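(* Suppose there exists a function $v\colon [0,T]\times \mathbb{R}^n\to \mathbb{R}$ that is continuously differentiable in $t$ and twice continuously differentiable in $x$, satisfying $$\begin{cases}\mathcal{L}v(t,x)\leq 0, & \forall x\in \mathcal{X},\ \forall t \in [0,T],\\ \frac{\partial v(t,x)}{\partial t}\leq 0, & \forall x\in \partial \mathcal{X},\ \forall t\in [0,T],\\ v(T,x)\geq 1_{\mathcal{X}_s}(x), & \forall x\in \overline{\mathcal{X}}.\end{cases}$$ Then $\mathbb{P}_{x_0}^{T}\leq v(0,x_0)$ for every $x_0\in \mathcal{X}\setminus \mathcal{X}_s$.
   Context: Let $b\colon\mathbb{R}^n\to\mathbb{R}^n$ and $\sigma\colon\mathbb{R}^n\to\mathbb{R}^{n\times k}$ be locally Lipschitz continuous, and let $W$ be a standard $k$-dimensional Wiener process on a probability space $(\Omega,\mathbb{P})$. For $x_0\in\mathbb{R}^n$, the SDE $dX=b(X)\,dt+\sigma(X)\,dW$ with initial state $x_0$ has a unique maximal local strong solution $X_{x_0}^{w}(t)$, $t\in[0,T^{x_0}(w))$, with continuous sample paths, where $T^{x_0}(w)\in(0,\infty]$. Let $\mathcal{X}\subseteq\mathbb{R}^n$ be open and bounded, $\mathcal{X}_s\subseteq\mathcal{X}$ a closed set, and $0<T<\infty$. An overline denotes closure, $\partial$ denotes topological boundary, and $1_A$ is the indicator function of $A$. For $x_0\in\mathcal{X}\setminus\mathcal{X}_s$ define $$\mathbb{P}_{x_0}^{T}:=\mathbb{P}\big(\{w\in\Omega \mid X_{x_0}^{w}(T)\in\mathcal{X}_s\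 \wedge\ \forall\tau\in[0,T).\ X_{x_0}^{w}(\tau)\in\mathcal{X}\}\big),$$ where the path is required to be defined at the times involved. For a function $v(t,x)$ that is continuously differentiable in $t$ and twice continuously differentiable in $x$ (class $C^{1,2}$), $$\mathcal{L}v(t,x)=\frac{\partial v(t,x)}{\partial t}+\frac{\partial v(t,x)}{\partial x}b(x)+\frac12\mathrm{tr}\Big(\sigma(x)^{\top}\frac{\partial^2 v(t,x)}{\partial x^2}\sigma(x)\Big).$$ *)

theory Defs
  imports "HOL-Probability.Probability"
begin

text \<open>A matrix with \<open>n\<close> rows and \<open>k\<close> columns has type \<^typ>\<open>real ^ 'k ^ 'n\<close>; its norm is the
  Frobenius norm.\<close>

definition wiener_process :: "'a measure \<Rightarrow> (real \<Rightarrow> 'a \<Rightarrow> real ^ 'k) \<Rightarrow> bool" where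
  "wiener_process M W \<longleftrightarrow>
     prob_space M \<and>
     (\<forall>t\<ge>0. W t \<in> borel_measurable M) \<and>
     (AE \<omega> in M. W 0 \<omega> = 0) \<and>
     (AE \<omega> in M. continuous_on {0..} (\<lambda>t. W t \<omega>)) \<and>
     (\<forall>n (p :: nat \<Rightarrow> real). 0 \<le> p 0 \<and> mono p \<longrightarrow>
        prob_space.indep_vars M (\<lambda>_. borel) (\<lambda>i \<omega>. W (p (Suc i)) \<omega> - W (p i) \<omega>) {..<n}) \<and>
     (\<forall>s t. 0 \<le> s \<and> s < t \<longrightarrow>
        distributed M lborel (\<lambda>\<omega>. W t \<omega> - W s \<omega>)
          (\<lambda>x. ennreal (\<Prod>j\<in>UNIV. normal_density 0 (sqrt (t - s)) (x $ j))))"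

text \<open>The filtration generated by \<open>W\<close>, augmented by the null sets. Only its \<open>\<sigma>\<close>-algebras matter;
  the measure component of \<open>brownian_filtration M W t\<close> is irrelevant.\<close>

definition brownian_filtration ::
    "'a measure \<Rightarrow> (real \<Rightarrow> 'a \<Rightarrow> real ^ 'k) \<Rightarrow> real \<Rightarrow> 'a measure" where
  "brownian_filtration M W t =
     sigma (space M)
       ({W s -` A \<inter> space M | s A. 0 \<le> s \<and> s \<le> t \<and> A \<in> sets borel} \<union> null_sets M)"

text \<open>The simple process \<open>\<Sum>i<N. 1\<^bsub>(p i, p (i + 1)]\<^esub> \<xi> i\<close> and its stochastic integral over \<open>[0, t]\<close>.\<close>

definition simple_integrand ::
    "(real \<Rightarrow> 'a measure) \<Rightarrow> nat \<Rightarrow> (nat \<Rightarrow> real) \<Rightarrow> (nat \<Rightarrow> 'a \<Rightarrow> real ^ 'k ^ 'n) \<Rightarrow> bool" where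
  "simple_integrand F N p \<xi> \<longleftrightarrow>
     0 \<le> p 0 \<and> mono p \<and>
     (\<forall>i<N. \<xi> i \<in> borel_measurable (F (p i)) \<and>
            (\<exists>C. \<forall>\<omega>\<in>space (F (p i)). norm (\<xi> i \<omega>) \<le> C))"

definition simple_process ::
    "nat \<Rightarrow> (nat \<Rightarrow> real) \<Rightarrow> (nat \<Rightarrow> 'a \<Rightarrow> real ^ 'k ^ 'n) \<Rightarrow> real \<Rightarrow> 'a \<Rightarrow> real ^ 'k ^ 'n" where
  "simple_process N p \<xi> s \<omega> = (\<Sum>i<N. indicator {p i<..p (Suc i)} s *\<^sub>R \<xi> i \<omega>)"

definition simple_integral ::
    "(real \<Rightarrow> 'a \<Rightarrow> real ^ 'k) \<Rightarrow> nat \<Rightarrow> (nat \<Rightarrow> real) \<Rightarrow> (nat \<Rightarrow> 'a \<Rightarrow> real ^ 'k ^ 'n) \<Rightarrow>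
     real \<Rightarrow> 'a \<Rightarrow> real ^ 'n" where
  "simple_integral W N p \<xi> t \<omega> =
     (\<Sum>i<N. \<xi> i \<omega> *v (W (min t (p (Suc i))) \<omega> - W (min t (p i)) \<omega>))"

text \<open>The Ito integral of \<open>H\<close> over \<open>[0, t]\<close> as the \<open>L\<^sup>2\<close>-limit of integrals of simple processes.
  The square integrability of \<open>H\<close> on \<open>[0, t] \<times> \<Omega>\<close> is implied by the existence of the approximation.
  As a limit in \<open>L\<^sup>2\<close>, the integral is determined up to a null set.\<close>

definition progressively_measurable ::
    "(real \<Rightarrow> 'a measure) \<Rightarrow> (real \<Rightarrow> 'a \<Rightarrow> 'b::topological_space) \<Rightarrow> bool" where
  "progressively_measurable F H \<longleftrightarrow>
     (\<forall>t\<ge>0. (\<lambda>(s, \<omega>). H s \<omega>)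
              \<in> borel_measurable (restrict_space borel {0..t} \<Otimes>\<^sub>M F t))"

definition has_ito_integral ::
    "'a measure \<Rightarrow> (real \<Rightarrow> 'a measure) \<Rightarrow> (real \<Rightarrow> 'a \<Rightarrow> real ^ 'k) \<Rightarrow>
     (real \<Rightarrow> 'a \<Rightarrow> real ^ 'k ^ 'n) \<Rightarrow> real \<Rightarrow> ('a \<Rightarrow> real ^ 'n) \<Rightarrow> bool" where
  "has_ito_integral M F W H t I \<longleftrightarrow>
     progressively_measurable F H \<and> I \<in> borel_measurable M \<and>
     (\<exists>N p \<xi>. (\<forall>m. simple_integrand F (N m) (p m) (\<xi> m)) \<and>
        (\<lambda>m. \<integral>\<^sup>+\<omega>. (\<integral>\<^sup>+s. ennreal ((norm (simple_process (N m) (p m) (\<xi> m) s \<omega> - H s \<omega>))\<^sup>2)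
                       * indicator {0..t} s \<partial>lborel) \<partial>M) \<longlonglongrightarrow> 0 \<and>
        (\<lambda>m. \<integral>\<^sup>+\<omega>. ennreal ((norm (simple_integral W (N m) (p m) (\<xi> m) t \<omega> - I \<omega>))\<^sup>2) \<partial>M)
          \<longlonglongrightarrow> 0)"

text \<open>Strong solutions of \<open>dX = b(X) dt + \<sigma>(X) dW\<close>, \<open>X(0) = x0\<close>, on the random interval \<open>[0, \<zeta>)\<close>;
  the values of \<open>X t \<omega>\<close> for \<open>t \<ge> \<zeta> \<omega>\<close> are irrelevant. The stopping times \<open>\<tau> m\<close> increase to \<open>\<zeta>\<close> and stay
  below it, and the integral equation is required up to each of them, that is,
  \<open>X(t \<and> \<tau>) = x0 + \<integral>\<^sub>0\<^bsup>t \<and> \<tau>\<^esup> b(X) ds + \<integral>\<^sub>0\<^sup>t 1\<^bsub>s \<le> \<tau>\<^esub> \<sigma>(X) dW\<close> almost surely for \<open>\<tau> = \<tau> m\<close>.\<close>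

definition local_strong_solution ::
    "'a measure \<Rightarrow> (real \<Rightarrow> 'a \<Rightarrow> real ^ 'k) \<Rightarrow> (real ^ 'n \<Rightarrow> real ^ 'n) \<Rightarrow>
     (real ^ 'n \<Rightarrow> real ^ 'k ^ 'n) \<Rightarrow> real ^ 'n \<Rightarrow>
     (real \<Rightarrow> 'a \<Rightarrow> real ^ 'n) \<Rightarrow> ('a \<Rightarrow> ereal) \<Rightarrow> bool" where
  "local_strong_solution M W b \<sigma> x0 X \<zeta> \<longleftrightarrow>
     (let F = brownian_filtration M W in
      (\<forall>\<omega>\<in>space M. 0 < \<zeta> \<omega> \<and> X 0 \<omega> = x0 \<and>
          continuous_on {t. 0 \<le> t \<and> ereal t < \<zeta> \<omega>} (\<lambda>t. X t \<omega>)) \<and>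
      (\<forall>t\<ge>0. {\<omega> \<in> space M. ereal t < \<zeta> \<omega>} \<in> sets (F t) \<and>
              X t \<in> borel_measurable (restrict_space (F t) {\<omega> \<in> space M. ereal t < \<zeta> \<omega>})) \<and>
      (\<exists>\<tau> :: nat \<Rightarrow> 'a \<Rightarrow> real.
         (\<forall>m. stopping_time F (\<tau> m)) \<and>
         (\<forall>\<omega>\<in>space M. (\<forall>m. 0 \<le> \<tau> m \<omega> \<and> \<tau> m \<omega> \<le> \<tau> (Suc m) \<omega> \<and> ereal (\<tau> m \<omega>) < \<zeta> \<omega>) \<and>
            (\<lambda>m. ereal (\<tau> m \<omega>)) \<longlonglongrightarrow> \<zeta> \<omega>) \<and>
         (\<forall>m. \<forall>t\<ge>0. has_ito_integral M F W
            (\<lambda>s \<omega>. indicator {..\<tau> m \<omega>} s *\<^sub>R \<sigma> (X s \<omega>)) t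
            (\<lambda>\<omega>. X (min t (\<tau> m \<omega>)) \<omega> - x0
                  - integral {0..min t (\<tau> m \<omega>)} (\<lambda>s. b (X s \<omega>))))))"

definition maximal_local_strong_solution ::
    "'a measure \<Rightarrow> (real \<Rightarrow> 'a \<Rightarrow> real ^ 'k) \<Rightarrow> (real ^ 'n \<Rightarrow> real ^ 'n) \<Rightarrow>
     (real ^ 'n \<Rightarrow> real ^ 'k ^ 'n) \<Rightarrow> real ^ 'n \<Rightarrow>
     (real \<Rightarrow> 'a \<Rightarrow> real ^ 'n) \<Rightarrow> ('a \<Rightarrow> ereal) \<Rightarrow> bool" where
  "maximal_local_strong_solution M W b \<sigma> x0 X \<zeta> \<longleftrightarrow>
     local_strong_solution M W b \<sigma> x0 X \<zeta> \<and>
     (\<forall>Y \<eta>. local_strong_solution M W b \<sigma> x0 Y \<eta> \<longrightarrow>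
        (AE \<omega> in M. \<zeta> \<omega> \<le> \<eta> \<omega> \<and> (\<forall>t\<ge>0. ereal t < \<zeta> \<omega> \<longrightarrow> Y t \<omega> = X t \<omega>)) \<longrightarrow>
        (AE \<omega> in M. \<eta> \<omega> = \<zeta> \<omega>))"

definition reach_avoid_prob ::
    "'a measure \<Rightarrow> (real \<Rightarrow> 'a \<Rightarrow> 'b) \<Rightarrow> ('a \<Rightarrow> ereal) \<Rightarrow> 'b set \<Rightarrow> 'b set \<Rightarrow> real \<Rightarrow> real" where
  "reach_avoid_prob M X \<zeta> D S T =
     measure M {\<omega> \<in> space M. ereal T < \<zeta> \<omega> \<and> X T \<omega> \<in> S \<and> (\<forall>s\<in>{0..<T}. X s \<omega> \<in> D)}"

text \<open>\<open>v\<close> is of class \<open>C\<^sup>1\<^sup>,\<^sup>2\<close> on \<open>[0, T] \<times> \<real>\<^sup>n\<close> with time derivative \<open>vt\<close> (one-sided at \<open>0\<close> and \<open>T\<close>),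
  spatial gradient \<open>vx\<close> and spatial Hessian \<open>vxx\<close>. For \<open>T > 0\<close> these are determined by \<open>v\<close>
  on \<open>[0, T] \<times> \<real>\<^sup>n\<close>.\<close>

definition C12_on ::
    "real \<Rightarrow> (real \<Rightarrow> real ^ 'n \<Rightarrow> real) \<Rightarrow> (real \<Rightarrow> real ^ 'n \<Rightarrow> real) \<Rightarrow>
     (real \<Rightarrow> real ^ 'n \<Rightarrow> real ^ 'n) \<Rightarrow> (real \<Rightarrow> real ^ 'n \<Rightarrow> real ^ 'n ^ 'n) \<Rightarrow> bool" where
  "C12_on T v vt vx vxx \<longleftrightarrow>
     (\<forall>t\<in>{0..T}. \<forall>x.
        ((\<lambda>s. v s x) has_real_derivative vt t x) (at t within {0..T}) \<and>
        (v t has_derivative (\<lambda>h. vx t x \<bullet> h)) (at x) \<and>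
        (vx t has_derivative (\<lambda>h. vxx t x *v h)) (at x)) \<and>
     continuous_on ({0..T} \<times> UNIV) (\<lambda>(t, x). v t x) \<and>
     continuous_on ({0..T} \<times> UNIV) (\<lambda>(t, x). vt t x) \<and>
     continuous_on ({0..T} \<times> UNIV) (\<lambda>(t, x). vx t x) \<and>
     continuous_on ({0..T} \<times> UNIV) (\<lambda>(t, x). vxx t x)"

text \<open>The operator \<open>\<L>v\<close>, expressed through the derivatives of \<open>v\<close>.\<close>

definition generator ::
    "(real ^ 'n \<Rightarrow> real ^ 'n) \<Rightarrow> (real ^ 'n \<Rightarrow> real ^ 'k ^ 'n) \<Rightarrow> (real \<Rightarrow> real ^ 'n \<Rightarrow> real) \<Rightarrow>
     (real \<Rightarrow> real ^ 'n \<Rightarrow> real ^ 'n) \<Rightarrow> (real \<Rightarrow> real ^ 'n \<Rightarrow> real ^ 'n ^ 'n) \<Rightarrow>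
     real \<Rightarrow> real ^ 'n \<Rightarrow> real" where
  "generator b \<sigma> vt vx vxx t x =
     vt t x + vx t x \<bullet> b x + 1/2 * trace (transpose (\<sigma> x) ** vxx t x ** \<sigma> x)"

end

theory Submission
  imports Defs
begin

text \<open>
  The weak maximum principle, applied to \<open>v + \<epsilon> (T - t)\<close>, gives \<open>v \<ge> 0\<close> on \<open>[0, T] \<times> D\<close>. Hence an explosion
  inside \<open>D\<close> does no harm: it suffices to bound, for each localizing stopping time \<open>\<tau>\<close>, the probability of
  reaching \<open>S\<close> at time \<open>T \<le> \<tau>\<close>.

  Instead of stopping the Ito integral, one runs along a grid \<open>t\<^sub>i = i T / K\<close> and stops at the first grid point
  after the exit from \<open>D\<close> or after \<open>\<tau>\<close>. In one step, Taylor's formula bounds the increment of \<open>v(t, X)\<close>. Its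
  stochastic part has mean zero, and by the Ito isometry with a weight known at the beginning of the step the
  second order part has the mean of a time integral. So the sum of the steps is a Riemann sum of
  \<open>\<L>v(t, X) \<le> 0\<close>, up to a remainder controlled by \<open>\<Sum> |\<Delta>I\<^sub>i|\<^sup>2 1(|\<Delta>I\<^sub>i| > \<eta>)\<close>. That sum vanishes in \<open>L\<^sup>1\<close>: split
  the integrand into a simple process, whose fourth moments are small, and a remainder that is small in \<open>L\<^sup>2\<close>.
  Letting \<open>K \<rightarrow> \<infinity>\<close> gives \<open>P(reach) \<le> v(0, x\<^sub>0)\<close>. To keep everything bounded beyond \<open>D\<close>, only the
  values of \<open>v\<close> and of the drift are truncated.
\<close>

section \<open>Brownian increments\<close>

text \<open>The definition of the Ito integral provides, for each time separately, an approximating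
  sequence of its own and a value up to a null set. By the isometry, one sequence chosen at the
  horizon serves for all earlier times. A stopping time inside the integral is replaced by a 0/1
  gate, known at the left end of each step; the gated steps telescope to a value at a grid point.
  This point lies after the exit, so that nothing known in \<open>D\<close> controls the value
  there. Continuity of the path brings it close to the nonnegative value at the last open grid
  point, and its negative part disappears in the limit. Up to \<open>\<tau>\<close> the path may
  leave \<open>D\<close>, so the integrand is only known to be square integrable, and the Taylor
  remainder cannot be estimated directly by fourth moments of the increments.\<close>

lemma integral_lborel_vec_prod:
  fixes f :: "'k::finite \<Rightarrow> real \<Rightarrow> real"
  assumes f: "\<And>j. integrable lborel (f j)"
  shows "integrable lborel (\<lambda>x::real^'k. \<Prod>j\<in>UNIV. f j (x $ j))" (is ?g1)
    and "(\<integral>x. (\<Prod>j\<in>UNIV. f j ((x::real^'k) $ j)) \<partial>lborel) = (\<Prod>j\<in>UNIV. \<integral>x. f j x \<partial>lborel)" (is ?g2)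
proof -
  interpret product_sigma_finite "\<lambda>_::real^'k. lborel :: real measure" by standard
  \<comment> \<open>\<open>lborel_eq\<close> presents Lebesgue measure as the image of a product
    over \<open>Basis\<close>, so the factors have to be indexed by basis vectors; off the axis
    vectors the value of \<open>g\<close> is arbitrary.\<close>
  define g where "g b = f (THE j. b = axis j 1)" for b :: "real^'k"
  have g: "g (axis j 1) = f j" for j
    unfolding g_def by (rule arg_cong[where f=f], rule the_equality) (auto simp: axis_eq_axis)
  have inj: "inj (\<lambda>j. axis j (1::real))" by (auto simp: inj_def axis_eq_axis)
  have B: "(Basis :: (real^'k) set) = range (\<lambda>j. axis j 1)"
    by (auto simp: Basis_vec_def)
  have gi: "integrable lborel (g b)" if "b \<in> Basis" for b
    using that f g by (auto simp: B)
  have eq: "(\<Prod>j\<in>UNIV. f j ((\<Sum>b\<in>Basis. y b *\<^sub>R b :: real^'k) $ j)) = (\<Prod>b\<in>Basis. g b (y b))" for y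
  proof -
    have "(\<Sum>b\<in>Basis. y b *\<^sub>R b :: real^'k) $ j = y (axis j 1)" for j
    proof -
      have "(\<Sum>b\<in>Basis. y b *\<^sub>R b :: real^'k) $ j = (\<Sum>b\<in>Basis. y b *\<^sub>R b) \<bullet> axis j 1"
        by (simp add: inner_axis)
      also have "\<dots> = y (axis j 1)" by (rule inner_sum_left_Basis) (auto simp: B)
      finally show ?thesis .
    qed
    then show ?thesis unfolding B by (subst prod.reindex[OF inj]) (simp add: g)
  qed
  have m: "(\<lambda>y. \<Sum>b\<in>Basis. y b *\<^sub>R b :: real^'k) \<in> measurable (\<Pi>\<^sub>M b\<in>Basis. lborel) borel"
  proof (intro borel_measurable_sum borel_measurable_scaleR borel_measurable_const)
    fix b :: "real^'k" assume "b \<in> Basis"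
    then show "(\<lambda>y. y b) \<in> borel_measurable (\<Pi>\<^sub>M b\<in>(Basis :: (real^'k) set). lborel)"
      using measurable_component_singleton[of b Basis "\<lambda>_. lborel"] by simp
  qed
  have mm: "(\<lambda>x::real^'k. \<Prod>j\<in>UNIV. f j (x $ j)) \<in> borel_measurable borel"
  proof (intro borel_measurable_prod)
    fix j
    have "f j \<in> borel_measurable borel" using borel_measurable_integrable[OF f[of j]] by simp
    moreover have "(\<lambda>x::real^'k. x $ j) \<in> borel_measurable borel"
      by (intro borel_measurable_continuous_onI continuous_intros)
    ultimately show "(\<lambda>x::real^'k. f j (x $ j)) \<in> borel_measurable borel"
      by (rule measurable_compose[rotated])
  qed
  show ?g1
    unfolding lborel_eq[where 'a="real^'k"]
    by (subst integrable_distr_eq[OF m mm], subst eq, rule product_integrable_prod) (auto intro: gi)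
  have "(\<integral>x. (\<Prod>j\<in>UNIV. f j ((x::real^'k) $ j)) \<partial>lborel) = (\<Prod>b\<in>Basis. \<integral>x. g b x \<partial>lborel)"
    unfolding lborel_eq[where 'a="real^'k"]
    by (subst integral_distr[OF m mm], subst eq, rule product_integral_prod) (auto intro: gi)
  also have "\<dots> = (\<Prod>j\<in>UNIV. \<integral>x. f j x \<partial>lborel)"
    unfolding B by (subst prod.reindex[OF inj]) (simp add: g)
  finally show ?g2 .
qed

section \<open>The augmented filtration and independence of later increments\<close>

locale brownian = prob_space M for M :: "'a measure" +
  fixes W :: "real \<Rightarrow> 'a \<Rightarrow> real ^ 'k"
  assumes wiener: "wiener_process M W"
begin

abbreviation F where "F \<equiv> brownian_filtration M W"

abbreviation incr where "incr s t \<omega> \<equiv> W t \<omega> - W s \<omega>"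

lemma W_measurable [measurable]: "0 \<le> t \<Longrightarrow> W t \<in> borel_measurable M"
  using wiener by (auto simp: wiener_process_def)

lemma space_F [simp]: "space (F t) = space M"
  unfolding brownian_filtration_def
  by (rule space_measure_of) (auto dest: sets.sets_into_space null_setsD2)

lemma sets_F: "sets (F t) = sigma_sets (space M)
    ({W s -` A \<inter> space M | s A. 0 \<le> s \<and> s \<le> t \<and> A \<in> sets borel} \<union> null_sets M)"
  unfolding brownian_filtration_def
  by (rule sets_measure_of) (auto dest: sets.sets_into_space null_setsD2)

lemma sets_F_le: "sets (F t) \<subseteq> sets M"
  unfolding sets_F
  by (rule sets.sigma_sets_subset) (auto intro: measurable_sets[OF W_measurable])

lemma sets_F_mono: "s \<le> t \<Longrightarrow> sets (F s) \<subseteq> sets (F t)"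
  unfolding sets_F by (rule sigma_sets_mono') (auto intro: order_trans)

lemma measurable_F_M: "f \<in> measurable (F t) N \<Longrightarrow> f \<in> measurable M N"
  using sets_F_le[of t] by (auto simp: measurable_def)

lemma measurable_F_mono: "f \<in> measurable (F s) N \<Longrightarrow> s \<le> t \<Longrightarrow> f \<in> measurable (F t) N"
  using sets_F_mono[of s t] by (auto simp: measurable_def)

lemma W_measurable_F: "0 \<le> s \<Longrightarrow> s \<le> t \<Longrightarrow> W s \<in> borel_measurable (F t)"
  by (rule measurableI) (auto simp: sets_F)

text \<open>Finite-dimensional cylinders up to time \<open>t\<close>, modulo null sets. Agreement
  almost everywhere puts the null sets of the augmentation into the same intersection-stable class,
  so one generator of \<open>F t\<close> serves for the independence argument.\<close>

definition cylinder_sets :: "real \<Rightarrow> 'a set set" where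
  "cylinder_sets t = {A \<in> sets M. \<exists>J B. finite J \<and> J \<subseteq> {0..t} \<and> (\<forall>j. B j \<in> sets borel) \<and>
     (AE \<omega> in M. \<omega> \<in> A \<longleftrightarrow> (\<forall>j\<in>J. W j \<omega> \<in> B j))}"

lemma Int_stable_cylinder_sets: "Int_stable (cylinder_sets t)"
proof (rule Int_stableI)
  fix A A' assume A: "A \<in> cylinder_sets t" "A' \<in> cylinder_sets t"
  from A(1) obtain J B where 1: "A \<in> sets M" "finite J" "J \<subseteq> {0..t}" "\<And>j. B j \<in> sets borel"
    "AE \<omega> in M. \<omega> \<in> A \<longleftrightarrow> (\<forall>j\<in>J. W j \<omega> \<in> B j)" unfolding cylinder_sets_def by blast
  from A(2) obtain J' B' where 2: "A' \<in> sets M" "finite J'" "J' \<subseteq> {0..t}" "\<And>j. B' j \<in> sets borel"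
    "AE \<omega> in M. \<omega> \<in> A' \<longleftrightarrow> (\<forall>j\<in>J'. W j \<omega> \<in> B' j)" unfolding cylinder_sets_def by blast
  define C where "C j = (if j \<in> J then B j else UNIV) \<inter> (if j \<in> J' then B' j else UNIV)" for j
  have "AE \<omega> in M. \<omega> \<in> A \<inter> A' \<longleftrightarrow> (\<forall>j\<in>J \<union> J'. W j \<omega> \<in> C j)"
    using 1(5) 2(5) by eventually_elim (auto simp: C_def)
  moreover have "\<forall>j. C j \<in> sets borel" using 1(4) 2(4) by (auto simp: C_def)
  moreover have "finite (J \<union> J')" "J \<union> J' \<subseteq> {0..t}" "A \<inter> A' \<in> sets M" using 1 2 by auto
  ultimately show "A \<inter> A' \<in> cylinder_sets t" unfolding cylinder_sets_def by blast
qed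

lemma sets_F_cylinder:
  assumes t: "0 \<le> t"
  shows "sets (F t) \<subseteq> sigma_sets (space M) (cylinder_sets t)"
  unfolding sets_F
proof (rule sigma_sets_mono', safe)
  fix s :: real and A :: "(real^'k) set" assume s: "0 \<le> s" "s \<le> t" "A \<in> sets borel"
  then have "W s -` A \<inter> space M \<in> sets M" by simp
  moreover have "AE \<omega> in M. \<omega> \<in> W s -` A \<inter> space M \<longleftrightarrow> (\<forall>j\<in>{s}. W j \<omega> \<in> A)" by auto
  ultimately show "W s -` A \<inter> space M \<in> cylinder_sets t"
    unfolding cylinder_sets_def using s
    by (intro CollectI conjI exI[of _ "{s}"] exI[of _ "\<lambda>_. A"]) auto
next
  fix N assume N: "N \<in> null_sets M"
  have "AE \<omega> in M. \<omega> \<notin> N" using N by (rule AE_not_in)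
  \<comment> \<open>A null set agrees almost everywhere with the impossible event
    \<open>W 0 \<omega> \<in> {}\<close>.\<close>
  with N t show "N \<in> cylinder_sets t"
    unfolding cylinder_sets_def
    by (intro CollectI conjI exI[of _ "{0}"] exI[of _ "\<lambda>_. {}"]) auto
qed

lemma W_0: "AE \<omega> in M. W 0 \<omega> = 0"
  using wiener by (auto simp: wiener_process_def)

text \<open>Sort the finitely many times of the cylinder together with \<open>0\<close> and
  \<open>c\<close>. Since \<open>W 0 = 0\<close> almost surely, each \<open>W j\<close> is a partial
  sum of consecutive increments, so the cylinder is an event of the increments before
  \<open>c\<close>, and \<open>incr c d\<close> is the next member of an independent family.\<close>

lemma prob_cylinder_increment:
  assumes A: "A \<in> cylinder_sets c" and c: "0 \<le> c" "c < d" and U: "U \<in> sets borel"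
  shows "prob (A \<inter> ((\<lambda>\<omega>. incr c d \<omega>) -` U \<inter> space M)) =
         prob A * prob ((\<lambda>\<omega>. incr c d \<omega>) -` U \<inter> space M)"
proof -
  from A obtain J B where J: "A \<in> sets M" "finite J" "J \<subseteq> {0..c}" "\<And>j. B j \<in> sets borel"
    "AE \<omega> in M. \<omega> \<in> A \<longleftrightarrow> (\<forall>j\<in>J. W j \<omega> \<in> B j)" unfolding cylinder_sets_def by blast
  \<comment> \<open>\<open>0\<close> is inserted so that the partial sums start at
    \<open>W 0\<close>, and \<open>c\<close> so that the block after the sorted times is exactly the
    one from \<open>c\<close> to \<open>d\<close>.\<close>
  define xs where "xs = sorted_list_of_set (insert 0 (insert c J))"
  have set_xs: "set xs = insert 0 (insert c J)" 
    unfolding xs_def by (rule set_sorted_list_of_set) (use J(2) in simp)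
  have sorted: "sorted xs" by (simp add: xs_def)
  have ne: "xs \<noteq> []" using set_xs by auto
  define n where "n = length xs - 1"
  have len: "length xs = Suc n" using ne by (simp add: n_def)
  \<comment> \<open>The definition of a Wiener process speaks of monotone time sequences indexed by
    all naturals, so the list is continued by the constant \<open>d\<close>.\<close>
  define p where "p i = (if i \<le> n then xs ! i else d)" for i
  have in_xs: "p i \<in> set xs" if "i \<le> n" for i using that len by (simp add: p_def)
  have le_c: "x \<in> set xs \<Longrightarrow> 0 \<le> x \<and> x \<le> c" for x using set_xs J(3) c by auto
  have mono: "mono p"
  proof (rule monoI)
    fix i j :: nat assume "i \<le> j"
    show "p i \<le> p j"
    proof (cases "j \<le> n")
      case True
      with \<open>i \<le> j\<close> sorted len show ?thesis by (simp add: p_def sorted_iff_nth_mono)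
    next
      case False
      then show ?thesis using in_xs[of i] le_c[of "p i"] c by (cases "i \<le> n") (auto simp: p_def)
    qed
  qed
  have ex: "\<exists>i\<le>n. p i = x" if "x \<in> set xs" for x
    using that len by (auto simp: in_set_conv_nth p_def)
  have p0: "p 0 = 0"
  proof -
    obtain i where "i \<le> n" "p i = 0" using ex[of 0] set_xs by auto
    with monoD[OF mono, of 0 i] in_xs[of 0] le_c[of "p 0"] show ?thesis by auto
  qed
  have pn: "p n = c"
  proof -
    obtain i where "i \<le> n" "p i = c" using ex[of c] set_xs by auto
    with monoD[OF mono, of i n] in_xs[of n] le_c[of "p n"] show ?thesis by auto
  qed
  have pSn: "p (Suc n) = d" by (simp add: p_def)
  let ?X = "\<lambda>i \<omega>. incr (p i) (p (Suc i)) \<omega>"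
  have ind: "indep_vars (\<lambda>_. borel) ?X {..<Suc n}"
    using wiener mono p0 unfolding wiener_process_def by auto
  have iv: "indep_var (PiM {..<n} (\<lambda>_. borel)) (\<lambda>\<omega>. restrict (\<lambda>i. ?X i \<omega>) {..<n})
                 (PiM {n} (\<lambda>_. borel)) (\<lambda>\<omega>. restrict (\<lambda>i. ?X i \<omega>) {n})"
    by (rule indep_var_restrict[OF ind]) auto
  obtain k where k: "\<And>j. j \<in> J \<Longrightarrow> k j \<le> n \<and> p (k j) = j"
    using ex set_xs by (metis insertCI)
  \<comment> \<open>The cylinder, rewritten as a condition on the vector of the first
    \<open>n\<close> increments.\<close>
  define V where "V = {f \<in> space (PiM {..<n} (\<lambda>_. borel :: (real^'k) measure)). \<forall>j\<in>J. (\<Sum>i<k j. f i) \<in> B j}"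
  have V: "V \<in> sets (PiM {..<n} (\<lambda>_. borel))"
    unfolding V_def
  proof (intro sets.sets_Collect_finite_All J(2))
    fix j assume "j \<in> J"
    with k have "k j \<le> n" by auto
    then have "(\<lambda>f. \<Sum>i<k j. f i) \<in> borel_measurable (PiM {..<n} (\<lambda>_. borel :: (real^'k) measure))"
      by (intro borel_measurable_sum measurable_component_singleton) auto
    from measurable_sets[OF this J(4)[of j]]
    show "{f \<in> space (PiM {..<n} (\<lambda>_. borel :: (real^'k) measure)). (\<Sum>i<k j. f i) \<in> B j} \<in> sets (PiM {..<n} (\<lambda>_. borel))"
      by (simp add: vimage_def Int_def conj_commute)
  qed
  define U' where "U' = {f \<in> space (PiM {n} (\<lambda>_. borel :: (real^'k) measure)). f n \<in> U}"
  have U': "U' \<in> sets (PiM {n} (\<lambda>_. borel))"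
    using measurable_sets[OF measurable_component_singleton[of n "{n}" "\<lambda>_. borel"] U]
    by (simp add: U'_def vimage_def Int_def conj_commute)
  let ?R = "\<lambda>\<omega>. restrict (\<lambda>i. ?X i \<omega>) {..<n}" and ?D = "\<lambda>\<omega>. incr c d \<omega>"
  have R_sets: "?R -` V \<inter> space M \<in> sets M"
    using indep_var_rv1[OF iv] V by (rule measurable_sets)
  have c_d: "0 \<le> d" using c by simp
  have D_sets: "?D -` U \<inter> space M \<in> sets M"
    using U c c_d by (intro measurable_sets[of _ _ borel]) auto
  have sp: "restrict f I \<in> space (PiM I (\<lambda>_. borel :: (real^'k) measure))" for f and I :: "nat set"
    by (simp add: space_PiM)
  have tele: "(\<Sum>i<m. incr (p i) (p (Suc i)) \<omega>) = incr (p 0) (p m) \<omega>" for m \<omega>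
    by (rule sum_lessThan_telescope)
  have AR: "AE \<omega> in M. \<omega> \<in> A \<longleftrightarrow> \<omega> \<in> ?R -` V \<inter> space M"
    using J(5) W_0 AE_space
  proof eventually_elim
    case (elim \<omega>)
    have "(\<Sum>i<k j. ?R \<omega> i) = W j \<omega>" if "j \<in> J" for j
    proof -
      have "(\<Sum>i<k j. ?R \<omega> i) = (\<Sum>i<k j. ?X i \<omega>)"
        using k[OF that] by (intro sum.cong) auto
      also have "\<dots> = W j \<omega>" using tele[of \<omega> "k j"] k[OF that] elim(2) by (simp add: p0)
      finally show ?thesis .
    qed
    then show ?case using elim(1,3) sp unfolding V_def by auto
  qed
  have Deq: "(\<lambda>\<omega>. restrict (\<lambda>i. ?X i \<omega>) {n}) -` U' \<inter> space M = ?D -` U \<inter> space M"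
    using sp by (auto simp: U'_def pSn pn)
  have "prob (A \<inter> (?D -` U \<inter> space M)) = prob ((?R -` V \<inter> space M) \<inter> (?D -` U \<inter> space M))"
    using AR J(1) R_sets D_sets by (intro measure_eq_AE) (auto elim: eventually_mono)
  also have "\<dots> = prob ((\<lambda>\<omega>. (?R \<omega>, restrict (\<lambda>i. ?X i \<omega>) {n})) -` (V \<times> U') \<inter> space M)"
    unfolding Deq[symmetric] by (intro arg_cong[where f=prob]) auto
  also have "\<dots> = prob (?R -` V \<inter> space M) * prob (?D -` U \<inter> space M)"
    unfolding indep_varD[OF iv V U'] Deq by simp
  also have "prob (?R -` V \<inter> space M) = prob A"
    using AR J(1) R_sets by (intro measure_eq_AE) (auto elim: eventually_mono)
  finally show ?thesis .
qed

text \<open>The cylinders and the events of the increment are both stable under intersection, so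
  independence passes from them to the generated \<sigma>-algebras; the one generated by the
  cylinders contains \<open>F c\<close>.\<close>

lemma indep_var_F_increment:
  assumes \<phi>: "\<phi> \<in> measurable (F c) N" and c: "0 \<le> c" "c < d" and g: "g \<in> measurable borel N'"
  shows "indep_var N \<phi> N' (\<lambda>\<omega>. g (incr c d \<omega>))"
  unfolding indep_var_eq
proof (intro conjI)
  show "random_variable N \<phi>" using \<phi> by (rule measurable_F_M)
  have rv: "random_variable borel (\<lambda>\<omega>. incr c d \<omega>)" using c by simp
  show "random_variable N' (\<lambda>\<omega>. g (incr c d \<omega>))" using measurable_compose[OF rv g] .
  let ?B = "{(\<lambda>\<omega>. incr c d \<omega>) -` A \<inter> space M |A. A \<in> sets borel}"
  let ?B' = "{(\<lambda>\<omega>. g (incr c d \<omega>)) -` A \<inter> space M |A. A \<in> sets N'}"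
  have "indep_set (cylinder_sets c) ?B"
    unfolding indep_sets2_eq
    using prob_cylinder_increment[OF _ c] measurable_sets[OF rv] by (auto simp: cylinder_sets_def)
  moreover have "Int_stable ?B"
  proof (rule Int_stableI, safe)
    fix A A' :: "(real^'k) set" assume "A \<in> sets borel" "A' \<in> sets borel"
    then show "\<exists>C. (\<lambda>\<omega>. incr c d \<omega>) -` A \<inter> space M \<inter> ((\<lambda>\<omega>. incr c d \<omega>) -` A' \<inter> space M) =
        (\<lambda>\<omega>. incr c d \<omega>) -` C \<inter> space M \<and> C \<in> sets borel"
      by (intro exI[of _ "A \<inter> A'"]) auto
  qed
  ultimately have *: "indep_set (sigma_sets (space M) (cylinder_sets c)) (sigma_sets (space M) ?B)"
    by (intro indep_set_sigma_sets Int_stable_cylinder_sets)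
  have "sigma_sets (space M) {\<phi> -` A \<inter> space M |A. A \<in> sets N} \<subseteq> sets (F c)"
    by (rule sets.sigma_sets_subset[of _ "F c", unfolded space_F]) (use measurable_sets[OF \<phi>] in auto)
  also have "\<dots> \<subseteq> sigma_sets (space M) (cylinder_sets c)"
    by (rule sets_F_cylinder[OF c(1)])
  finally have 1: "sigma_sets (space M) {\<phi> -` A \<inter> space M |A. A \<in> sets N} \<subseteq> sigma_sets (space M) (cylinder_sets c)" .
  have 2: "sigma_sets (space M) ?B' \<subseteq> sigma_sets (space M) ?B"
  proof (rule sigma_sets_mono', safe)
    fix A assume "A \<in> sets N'"
    with g have "g -` A \<in> sets borel" using measurable_sets[of g borel N' A] by simp
    then show "\<exists>C. (\<lambda>\<omega>. g (incr c d \<omega>)) -` A \<inter> space M = (\<lambda>\<omega>. incr c d \<omega>) -` C \<inter> space M \<and> C \<in> sets borel"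
      by (intro exI[of _ "g -` A"]) auto
  qed
  show "indep_set (sigma_sets (space M) {\<phi> -` A \<inter> space M |A. A \<in> sets N}) (sigma_sets (space M) ?B')"
    using * 1 2 unfolding indep_sets2_eq by blast
qed

section \<open>Gaussian moments of a single increment\<close>

lemma increment_prod_moment:
  fixes g :: "'k \<Rightarrow> real \<Rightarrow> real"
  assumes c: "0 \<le> c" "c < d"
    and g: "\<And>j. g j \<in> borel_measurable borel"
    and gi: "\<And>j. integrable lborel (\<lambda>x. normal_density 0 (sqrt (d - c)) x * g j x)"
  shows "integrable M (\<lambda>\<omega>. \<Prod>j\<in>UNIV. g j (incr c d \<omega> $ j))" (is ?g1)
    and "expectation (\<lambda>\<omega>. \<Prod>j\<in>UNIV. g j (incr c d \<omega> $ j)) =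
           (\<Prod>j\<in>UNIV. \<integral>x. normal_density 0 (sqrt (d - c)) x * g j x \<partial>lborel)" (is ?g2)
proof -
  have dist: "distributed M lborel (\<lambda>\<omega>. incr c d \<omega>)
          (\<lambda>x. ennreal (\<Prod>j\<in>UNIV. normal_density 0 (sqrt (d - c)) (x $ j)))"
    using wiener c unfolding wiener_process_def by auto
  have pos: "0 \<le> (\<Prod>j\<in>UNIV. normal_density 0 (sqrt (d - c)) ((x::real^'k) $ j))" for x
    by (intro prod_nonneg) auto
  have gm: "(\<lambda>x::real^'k. \<Prod>j\<in>UNIV. g j (x $ j)) \<in> borel_measurable lborel"
  proof (simp, intro borel_measurable_prod)
    fix j
    have "(\<lambda>x::real^'k. x $ j) \<in> borel_measurable borel"
      by (intro borel_measurable_continuous_onI continuous_intros)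
    then show "(\<lambda>x::real^'k. g j (x $ j)) \<in> borel_measurable borel"
      using g by (rule measurable_compose)
  qed
  note * = integral_lborel_vec_prod[where f="\<lambda>j x. normal_density 0 (sqrt (d - c)) x * g j x", OF gi]
  show ?g1
    using *(1) distributed_integrable[OF dist gm pos] by (simp add: prod.distrib)
  show ?g2
    using *(2) distributed_integral[OF dist gm pos] by (simp add: prod.distrib)
qed

text \<open>A product moment with the power in coordinate \<open>j\<close> and the constant
  \<open>1\<close> elsewhere, where the factors are total masses of the density.\<close>

lemma increment_power_moment:
  fixes j :: 'k
  assumes c: "0 \<le> c" "c < d"
  shows "integrable M (\<lambda>\<omega>. (incr c d \<omega> $ j) ^ m)" (is ?g1)
    and "expectation (\<lambda>\<omega>. (incr c d \<omega> $ j) ^ m) =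
           (\<integral>x. normal_density 0 (sqrt (d - c)) x * x ^ m \<partial>lborel)" (is ?g2)
proof -
  define g :: "'k \<Rightarrow> real \<Rightarrow> real" where "g i x = (if i = j then x ^ m else 1)" for i x
  have gm: "g i \<in> borel_measurable borel" for i unfolding g_def by (cases "i = j") auto
  have gi: "integrable lborel (\<lambda>x. normal_density 0 (sqrt (d - c)) x * g i x)" for i
    using c integrable_normal_moment[of "sqrt (d - c)" 0 m] integrable_normal_density[of "sqrt (d - c)" 0]
    by (cases "i = j") (auto simp: g_def)
  have 1: "(\<Prod>i\<in>UNIV. g i (x $ i)) = (x $ j) ^ m" for x :: "real^'k"
    by (simp add: g_def)
  have 2: "(\<Prod>i\<in>UNIV. \<integral>x. normal_density 0 (sqrt (d - c)) x * g i x \<partial>lborel) =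
      (\<integral>x. normal_density 0 (sqrt (d - c)) x * x ^ m \<partial>lborel)"
  proof -
    have "(\<Prod>i\<in>UNIV. \<integral>x. normal_density 0 (sqrt (d - c)) x * g i x \<partial>lborel) =
      (\<Prod>i\<in>UNIV. if i = j then \<integral>x. normal_density 0 (sqrt (d - c)) x * x ^ m \<partial>lborel else 1)"
      using c by (intro prod.cong refl) (auto simp: g_def)
    then show ?thesis by simp
  qed
  show ?g1
    using increment_prod_moment(1)[where g=g, OF c gm gi] unfolding 1 by simp
  show ?g2
    using increment_prod_moment(2)[where g=g, OF c gm gi] unfolding 1 2 by simp
qed

lemma increment_mean:
  assumes c: "0 \<le> c" "c \<le> d"
  shows "integrable M (\<lambda>\<omega>. incr c d \<omega> $ j)" "expectation (\<lambda>\<omega>. incr c d \<omega> $ j) = 0"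
proof -
  have "integrable M (\<lambda>\<omega>. incr c d \<omega> $ j) \<and> expectation (\<lambda>\<omega>. incr c d \<omega> $ j) = 0"
  \<comment> \<open>The Gaussian law is given for \<open>c < d\<close>; the degenerate increment is
    zero.\<close>
  proof (cases "c = d")
    case False
    with c have c: "0 \<le> c" "c < d" by auto
    show ?thesis
      using increment_power_moment[OF c, of j 1] integral_normal_moment_nz_1[of "sqrt (d - c)" 0] c by simp
  qed simp
  then show "integrable M (\<lambda>\<omega>. incr c d \<omega> $ j)" "expectation (\<lambda>\<omega>. incr c d \<omega> $ j) = 0"
    by auto
qed

lemma increment_fourth_moment:
  assumes c: "0 \<le> c" "c \<le> d"
  shows "integrable M (\<lambda>\<omega>. (incr c d \<omega> $ j) ^ 4)" (is ?g1)
    and "expectation (\<lambda>\<omega>. (incr c d \<omega> $ j) ^ 4) = 3 * (d - c)\<^sup>2"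
proof -
  have "integrable M (\<lambda>\<omega>. (incr c d \<omega> $ j) ^ 4) \<and>
    expectation (\<lambda>\<omega>. (incr c d \<omega> $ j) ^ 4) = 3 * (d - c)\<^sup>2"
  proof (cases "c = d")
    case False
    with c have c: "0 \<le> c" "c < d" by auto
    have "(\<integral>x. normal_density 0 (sqrt (d - c)) x * x ^ 4 \<partial>lborel) = 3 * (d - c)\<^sup>2"
      using integral_normal_moment_even[of "sqrt (d - c)" 0 2] c
      by (simp add: fact_numeral power2_eq_square field_simps)
    then show ?thesis
      using increment_power_moment[OF c, of j 4] by simp
  qed simp
  then show ?g1
    and "expectation (\<lambda>\<omega>. (incr c d \<omega> $ j) ^ 4) = 3 * (d - c)\<^sup>2" by auto
qed

lemma increment_covariance:
  assumes c: "0 \<le> c" "c \<le> d"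
  shows "integrable M (\<lambda>\<omega>. incr c d \<omega> $ j * incr c d \<omega> $ l)" (is ?g1)
    and "expectation (\<lambda>\<omega>. incr c d \<omega> $ j * incr c d \<omega> $ l) = (if j = l then d - c else 0)"
proof -
  have "integrable M (\<lambda>\<omega>. incr c d \<omega> $ j * incr c d \<omega> $ l) \<and>
    expectation (\<lambda>\<omega>. incr c d \<omega> $ j * incr c d \<omega> $ l) = (if j = l then d - c else 0)"
  proof (cases "c = d")
    case False
    with c have c: "0 \<le> c" "c < d" by auto
    show ?thesis
    proof (cases "j = l")
      case True
      have "(\<integral>x. normal_density 0 (sqrt (d - c)) x * x\<^sup>2 \<partial>lborel) = d - c"
        using integral_normal_moment_even[of "sqrt (d - c)" 0 1] c
        by (simp add: fact_numeral power2_eq_square field_simps)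
      then show ?thesis
        using increment_power_moment[OF c, of j 2] True by (simp add: power2_eq_square)
    next
      case False
      \<comment> \<open>The identity at the two coordinates and \<open>1\<close> elsewhere: the
        product then contains a vanishing first moment.\<close>
      define g :: "'k \<Rightarrow> real \<Rightarrow> real" where "g i x = (if i = j \<or> i = l then x else 1)" for i x
      have gm: "g i \<in> borel_measurable borel" for i unfolding g_def by (cases "i = j \<or> i = l") auto
      have gi: "integrable lborel (\<lambda>x. normal_density 0 (sqrt (d - c)) x * g i x)" for i
        using c integrable_normal_moment_nz_1[of "sqrt (d - c)" 0] integrable_normal_density[of "sqrt (d - c)" 0]
        by (cases "i = j \<or> i = l") (auto simp: g_def)
      have 1: "(\<Prod>i\<in>UNIV. g i (x $ i)) = x $ j * x $ l" for x :: "real^'k"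
      proof -
        have "(\<Prod>i\<in>UNIV. g i (x $ i)) = (\<Prod>i\<in>{j, l}. x $ i)"
          unfolding g_def by (intro prod.mono_neutral_cong_right) auto
        then show ?thesis using False by simp
      qed
      have "(\<integral>x. normal_density 0 (sqrt (d - c)) x * g j x \<partial>lborel) = 0"
        using integral_normal_moment_nz_1[of "sqrt (d - c)" 0] c by (simp add: g_def)
      then have 2: "(\<Prod>i\<in>UNIV. \<integral>x. normal_density 0 (sqrt (d - c)) x * g i x \<partial>lborel) = 0"
        by (intro prod_zero) auto
      show ?thesis
        using increment_prod_moment[where g=g, OF c gm gi] False unfolding 1 2 by simp
    qed
  qed simp
  then show ?g1
    and "expectation (\<lambda>\<omega>. incr c d \<omega> $ j * incr c d \<omega> $ l) = (if j = l then d - c else 0)"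
    by auto
qed

lemma integral_mult_increment:
  fixes \<psi> :: "'a \<Rightarrow> real" and g :: "real^'k \<Rightarrow> real"
  assumes \<psi>: "\<psi> \<in> borel_measurable (F c)" "integrable M \<psi>" and c: "0 \<le> c" "c \<le> d"
    and g: "g \<in> borel_measurable borel" "integrable M (\<lambda>\<omega>. g (incr c d \<omega>))"
  shows "integrable M (\<lambda>\<omega>. \<psi> \<omega> * g (incr c d \<omega>))" (is ?g1)
    and "expectation (\<lambda>\<omega>. \<psi> \<omega> * g (incr c d \<omega>)) = expectation \<psi> * expectation (\<lambda>\<omega>. g (incr c d \<omega>))"
proof -
  have "integrable M (\<lambda>\<omega>. \<psi> \<omega> * g (incr c d \<omega>)) \<and>
     expectation (\<lambda>\<omega>. \<psi> \<omega> * g (incr c d \<omega>)) = expectation \<psi> * expectation (\<lambda>\<omega>. g (incr c d \<omega>))"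
  proof (cases "c = d")
    case True
    then show ?thesis using \<psi>(2) by (simp add: prob_space)
  next
    case False
    with c have c: "0 \<le> c" "c < d" by auto
    have "indep_var borel \<psi> borel (\<lambda>\<omega>. g (incr c d \<omega>))"
      by (rule indep_var_F_increment[OF \<psi>(1) c g(1)])
    from indep_var_lebesgue_integral[OF this \<psi>(2) g(2)] indep_var_integrable[OF this \<psi>(2) g(2)]
    show ?thesis by simp
  qed
  then show ?g1
    and "expectation (\<lambda>\<omega>. \<psi> \<omega> * g (incr c d \<omega>)) = expectation \<psi> * expectation (\<lambda>\<omega>. g (incr c d \<omega>))"
    by auto
qed

end

section \<open>Matrix products as bounded bilinear maps\<close>

lemma bounded_bilinear_matrix_vector: "bounded_bilinear (\<lambda>(A::real^'m^'n) x. A *v x)"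
  unfolding bilinear_conv_bounded_bilinear[symmetric] bilinear_def linear_iff
  by (auto simp: matrix_vector_right_distrib matrix_vector_mult_add_rdistrib
      matrix_vector_mult_scaleR scaleR_matrix_vector_assoc)

lemma bounded_bilinear_matrix_matrix: "bounded_bilinear (\<lambda>(A::real^'m^'n) (B::real^'p^'m). A ** B)"
  unfolding bilinear_conv_bounded_bilinear[symmetric] bilinear_def linear_iff
  by (auto simp: vec_eq_iff matrix_matrix_mult_def sum.distrib algebra_simps sum_distrib_left)

lemma borel_measurable_bounded_bilinear:
  fixes h :: "'b::{real_normed_vector, second_countable_topology} \<Rightarrow>
    'c::{real_normed_vector, second_countable_topology} \<Rightarrow> 'd::real_normed_vector"
  assumes h: "bounded_bilinear h" and "f \<in> borel_measurable N" "g \<in> borel_measurable N"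
  shows "(\<lambda>x. h (f x) (g x)) \<in> borel_measurable N"
  using assms(2,3)
  by (rule borel_measurable_continuous_Pair) (intro bounded_bilinear.continuous_on[OF h] continuous_intros)

lemma borel_measurable_vec_nth [measurable (raw)]:
  "f \<in> borel_measurable N \<Longrightarrow> (\<lambda>x. f x $ i) \<in> borel_measurable N"
  by (erule measurable_compose) (intro borel_measurable_continuous_onI continuous_intros)

context brownian
begin

section \<open>Weighted products of two increments\<close>

lemma integrable_bounded_mult:
  fixes f g :: "'a \<Rightarrow> real"
  assumes "f \<in> borel_measurable M" "\<And>\<omega>. \<omega> \<in> space M \<Longrightarrow> \<bar>f \<omega>\<bar> \<le> C" "integrable M g"
  shows "integrable M (\<lambda>\<omega>. f \<omega> * g \<omega>)"
proof (rule Bochner_Integration.integrable_bound[where f="\<lambda>\<omega>. C * g \<omega>"])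
  show "integrable M (\<lambda>\<omega>. C * g \<omega>)" using assms by simp
  show "(\<lambda>\<omega>. f \<omega> * g \<omega>) \<in> borel_measurable M" using assms by simp
  show "AE \<omega> in M. norm (f \<omega> * g \<omega>) \<le> norm (C * g \<omega>)"
  proof (rule AE_I2)
    fix \<omega> assume "\<omega> \<in> space M"
    from assms(2)[OF this] have "\<bar>f \<omega>\<bar> \<le> \<bar>C\<bar>" by simp
    then show "norm (f \<omega> * g \<omega>) \<le> norm (C * g \<omega>)" by (simp add: abs_mult mult_right_mono)
  qed
qed

lemma integrable_increment_mult:
  assumes "0 \<le> a" "a \<le> b" "0 \<le> c" "c \<le> d"
  shows "integrable M (\<lambda>\<omega>. incr a b \<omega> $ k * incr c d \<omega> $ l)"
proof (rule Bochner_Integration.integrable_bound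
    [where f="\<lambda>\<omega>. (incr a b \<omega> $ k * incr a b \<omega> $ k) + (incr c d \<omega> $ l * incr c d \<omega> $ l)"])
  show "integrable M (\<lambda>\<omega>. (incr a b \<omega> $ k * incr a b \<omega> $ k) + (incr c d \<omega> $ l * incr c d \<omega> $ l))"
    using assms by (intro Bochner_Integration.integrable_add increment_covariance)
  have [measurable]: "W a \<in> borel_measurable M" "W b \<in> borel_measurable M"
    "W c \<in> borel_measurable M" "W d \<in> borel_measurable M" using assms by auto
  show "(\<lambda>\<omega>. incr a b \<omega> $ k * incr c d \<omega> $ l) \<in> borel_measurable M"
    by measurable
  have *: "\<bar>x * y\<bar> \<le> \<bar>x * x + y * y\<bar>" for x y :: real
  proof -
    have "0 \<le> (\<bar>x\<bar> - \<bar>y\<bar>)\<^sup>2" by simp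
    then have "2 * (\<bar>x\<bar> * \<bar>y\<bar>) \<le> x * x + y * y"
      by (simp add: power2_eq_square algebra_simps abs_mult_self_eq)
    moreover have "0 \<le> \<bar>x\<bar> * \<bar>y\<bar>" by simp
    ultimately show ?thesis unfolding abs_mult by linarith
  qed
  show "AE \<omega> in M. norm (incr a b \<omega> $ k * incr c d \<omega> $ l)
      \<le> norm ((incr a b \<omega> $ k * incr a b \<omega> $ k) + (incr c d \<omega> $ l * incr c d \<omega> $ l))"
    using * by (intro AE_I2) (simp only: real_norm_def)
qed

lemma increment_measurable_F:
  "0 \<le> a \<Longrightarrow> a \<le> b \<Longrightarrow> b \<le> c \<Longrightarrow> (\<lambda>\<omega>. incr a b \<omega> $ k) \<in> borel_measurable (F c)"
  using W_measurable_F[of a c] W_measurable_F[of b c] by measurable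

text \<open>The weight and the earlier increment are both known at time \<open>c\<close>, so they
  factor off the later increment, which has mean zero.\<close>

lemma expectation_disjoint_increments:
  assumes ab: "0 \<le> a" "a \<le> b" "b \<le> c" "c \<le> d"
    and \<psi>: "\<psi> \<in> borel_measurable (F c)" "\<And>\<omega>. \<omega> \<in> space M \<Longrightarrow> \<bar>\<psi> \<omega>\<bar> \<le> C"
  shows "expectation (\<lambda>\<omega>. \<psi> \<omega> * (incr a b \<omega> $ k * incr c d \<omega> $ l)) = 0"
proof -
  let ?\<phi> = "\<lambda>\<omega>. \<psi> \<omega> * incr a b \<omega> $ k"
  have "?\<phi> \<in> borel_measurable (F c)"
    using \<psi>(1) increment_measurable_F[OF ab(1-3)] by (rule borel_measurable_times)
  moreover have "integrable M ?\<phi>"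
    using measurable_F_M[OF \<psi>(1)] \<psi>(2) increment_mean(1)[OF ab(1,2)] by (rule integrable_bounded_mult)
  moreover have "0 \<le> c" using ab by simp
  moreover have "(\<lambda>x. x $ l) \<in> borel_measurable (borel :: (real^'k) measure)"
    by (intro borel_measurable_continuous_onI continuous_intros)
  ultimately have "expectation (\<lambda>\<omega>. ?\<phi> \<omega> * incr c d \<omega> $ l) =
    expectation ?\<phi> * expectation (\<lambda>\<omega>. incr c d \<omega> $ l)"
    using ab by (intro integral_mult_increment(2)) (auto simp del: vector_minus_component intro: increment_mean)
  also have "\<dots> = 0" using increment_mean(2)[of c d l] ab by simp
  finally show ?thesis by (simp add: mult.assoc)
qed

text \<open>Split the longer increment at \<open>b\<close>: the part after \<open>b\<close>
  contributes nothing, and the common part gives the covariance of one increment.\<close>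

lemma expectation_increments_same_start:
  assumes ab: "0 \<le> a" "a \<le> b" "b \<le> d"
    and \<psi>: "\<psi> \<in> borel_measurable (F a)" "\<And>\<omega>. \<omega> \<in> space M \<Longrightarrow> \<bar>\<psi> \<omega>\<bar> \<le> C"
  shows "expectation (\<lambda>\<omega>. \<psi> \<omega> * (incr a b \<omega> $ k * incr a d \<omega> $ l)) =
    (if k = l then expectation \<psi> * (b - a) else 0)"
proof -
  have M: "\<psi> \<in> borel_measurable M" by (rule measurable_F_M[OF \<psi>(1)])
  have i\<psi>: "integrable M \<psi>" using \<psi>(2) M by (intro integrable_const_bound[of _ C]) auto
  have i1: "integrable M (\<lambda>\<omega>. \<psi> \<omega> * (incr a b \<omega> $ k * incr a b \<omega> $ l))"
    using ab by (intro integrable_bounded_mult[OF M \<psi>(2)] integrable_increment_mult) auto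
  have i2: "integrable M (\<lambda>\<omega>. \<psi> \<omega> * (incr a b \<omega> $ k * incr b d \<omega> $ l))"
    using ab by (intro integrable_bounded_mult[OF M \<psi>(2)] integrable_increment_mult) auto
  have "expectation (\<lambda>\<omega>. \<psi> \<omega> * (incr a b \<omega> $ k * incr a d \<omega> $ l)) =
    expectation (\<lambda>\<omega>. \<psi> \<omega> * (incr a b \<omega> $ k * incr a b \<omega> $ l)
        + \<psi> \<omega> * (incr a b \<omega> $ k * incr b d \<omega> $ l))"
    by (intro Bochner_Integration.integral_cong refl) (simp add: algebra_simps)
  also have "\<dots> = expectation (\<lambda>\<omega>. \<psi> \<omega> * (incr a b \<omega> $ k * incr a b \<omega> $ l))
      + expectation (\<lambda>\<omega>. \<psi> \<omega> * (incr a b \<omega> $ k * incr b d \<omega> $ l))"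
    by (rule Bochner_Integration.integral_add[OF i1 i2])
  also have "expectation (\<lambda>\<omega>. \<psi> \<omega> * (incr a b \<omega> $ k * incr b d \<omega> $ l)) = 0"
    using measurable_F_mono[OF \<psi>(1) ab(2)] ab \<psi>(2) by (intro expectation_disjoint_increments) auto
  also have "expectation (\<lambda>\<omega>. \<psi> \<omega> * (incr a b \<omega> $ k * incr a b \<omega> $ l)) =
     expectation \<psi> * expectation (\<lambda>\<omega>. incr a b \<omega> $ k * incr a b \<omega> $ l)"
  proof (rule integral_mult_increment(2)[OF \<psi>(1) i\<psi> ab(1,2), where g="\<lambda>x. x $ k * x $ l"])
    show "(\<lambda>x. x $ k * x $ l) \<in> borel_measurable (borel :: (real^'k) measure)"
      by (intro borel_measurable_continuous_onI continuous_intros)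
    show "integrable M (\<lambda>\<omega>. incr a b \<omega> $ k * incr a b \<omega> $ l)"
      by (rule integrable_increment_mult[OF ab(1,2) ab(1,2)])
  qed
  also have "expectation (\<lambda>\<omega>. incr a b \<omega> $ k * incr a b \<omega> $ l) = (if k = l then b - a else 0)"
    by (rule increment_covariance(2)[OF ab(1,2)])
  finally show ?thesis by simp
qed

text \<open>The covariance of two increments is the length of the overlap of their time intervals,
  here with weights known at the respective starting times. One formula covers disjoint, nested and
  crossing intervals, so sums over pairs can do without a common refinement.\<close>

lemma expectation_two_increments:
  assumes ab: "0 \<le> a" "a \<le> b" "0 \<le> c" "c \<le> d"
    and \<phi>: "\<phi> \<in> borel_measurable (F a)" "\<And>\<omega>. \<omega> \<in> space M \<Longrightarrow> \<bar>\<phi> \<omega>\<bar> \<le> C"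
    and \<psi>: "\<psi> \<in> borel_measurable (F c)" "\<And>\<omega>. \<omega> \<in> space M \<Longrightarrow> \<bar>\<psi> \<omega>\<bar> \<le> C'"
  shows "integrable M (\<lambda>\<omega>. (\<phi> \<omega> * \<psi> \<omega>) * (incr a b \<omega> $ k * incr c d \<omega> $ l))" (is ?int)
    and "expectation (\<lambda>\<omega>. (\<phi> \<omega> * \<psi> \<omega>) * (incr a b \<omega> $ k * incr c d \<omega> $ l)) =
      (if k = l then expectation (\<lambda>\<omega>. \<phi> \<omega> * \<psi> \<omega>) * max 0 (min b d - max a c) else 0)" (is ?eq)
proof -
  have bd: "\<bar>\<phi> \<omega> * \<psi> \<omega>\<bar> \<le> C * C'" if "\<omega> \<in> space M" for \<omega>
    using \<phi>(2)[OF that] \<psi>(2)[OF that] by (simp add: abs_mult mult_mono')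
  have m: "(\<lambda>\<omega>. \<phi> \<omega> * \<psi> \<omega>) \<in> borel_measurable M"
    using measurable_F_M[OF \<phi>(1)] measurable_F_M[OF \<psi>(1)] by simp
  show ?int
    using bd m ab by (intro integrable_bounded_mult[OF m bd] integrable_increment_mult) auto
  \<comment> \<open>The case in which the first interval starts first: up to \<open>c\<close> it
    contributes nothing, and from \<open>c\<close> on both increments share their start. The other
    case is an instance with the roles exchanged, hence the fresh quantification.\<close>
  have ordered: "expectation (\<lambda>\<omega>. \<theta> \<omega> * (incr a b \<omega> $ k * incr c d \<omega> $ l)) =
      (if k = l then expectation \<theta> * max 0 (min b d - max a c) else 0)"
    if ab: "0 \<le> a" "a \<le> b" "0 \<le> c" "c \<le> d" and ac: "a \<le> c"
      and \<theta>: "\<theta> \<in> borel_measurable (F c)" "\<And>\<omega>. \<omega> \<in> space M \<Longrightarrow> \<bar>\<theta> \<omega>\<bar> \<le> C"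
    for a b c d \<theta> k l C
  proof (cases "b \<le> c")
    case True
    have "expectation (\<lambda>\<omega>. \<theta> \<omega> * (incr a b \<omega> $ k * incr c d \<omega> $ l)) = 0"
      using True ab \<theta> by (intro expectation_disjoint_increments) auto
    moreover have "max 0 (min b d - max a c) = 0" using True ab by auto
    ultimately show ?thesis by simp
  next
    case False
    have M: "\<theta> \<in> borel_measurable M" by (rule measurable_F_M[OF \<theta>(1)])
    have i1: "integrable M (\<lambda>\<omega>. \<theta> \<omega> * (incr a c \<omega> $ k * incr c d \<omega> $ l))"
      using ab ac by (intro integrable_bounded_mult[OF M \<theta>(2)] integrable_increment_mult) auto
    have i2: "integrable M (\<lambda>\<omega>. \<theta> \<omega> * (incr c b \<omega> $ k * incr c d \<omega> $ l))"
      using ab ac False by (intro integrable_bounded_mult[OF M \<theta>(2)] integrable_increment_mult) auto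
    have "expectation (\<lambda>\<omega>. \<theta> \<omega> * (incr a b \<omega> $ k * incr c d \<omega> $ l)) =
      expectation (\<lambda>\<omega>. \<theta> \<omega> * (incr a c \<omega> $ k * incr c d \<omega> $ l) +
        \<theta> \<omega> * (incr c b \<omega> $ k * incr c d \<omega> $ l))"
      by (intro Bochner_Integration.integral_cong refl) (simp add: algebra_simps)
    also have "\<dots> = expectation (\<lambda>\<omega>. \<theta> \<omega> * (incr a c \<omega> $ k * incr c d \<omega> $ l)) +
        expectation (\<lambda>\<omega>. \<theta> \<omega> * (incr c b \<omega> $ k * incr c d \<omega> $ l))"
      by (rule Bochner_Integration.integral_add[OF i1 i2])
    also have "expectation (\<lambda>\<omega>. \<theta> \<omega> * (incr a c \<omega> $ k * incr c d \<omega> $ l)) = 0"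
      using ab ac \<theta> by (intro expectation_disjoint_increments) auto
    also have "expectation (\<lambda>\<omega>. \<theta> \<omega> * (incr c b \<omega> $ k * incr c d \<omega> $ l)) =
        (if k = l then expectation \<theta> * (min b d - c) else 0)"
    proof (cases "b \<le> d")
      case True
      then show ?thesis
        using expectation_increments_same_start[OF ab(3) _ True \<theta>, of k l] False by simp
    next
      case bd: False
      have "expectation (\<lambda>\<omega>. \<theta> \<omega> * (incr c b \<omega> $ k * incr c d \<omega> $ l)) =
          expectation (\<lambda>\<omega>. \<theta> \<omega> * (incr c d \<omega> $ l * incr c b \<omega> $ k))"
        by (simp add: mult.commute)
      also have "\<dots> = (if l = k then expectation \<theta> * (d - c) else 0)"
        using bd by (intro expectation_increments_same_start[OF ab(3,4) _ \<theta>]) auto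
      finally show ?thesis using bd by auto
    qed
    also have "min b d - c = max 0 (min b d - max a c)" using ab ac False by auto
    finally show ?thesis by simp
  qed
  show ?eq
  proof (cases "a \<le> c")
    case True
    have "(\<lambda>\<omega>. \<phi> \<omega> * \<psi> \<omega>) \<in> borel_measurable (F c)"
      using measurable_F_mono[OF \<phi>(1) True] \<psi>(1) by simp
    from ordered[OF ab True this bd] show ?thesis .
  next
    case False
    then have ca: "c \<le> a" by simp
    have "(\<lambda>\<omega>. \<phi> \<omega> * \<psi> \<omega>) \<in> borel_measurable (F a)"
      using measurable_F_mono[OF \<psi>(1) ca] \<phi>(1) by simp
    have "expectation (\<lambda>\<omega>. (\<phi> \<omega> * \<psi> \<omega>) * (incr a b \<omega> $ k * incr c d \<omega> $ l)) =
        expectation (\<lambda>\<omega>. (\<phi> \<omega> * \<psi> \<omega>) * (incr c d \<omega> $ l * incr a b \<omega> $ k))"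
      by (simp only: mult.commute)
    also have "\<dots> = (if l = k then expectation (\<lambda>\<omega>. \<phi> \<omega> * \<psi> \<omega>) * max 0 (min d b - max c a) else 0)"
      by (rule ordered[OF ab(3,4,1,2) ca \<open>(\<lambda>\<omega>. \<phi> \<omega> * \<psi> \<omega>) \<in> borel_measurable (F a)\<close> bd])
    also have "\<dots> = (if k = l then expectation (\<lambda>\<omega>. \<phi> \<omega> * \<psi> \<omega>) * max 0 (min b d - max a c) else 0)"
      by (simp only: min.commute max.commute eq_commute)
    finally show ?thesis .
  qed
qed

text \<open>Expand into entries: only equal Brownian coordinates survive, and the remaining double
  sum is the Frobenius inner product of the coefficients.\<close>

lemma expectation_matrix_increments:
  fixes \<phi> \<psi> :: "'a \<Rightarrow> real^'k^'n"
  assumes ab: "0 \<le> a" "a \<le> b" "0 \<le> c" "c \<le> d"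
    and \<phi>: "\<phi> \<in> borel_measurable (F a)" "\<And>\<omega>. \<omega> \<in> space M \<Longrightarrow> norm (\<phi> \<omega>) \<le> C"
    and \<psi>: "\<psi> \<in> borel_measurable (F c)" "\<And>\<omega>. \<omega> \<in> space M \<Longrightarrow> norm (\<psi> \<omega>) \<le> C'"
  shows "integrable M (\<lambda>\<omega>. (\<phi> \<omega> *v incr a b \<omega>) \<bullet> (\<psi> \<omega> *v incr c d \<omega>))" (is ?g1)
    and "expectation (\<lambda>\<omega>. (\<phi> \<omega> *v incr a b \<omega>) \<bullet> (\<psi> \<omega> *v incr c d \<omega>)) =
      expectation (\<lambda>\<omega>. \<phi> \<omega> \<bullet> \<psi> \<omega>) * max 0 (min b d - max a c)" (is ?g2)
proof -
  have expand: "(A *v x) \<bullet> (B *v y) = (\<Sum>i\<in>UNIV. \<Sum>k\<in>UNIV. \<Sum>l\<in>UNIV. (A $ i $ k * B $ i $ l) * (x $ k * y $ l))"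
    for A B :: "real^'k^'n" and x y
    unfolding inner_vec_def matrix_vector_mult_def
    by (simp add: sum_product mult_ac)
  have \<phi>': "(\<lambda>\<omega>. \<phi> \<omega> $ i $ k) \<in> borel_measurable (F a)" "\<And>\<omega>. \<omega> \<in> space M \<Longrightarrow> \<bar>\<phi> \<omega> $ i $ k\<bar> \<le> C" for i k
  proof -
    show "(\<lambda>\<omega>. \<phi> \<omega> $ i $ k) \<in> borel_measurable (F a)" using \<phi>(1) by measurable
    show "\<bar>\<phi> \<omega> $ i $ k\<bar> \<le> C" if "\<omega> \<in> space M" for \<omega>
      using \<phi>(2)[OF that] component_le_norm_cart[of "\<phi> \<omega> $ i" k] Finite_Cartesian_Product.norm_nth_le[of "\<phi> \<omega>" i] by linarith
  qed
  have \<psi>': "(\<lambda>\<omega>. \<psi> \<omega> $ i $ k) \<in> borel_measurable (F c)" "\<And>\<omega>. \<omega> \<in> space M \<Longrightarrow> \<bar>\<psi> \<omega> $ i $ k\<bar> \<le> C'" for i k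
  proof -
    show "(\<lambda>\<omega>. \<psi> \<omega> $ i $ k) \<in> borel_measurable (F c)" using \<psi>(1) by measurable
    show "\<bar>\<psi> \<omega> $ i $ k\<bar> \<le> C'" if "\<omega> \<in> space M" for \<omega>
      using \<psi>(2)[OF that] component_le_norm_cart[of "\<psi> \<omega> $ i" k] Finite_Cartesian_Product.norm_nth_le[of "\<psi> \<omega>" i] by linarith
  qed
  note * = expectation_two_increments[OF ab \<phi>' \<psi>']
  show ?g1
    unfolding expand by (intro Bochner_Integration.integrable_sum *(1))
  have "expectation (\<lambda>\<omega>. (\<phi> \<omega> *v incr a b \<omega>) \<bullet> (\<psi> \<omega> *v incr c d \<omega>)) =
    (\<Sum>i\<in>UNIV. \<Sum>k\<in>UNIV. \<Sum>l\<in>UNIV. if k = l then expectation (\<lambda>\<omega>. \<phi> \<omega> $ i $ k * \<psi> \<omega> $ i $ l) * max 0 (min b d - max a c) else 0)"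
    unfolding expand
    by (simp only: Bochner_Integration.integral_sum Bochner_Integration.integrable_sum *(1) *(2))
  also have "\<dots> = (\<Sum>i\<in>UNIV. \<Sum>k\<in>UNIV. expectation (\<lambda>\<omega>. \<phi> \<omega> $ i $ k * \<psi> \<omega> $ i $ k)) * max 0 (min b d - max a c)"
    by (simp add: sum_distrib_right)
  also have "(\<Sum>i\<in>UNIV. \<Sum>k\<in>UNIV. expectation (\<lambda>\<omega>. \<phi> \<omega> $ i $ k * \<psi> \<omega> $ i $ k)) = expectation (\<lambda>\<omega>. \<phi> \<omega> \<bullet> \<psi> \<omega>)"
  proof -
    have "integrable M (\<lambda>\<omega>. \<phi> \<omega> $ i $ k * \<psi> \<omega> $ i $ k)" for i k
      using measurable_F_M[OF \<phi>'(1)] measurable_F_M[OF \<psi>'(1)] \<phi>'(2) \<psi>'(2)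
      by (intro integrable_bounded_mult[where C=C] integrable_const_bound[where B=C']) auto
    then show ?thesis
      unfolding inner_vec_def by (simp add: Bochner_Integration.integral_sum)
  qed
  finally show ?g2 .
qed

section \<open>Elementary integrands\<close>

text \<open>Unlike in a simple integrand, the index set is arbitrary and the intervals may overlap.
  Differences then stay in the class, over the disjoint sum of the index sets.\<close>

definition elementary :: "'i set \<Rightarrow> ('i \<Rightarrow> real) \<Rightarrow> ('i \<Rightarrow> real) \<Rightarrow> ('i \<Rightarrow> 'a \<Rightarrow> real ^ 'k ^ 'n) \<Rightarrow> bool" where
  "elementary I a b \<xi> \<longleftrightarrow> finite I \<and>
     (\<forall>i\<in>I. 0 \<le> a i \<and> a i \<le> b i \<and> \<xi> i \<in> borel_measurable (F (a i)) \<and>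
        (\<exists>C. \<forall>\<omega>\<in>space M. norm (\<xi> i \<omega>) \<le> C))"

definition elem_process :: "'i set \<Rightarrow> ('i \<Rightarrow> real) \<Rightarrow> ('i \<Rightarrow> real) \<Rightarrow> ('i \<Rightarrow> 'a \<Rightarrow> real ^ 'k ^ 'n) \<Rightarrow>
    real \<Rightarrow> 'a \<Rightarrow> real ^ 'k ^ 'n" where
  "elem_process I a b \<xi> u \<omega> = (\<Sum>i\<in>I. indicator {a i<..b i} u *\<^sub>R \<xi> i \<omega>)"

definition elem_integral :: "'i set \<Rightarrow> ('i \<Rightarrow> real) \<Rightarrow> ('i \<Rightarrow> real) \<Rightarrow> ('i \<Rightarrow> 'a \<Rightarrow> real ^ 'k ^ 'n) \<Rightarrow>
    real \<Rightarrow> 'a \<Rightarrow> real ^ 'n" where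
  "elem_integral I a b \<xi> t \<omega> = (\<Sum>i\<in>I. \<xi> i \<omega> *v incr (min t (a i)) (min t (b i)) \<omega>)"

text \<open>Clamping the endpoints to \<open>{s..t}\<close> turns the increment into a sum of the
  same shape. For \<open>a i > t\<close> the clamped interval is degenerate, and the coefficient is
  replaced by \<open>0\<close> because \<open>\<xi> i\<close> need not be known at time
  \<open>t\<close>.\<close>

lemma elem_integral_increment:
  assumes "s \<le> t" "\<And>i. i \<in> I \<Longrightarrow> a i \<le> b i"
  shows "elem_integral I a b \<xi> t \<omega> - elem_integral I a b \<xi> s \<omega> =
    (\<Sum>i\<in>I. (if a i \<le> t then \<xi> i \<omega> else 0) *v incr (max s (min t (a i))) (max s (min t (b i))) \<omega>)"
  unfolding elem_integral_def sum_subtractf[symmetric]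
proof (intro sum.cong refl)
  fix i assume "i \<in> I"
  with assms have "s \<le> t" "a i \<le> b i" by auto
  then show "\<xi> i \<omega> *v incr (min t (a i)) (min t (b i)) \<omega> - \<xi> i \<omega> *v incr (min s (a i)) (min s (b i)) \<omega> =
    (if a i \<le> t then \<xi> i \<omega> else 0) *v incr (max s (min t (a i))) (max s (min t (b i))) \<omega>"
    by (auto simp: matrix_vector_mult_diff_distrib[symmetric] min_def max_def)
qed

lemma elementary_truncate:
  assumes "elementary I a b \<xi>" "0 \<le> s" "s \<le> t" "i \<in> I"
  shows "0 \<le> max s (min t (a i))" "max s (min t (a i)) \<le> max s (min t (b i))"
    and "(\<lambda>\<omega>. if a i \<le> t then \<xi> i \<omega> else 0) \<in> borel_measurable (F (max s (min t (a i))))" (is ?g1)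
    and "\<exists>C. \<forall>\<omega>\<in>space M. norm (if a i \<le> t then \<xi> i \<omega> else 0) \<le> C" (is ?g2)
proof -
  have i: "0 \<le> a i" "a i \<le> b i" "\<xi> i \<in> borel_measurable (F (a i))" "\<exists>C. \<forall>\<omega>\<in>space M. norm (\<xi> i \<omega>) \<le> C"
    using assms unfolding elementary_def by auto
  show "0 \<le> max s (min t (a i))" "max s (min t (a i)) \<le> max s (min t (b i))" using i assms by auto
  show ?g1
    using measurable_F_mono[OF i(3), of "max s (min t (a i))"] by (cases "a i \<le> t") auto
  show ?g2
    using i(4) by (cases "a i \<le> t") (auto intro: exI[of _ 0])
qed

text \<open>The left side arises from integrating a product of elementary processes over time, the
  right side from the overlap of clamped intervals in the covariance formula.\<close>

lemma interval_overlap_integral: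
  fixes a b c d s t :: real
  assumes "a \<le> b" "c \<le> d" "s \<le> t"
  shows "integrable lborel (\<lambda>u. indicator {s<..t} u * (indicator {a<..b} u * indicator {c<..d} u) :: real)" (is ?g1)
    and "(\<integral>u. indicator {s<..t} u * (indicator {a<..b} u * indicator {c<..d} u) \<partial>lborel) =
      max 0 (min (max s (min t b)) (max s (min t d)) - max (max s (min t a)) (max s (min t c)))" (is ?g2)
proof -
  have eq: "(indicator {s<..t} u * (indicator {a<..b} u * indicator {c<..d} u) :: real) =
    indicator {max s (max a c)<..min t (min b d)} u" for u
    by (auto simp: indicator_def)
  show ?g1
    unfolding eq by (cases "max s (max a c) \<le> min t (min b d)") auto
  have "(\<integral>u. indicator {s<..t} u * (indicator {a<..b} u * indicator {c<..d} u) \<partial>lborel) =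
    measure lborel {max s (max a c)<..min t (min b d)}"
    unfolding eq by simp
  also have "\<dots> = max 0 (min t (min b d) - max s (max a c))"
    by (cases "max s (max a c) \<le> min t (min b d)") auto
  also have "\<dots> = max 0 (min (max s (min t b)) (max s (min t d)) - max (max s (min t a)) (max s (min t c)))"
  proof -
    \<comment> \<open>The clamp is monotone and so commutes with \<open>min\<close> and
      \<open>max\<close>, which leaves an identity about a single interval.\<close>
    have m: "mono (\<lambda>x. max s (min t x))" by (intro monoI max.mono min.mono) auto
    have A: "min (max s (min t b)) (max s (min t d)) = max s (min t (min b d))"
      by (rule min_of_mono[OF m])
    have B: "max (max s (min t a)) (max s (min t c)) = max s (min t (max a c))"
      by (rule max_of_mono[OF m])
    have C: "max 0 (min t x - max s y) = max 0 (max s (min t x) - max s (min t y))" for x y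
    proof -
      consider "x \<le> s" | "t \<le> y" | "s < x" "y < t" by linarith
      then show ?thesis
      proof cases
        case 1
        then have "min t x - max s y \<le> 0" "max s (min t x) = s" using assms(3) by linarith+
        then show ?thesis by simp
      next
        case 2
        then have "min t x - max s y \<le> 0" "max s (min t x) \<le> t" "min t y = t" "max s t = t" using assms(3) by linarith+
        then show ?thesis by simp
      next
        case 3
        have "max s (min t x) = min t x" by (rule max_absorb2) (use 3 assms(3) in auto)
        moreover have "min t y = y" by (rule min_absorb2) (use 3 in auto)
        ultimately show ?thesis by (simp only:)
      qed
    qed
    show ?thesis unfolding A B by (rule C)
  qed
  finally show ?g2 .
qed

text \<open>The Ito isometry with a matrix weight known at the start \<open>s\<close>. The overlap
  formula applies to each pair of increments because \<open>Q \<omega> ** \<xi>' j \<omega>\<close>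
  is again a coefficient known at the start of its clamped interval. The identity weight gives the
  usual isometry, the Hessian of \<open>v\<close> the second order term of Taylor's formula.\<close>

lemma elem_quadratic:
  fixes \<xi> :: "'i \<Rightarrow> 'a \<Rightarrow> real ^ 'k ^ 'n" and Q :: "'a \<Rightarrow> real ^ 'n ^ 'n"
  assumes el: "elementary I a b \<xi>" and st: "0 \<le> s" "s \<le> t"
    and Q: "Q \<in> borel_measurable (F s)" "\<And>\<omega>. \<omega> \<in> space M \<Longrightarrow> norm (Q \<omega>) \<le> C"
  defines "\<Delta> \<equiv> \<lambda>\<omega>. elem_integral I a b \<xi> t \<omega> - elem_integral I a b \<xi> s \<omega>"
    and "q \<equiv> \<lambda>\<omega> u. indicator {s<..t} u * (elem_process I a b \<xi> u \<omega> \<bullet> (Q \<omega> ** elem_process I a b \<xi> u \<omega>))"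
  shows "integrable M (\<lambda>\<omega>. \<Delta> \<omega> \<bullet> (Q \<omega> *v \<Delta> \<omega>))" (is ?g1)
    and "\<And>\<omega>. integrable lborel (q \<omega>)"
    and "integrable M (\<lambda>\<omega>. \<integral>u. q \<omega> u \<partial>lborel)" (is ?g2)
    and "expectation (\<lambda>\<omega>. \<Delta> \<omega> \<bullet> (Q \<omega> *v \<Delta> \<omega>)) = expectation (\<lambda>\<omega>. \<integral>u. q \<omega> u \<partial>lborel)" (is ?g3)
proof -
  have fin: "finite I" and i: "\<And>i. i \<in> I \<Longrightarrow> 0 \<le> a i \<and> a i \<le> b i \<and> \<xi> i \<in> borel_measurable (F (a i))"
    using el unfolding elementary_def by auto
  interpret mm: bounded_bilinear "\<lambda>(A::real^'n^'n) (B::real^'k^'n). A ** B"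
    by (rule bounded_bilinear_matrix_matrix)
  interpret mv: bounded_bilinear "\<lambda>(A::real^'n^'n) (x::real^'n). A *v x"
    by (rule bounded_bilinear_matrix_vector)
  define \<xi>' where "\<xi>' i \<omega> = (if a i \<le> t then \<xi> i \<omega> else 0)" for i \<omega>
  define \<alpha> where "\<alpha> i = max s (min t (a i))" for i
  define \<beta> where "\<beta> i = max s (min t (b i))" for i
  define \<psi> where "\<psi> i \<omega> = Q \<omega> ** \<xi>' i \<omega>" for i \<omega>
  note tr = elementary_truncate[OF el st, folded \<xi>'_def \<alpha>_def \<beta>_def]
  have s\<alpha>: "s \<le> \<alpha> i" for i by (simp add: \<alpha>_def)
  have "\<exists>C. \<forall>\<omega>\<in>space M. norm (\<xi>' i \<omega>) \<le> C" if "i \<in> I" for i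
    using tr(4)[OF that] unfolding \<xi>'_def .
  then obtain K where K: "\<And>i \<omega>. i \<in> I \<Longrightarrow> \<omega> \<in> space M \<Longrightarrow> norm (\<xi>' i \<omega>) \<le> K i" by metis
  obtain L where L: "L \<ge> 0" "\<And>A B. norm ((A::real^'n^'n) ** (B::real^'k^'n)) \<le> norm A * norm B * L"
    using mm.nonneg_bounded by blast
  have \<psi>K: "norm (\<psi> i \<omega>) \<le> C * K i * L" if "i \<in> I" "\<omega> \<in> space M" for i \<omega>
  proof -
    have "norm (\<psi> i \<omega>) \<le> norm (Q \<omega>) * norm (\<xi>' i \<omega>) * L" unfolding \<psi>_def by (rule L)
    also have "\<dots> \<le> C * K i * L"
      using Q(2)[OF that(2)] K[OF that] L(1) by (intro mult_right_mono mult_mono') auto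
    finally show ?thesis .
  qed
  have \<xi>'m: "\<xi>' i \<in> borel_measurable (F (\<alpha> i))" if "i \<in> I" for i
    using tr(3)[OF that] unfolding \<xi>'_def .
  have \<psi>m: "\<psi> i \<in> borel_measurable (F (\<alpha> i))" if "i \<in> I" for i
    unfolding \<psi>_def
    by (intro borel_measurable_bounded_bilinear[OF bounded_bilinear_matrix_matrix]
        measurable_F_mono[OF Q(1) s\<alpha>] \<xi>'m that)
  note pair = expectation_matrix_increments[OF tr(1,2) tr(1,2) \<xi>'m K \<psi>m \<psi>K]
  let ?D = "\<lambda>i \<omega>. incr (\<alpha> i) (\<beta> i) \<omega>"
  have \<Delta>: "\<Delta> \<omega> = (\<Sum>i\<in>I. \<xi>' i \<omega> *v ?D i \<omega>)" for \<omega>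
    unfolding \<Delta>_def \<xi>'_def \<alpha>_def \<beta>_def using i by (intro elem_integral_increment st) auto
  have Q\<Delta>: "Q \<omega> *v \<Delta> \<omega> = (\<Sum>i\<in>I. \<psi> i \<omega> *v ?D i \<omega>)" for \<omega>
    unfolding \<Delta> \<psi>_def mv.sum_right by (simp only: matrix_vector_mul_assoc)
  have 1: "\<Delta> \<omega> \<bullet> (Q \<omega> *v \<Delta> \<omega>) = (\<Sum>i\<in>I. \<Sum>j\<in>I. (\<xi>' i \<omega> *v ?D i \<omega>) \<bullet> (\<psi> j \<omega> *v ?D j \<omega>))" for \<omega>
    unfolding Q\<Delta> by (subst \<Delta>, simp only: inner_sum_left inner_sum_right, rule sum.swap)
  show ?g1
    unfolding 1 by (intro Bochner_Integration.integrable_sum pair)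
  let ?ov = "\<lambda>i j. max 0 (min (\<beta> i) (\<beta> j) - max (\<alpha> i) (\<alpha> j))"
  have E: "expectation (\<lambda>\<omega>. \<Delta> \<omega> \<bullet> (Q \<omega> *v \<Delta> \<omega>)) =
     (\<Sum>i\<in>I. \<Sum>j\<in>I. expectation (\<lambda>\<omega>. \<xi>' i \<omega> \<bullet> \<psi> j \<omega>) * ?ov i j)"
    unfolding 1 by (simp add: Bochner_Integration.integral_sum Bochner_Integration.integrable_sum pair)
  have 2: "q \<omega> u = (\<Sum>i\<in>I. \<Sum>j\<in>I. (\<xi>' i \<omega> \<bullet> \<psi> j \<omega>) *
      (indicator {s<..t} u * (indicator {a i<..b i} u * indicator {a j<..b j} u)))" for \<omega> u
  proof (cases "u \<in> {s<..t}")
    case True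
    \<comment> \<open>An interval that contains \<open>u\<close> has \<open>a i < u \<le> t\<close>,
      so the zeroed coefficients are never seen here.\<close>
    have "elem_process I a b \<xi> u \<omega> = (\<Sum>i\<in>I. indicator {a i<..b i} u *\<^sub>R \<xi>' i \<omega>)"
      unfolding elem_process_def \<xi>'_def using True by (intro sum.cong refl) (auto simp: indicator_def)
    then have "q \<omega> u = (\<Sum>i\<in>I. indicator {a i<..b i} u *\<^sub>R \<xi>' i \<omega>) \<bullet> (\<Sum>j\<in>I. indicator {a j<..b j} u *\<^sub>R \<psi> j \<omega>)"
      using True unfolding q_def \<psi>_def by (simp add: mm.sum_right mm.scaleR_right)
    also have "\<dots> = (\<Sum>i\<in>I. \<Sum>j\<in>I. (indicator {a i<..b i} u *\<^sub>R \<xi>' i \<omega>) \<bullet> (indicator {a j<..b j} u *\<^sub>R \<psi> j \<omega>))"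
      unfolding inner_sum_left unfolding inner_sum_right ..
    finally show ?thesis using True by (simp add: mult_ac)
  qed (simp add: q_def)
  have ab: "a i \<le> b i" if "i \<in> I" for i using i[OF that] by simp
  have ov: "integrable lborel (\<lambda>u. indicator {s<..t} u * (indicator {a i<..b i} u * indicator {a j<..b j} u) :: real)"
    "(\<integral>u. indicator {s<..t} u * (indicator {a i<..b i} u * indicator {a j<..b j} u) \<partial>lborel) = ?ov i j"
    if "i \<in> I" "j \<in> I" for i j
    unfolding \<alpha>_def \<beta>_def
    by (rule interval_overlap_integral[OF ab[OF that(1)] ab[OF that(2)] st(2)])+
  show "integrable lborel (q \<omega>)" for \<omega>
    unfolding 2 by (intro Bochner_Integration.integrable_sum integrable_mult_right ov)
  have 3: "(\<integral>u. q \<omega> u \<partial>lborel) = (\<Sum>i\<in>I. \<Sum>j\<in>I. (\<xi>' i \<omega> \<bullet> \<psi> j \<omega>) * ?ov i j)" for \<omega>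
    unfolding 2 by (simp add: Bochner_Integration.integral_sum Bochner_Integration.integrable_sum ov)
  have int: "integrable M (\<lambda>\<omega>. \<xi>' i \<omega> \<bullet> \<psi> j \<omega>)" if "i \<in> I" "j \<in> I" for i j
  proof (rule integrable_const_bound)
    show "(\<lambda>\<omega>. \<xi>' i \<omega> \<bullet> \<psi> j \<omega>) \<in> borel_measurable M"
      using measurable_F_M[OF \<xi>'m[OF that(1)]] measurable_F_M[OF \<psi>m[OF that(2)]] by simp
    show "AE \<omega> in M. norm (\<xi>' i \<omega> \<bullet> \<psi> j \<omega>) \<le> K i * (C * K j * L)"
    proof (rule AE_I2)
      fix \<omega> assume \<omega>: "\<omega> \<in> space M"
      have "norm (\<xi>' i \<omega> \<bullet> \<psi> j \<omega>) \<le> norm (\<xi>' i \<omega>) * norm (\<psi> j \<omega>)" by (simp add: Cauchy_Schwarz_ineq2)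
      also have "\<dots> \<le> K i * (C * K j * L)"
        using K[OF that(1) \<omega>] \<psi>K[OF that(2) \<omega>] by (intro mult_mono') auto
      finally show "norm (\<xi>' i \<omega> \<bullet> \<psi> j \<omega>) \<le> K i * (C * K j * L)" .
    qed
  qed
  show ?g2
    unfolding 3 by (intro Bochner_Integration.integrable_sum integrable_mult_left int)
  show ?g3
    unfolding E 3 by (simp add: Bochner_Integration.integral_sum Bochner_Integration.integrable_sum int)
qed

lemma expectation_matrix_increment_zero:
  fixes \<phi> :: "'a \<Rightarrow> real^'k^'n" and z :: "'a \<Rightarrow> real^'n"
  assumes ab: "0 \<le> a" "a \<le> b"
    and \<phi>: "\<phi> \<in> borel_measurable (F a)" "\<And>\<omega>. \<omega> \<in> space M \<Longrightarrow> norm (\<phi> \<omega>) \<le> C"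
    and z: "z \<in> borel_measurable (F a)" "\<And>\<omega>. \<omega> \<in> space M \<Longrightarrow> norm (z \<omega>) \<le> C'"
  shows "integrable M (\<lambda>\<omega>. z \<omega> \<bullet> (\<phi> \<omega> *v incr a b \<omega>))" (is ?g1)
    and "expectation (\<lambda>\<omega>. z \<omega> \<bullet> (\<phi> \<omega> *v incr a b \<omega>)) = 0" (is ?g2)
proof -
  have expand: "z \<omega> \<bullet> (\<phi> \<omega> *v x) = (\<Sum>i\<in>UNIV. \<Sum>k\<in>UNIV. (z \<omega> $ i * \<phi> \<omega> $ i $ k) * (x $ k))" for x \<omega>
    unfolding inner_vec_def matrix_vector_mult_def by (simp add: sum_distrib_left mult_ac)
  have m: "(\<lambda>\<omega>. z \<omega> $ i * \<phi> \<omega> $ i $ k) \<in> borel_measurable (F a)" for i k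
    using \<phi>(1) z(1) by measurable
  have bd: "\<bar>z \<omega> $ i * \<phi> \<omega> $ i $ k\<bar> \<le> C' * C" if "\<omega> \<in> space M" for \<omega> i k
    unfolding abs_mult
    using \<phi>(2)[OF that] z(2)[OF that] component_le_norm_cart[of "\<phi> \<omega> $ i" k]
      Finite_Cartesian_Product.norm_nth_le[of "\<phi> \<omega>" i] component_le_norm_cart[of "z \<omega>" i]
    by (intro mult_mono') auto
  have int: "integrable M (\<lambda>\<omega>. z \<omega> $ i * \<phi> \<omega> $ i $ k)" for i k
    using measurable_F_M[OF m] bd by (intro integrable_const_bound[where B="C' * C"]) auto
  have p: "integrable M (\<lambda>\<omega>. (z \<omega> $ i * \<phi> \<omega> $ i $ k) * (incr a b \<omega> $ k))"
    "expectation (\<lambda>\<omega>. (z \<omega> $ i * \<phi> \<omega> $ i $ k) * (incr a b \<omega> $ k)) = 0" for i k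
    using integral_mult_increment[OF m int ab _ increment_mean(1)[OF ab], of k i k] increment_mean(2)[OF ab, of k]
    by (auto simp del: vector_minus_component)
  show ?g1
    unfolding expand by (intro Bochner_Integration.integrable_sum p)
  show ?g2
    unfolding expand
    by (simp only: Bochner_Integration.integral_sum Bochner_Integration.integrable_sum p sum.neutral_const)
qed

text \<open>All clamped intervals start at \<open>s\<close> or later, so \<open>z\<close> is known
  when each of them begins.\<close>

lemma elem_martingale:
  fixes \<xi> :: "'i \<Rightarrow> 'a \<Rightarrow> real ^ 'k ^ 'n"
  assumes el: "elementary I a b \<xi>" and st: "0 \<le> s" "s \<le> t"
    and z: "z \<in> borel_measurable (F s)" "\<And>\<omega>. \<omega> \<in> space M \<Longrightarrow> norm (z \<omega>) \<le> C"
  shows "integrable M (\<lambda>\<omega>. z \<omega> \<bullet> (elem_integral I a b \<xi> t \<omega> - elem_integral I a b \<xi> s \<omega>))" (is ?g1)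
    and "expectation (\<lambda>\<omega>. z \<omega> \<bullet> (elem_integral I a b \<xi> t \<omega> - elem_integral I a b \<xi> s \<omega>)) = 0" (is ?g2)
proof -
  have ab: "\<And>i. i \<in> I \<Longrightarrow> a i \<le> b i"
    using el unfolding elementary_def by auto
  note tr = elementary_truncate[OF el st]
  have p: "integrable M (\<lambda>\<omega>. z \<omega> \<bullet> ((if a i \<le> t then \<xi> i \<omega> else 0) *v incr (max s (min t (a i))) (max s (min t (b i))) \<omega>))"
    "expectation (\<lambda>\<omega>. z \<omega> \<bullet> ((if a i \<le> t then \<xi> i \<omega> else 0) *v incr (max s (min t (a i))) (max s (min t (b i))) \<omega>)) = 0"
    if i: "i \<in> I" for i
  proof -
    obtain C' where C': "\<forall>\<omega>\<in>space M. norm (if a i \<le> t then \<xi> i \<omega> else 0) \<le> C'" using tr(4)[OF i] by blast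
    have "s \<le> max s (min t (a i))" by simp
    note * = expectation_matrix_increment_zero[OF tr(1-3)[OF i] bspec[OF C'] measurable_F_mono[OF z(1) this] z(2)]
    show "integrable M (\<lambda>\<omega>. z \<omega> \<bullet> ((if a i \<le> t then \<xi> i \<omega> else 0) *v incr (max s (min t (a i))) (max s (min t (b i))) \<omega>))"
      "expectation (\<lambda>\<omega>. z \<omega> \<bullet> ((if a i \<le> t then \<xi> i \<omega> else 0) *v incr (max s (min t (a i))) (max s (min t (b i))) \<omega>)) = 0"
      by (rule *; simp)+
  qed
  have eq: "\<And>\<omega>. elem_integral I a b \<xi> t \<omega> - elem_integral I a b \<xi> s \<omega> =
    (\<Sum>i\<in>I. (if a i \<le> t then \<xi> i \<omega> else 0) *v incr (max s (min t (a i))) (max s (min t (b i))) \<omega>)"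
    using ab by (intro elem_integral_increment st) auto
  show ?g1
    unfolding eq inner_sum_right
    by (intro Bochner_Integration.integrable_sum p)
  show ?g2
    unfolding eq inner_sum_right
    by (simp only: Bochner_Integration.integral_sum p sum.neutral_const cong: sum.cong)
qed

lemma elem_integral_measurable: 
  assumes el: "elementary I a b \<xi>" and "0 \<le> t"
  shows "elem_integral I a b \<xi> t \<in> borel_measurable M"
proof -
  have i: "0 \<le> a i" "a i \<le> b i" "\<xi> i \<in> borel_measurable M" if "i \<in> I" for i
    using el that measurable_F_M unfolding elementary_def by auto
  show ?thesis
    unfolding elem_integral_def[abs_def]
    using i assms(2)
    by (intro borel_measurable_sum borel_measurable_bounded_bilinear[OF bounded_bilinear_matrix_vector]
         borel_measurable_diff W_measurable) (auto intro: order_trans)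
qed

text \<open>Cauchy-Schwarz twice: for the sum, and then for the sum of the squares.\<close>

lemma sum_power4_le:
  fixes f :: "'i \<Rightarrow> real"
  assumes "finite I" shows "(\<Sum>i\<in>I. f i) ^ 4 \<le> real (card I) ^ 3 * (\<Sum>i\<in>I. f i ^ 4)"
proof -
  have "(\<Sum>i\<in>I. f i) ^ 4 = ((\<Sum>i\<in>I. f i)\<^sup>2)\<^sup>2" by simp
  also have "\<dots> \<le> (real (card I) * (\<Sum>i\<in>I. (f i)\<^sup>2))\<^sup>2"
    using sum_squared_le_sum_of_squares[of f I] by (intro power_mono) (auto simp: mult.commute)
  also have "\<dots> = real (card I)^2 * (\<Sum>i\<in>I. (f i)\<^sup>2)\<^sup>2" by (simp add: power_mult_distrib)
  also have "\<dots> \<le> real (card I)^2 * (real (card I) * (\<Sum>i\<in>I. ((f i)\<^sup>2)\<^sup>2))"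
    using sum_squared_le_sum_of_squares[of "\<lambda>i. (f i)\<^sup>2" I] by (intro mult_left_mono) (auto simp: mult.commute)
  also have "\<dots> = real (card I) ^ 3 * (\<Sum>i\<in>I. f i ^ 4)" by (simp add: power3_eq_cube power2_eq_square power4_eq_xxxx mult.assoc)
  finally show ?thesis .
qed

text \<open>The point is the order \<open>(t - s)\<^sup>2\<close>: summed over \<open>K\<close>
  steps of length \<open>T / K\<close> it gives order \<open>1 / K\<close>. The constant depends on
  the process but not on the interval.\<close>

lemma elem_fourth_moment:
  fixes \<xi> :: "'i \<Rightarrow> 'a \<Rightarrow> real ^ 'k ^ 'n"
  assumes el: "elementary I a b \<xi>"
  obtains C where "0 \<le> C"
    and "\<And>s t. 0 \<le> s \<Longrightarrow> s \<le> t \<Longrightarrow>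
      integrable M (\<lambda>\<omega>. norm (elem_integral I a b \<xi> t \<omega> - elem_integral I a b \<xi> s \<omega>) ^ 4)"
    and "\<And>s t. 0 \<le> s \<Longrightarrow> s \<le> t \<Longrightarrow>
      expectation (\<lambda>\<omega>. norm (elem_integral I a b \<xi> t \<omega> - elem_integral I a b \<xi> s \<omega>) ^ 4) \<le> C * (t - s)\<^sup>2"
proof -
  have fin: "finite I" and i: "\<And>i. i \<in> I \<Longrightarrow> 0 \<le> a i \<and> a i \<le> b i" 
    and bd: "\<And>i. i \<in> I \<Longrightarrow> \<exists>C. \<forall>\<omega>\<in>space M. norm (\<xi> i \<omega>) \<le> C"
    using el unfolding elementary_def by auto
  obtain L where L: "L \<ge> 0" "\<And>A x. norm ((A::real^'k^'n) *v x) \<le> norm A * norm x * L"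
    using bounded_bilinear.nonneg_bounded[OF bounded_bilinear_matrix_vector] by blast
  obtain K where K: "\<And>i \<omega>. i \<in> I \<Longrightarrow> \<omega> \<in> space M \<Longrightarrow> norm (\<xi> i \<omega>) \<le> K i" using bd by metis
  define J where "J = I \<times> (UNIV :: 'k set)"
  have finJ: "finite J" using fin by (simp add: J_def)
  \<comment> \<open>The factor \<open>card J ^ 3\<close> pays for the fourth power of a sum over
    pairs of an interval and a Brownian coordinate; the \<open>3\<close> in front of
    \<open>C0\<close> below is the fourth moment of a standard Gaussian.\<close>
  define C0 where "C0 = real (card J) ^ 3 * (\<Sum>(i, k)\<in>J. (\<bar>K i\<bar> * L) ^ 4)"
  have C0: "0 \<le> C0" unfolding C0_def by (intro mult_nonneg_nonneg sum_nonneg) auto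
  have main: "integrable M (\<lambda>\<omega>. norm (elem_integral I a b \<xi> t \<omega> - elem_integral I a b \<xi> s \<omega>) ^ 4) \<and>
      expectation (\<lambda>\<omega>. norm (elem_integral I a b \<xi> t \<omega> - elem_integral I a b \<xi> s \<omega>) ^ 4) \<le> (3 * C0) * (t - s)\<^sup>2"
    if st: "0 \<le> s" "s \<le> t" for s t
  proof -
    let ?\<Delta> = "\<lambda>\<omega>. elem_integral I a b \<xi> t \<omega> - elem_integral I a b \<xi> s \<omega>"
    define \<alpha> where "\<alpha> i = max s (min t (a i))" for i
    define \<beta> where "\<beta> i = max s (min t (b i))" for i
    let ?D = "\<lambda>i k \<omega>. incr (\<alpha> i) (\<beta> i) \<omega> $ k"
    have \<alpha>\<beta>: "0 \<le> \<alpha> i" "\<alpha> i \<le> \<beta> i" "\<beta> i - \<alpha> i \<le> t - s" if "i \<in> I" for i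
      using st i[OF that] unfolding \<alpha>_def \<beta>_def by auto
    let ?G = "\<lambda>\<omega>. real (card J) ^ 3 * (\<Sum>(i, k)\<in>J. (\<bar>K i\<bar> * L) ^ 4 * ?D i k \<omega> ^ 4)"
    have pt: "norm (?\<Delta> \<omega>) ^ 4 \<le> ?G \<omega>" if \<omega>: "\<omega> \<in> space M" for \<omega>
    proof -
      have "norm (?\<Delta> \<omega>) \<le> (\<Sum>i\<in>I. norm ((if a i \<le> t then \<xi> i \<omega> else 0) *v incr (\<alpha> i) (\<beta> i) \<omega>))"
        unfolding \<alpha>_def \<beta>_def by (subst elem_integral_increment[OF st(2)]) (use i in \<open>auto intro: norm_sum\<close>)
      also have "\<dots> \<le> (\<Sum>i\<in>I. \<Sum>k\<in>UNIV. (\<bar>K i\<bar> * L) * \<bar>?D i k \<omega>\<bar>)"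
      proof (rule sum_mono)
        fix i assume iI: "i \<in> I"
        have "norm ((if a i \<le> t then \<xi> i \<omega> else 0) *v incr (\<alpha> i) (\<beta> i) \<omega>) \<le>
          norm (if a i \<le> t then \<xi> i \<omega> else 0) * norm (incr (\<alpha> i) (\<beta> i) \<omega>) * L" by (rule L)
        also have "\<dots> \<le> \<bar>K i\<bar> * (\<Sum>k\<in>UNIV. \<bar>?D i k \<omega>\<bar>) * L"
          using K[OF iI \<omega>] L(1) norm_le_l1_cart[of "incr (\<alpha> i) (\<beta> i) \<omega>"]
          by (intro mult_right_mono mult_mono') auto
        finally show "norm ((if a i \<le> t then \<xi> i \<omega> else 0) *v incr (\<alpha> i) (\<beta> i) \<omega>) \<le>
          (\<Sum>k\<in>UNIV. (\<bar>K i\<bar> * L) * \<bar>?D i k \<omega>\<bar>)" by (simp add: sum_distrib_left mult_ac)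
      qed
      also have "\<dots> = (\<Sum>(i, k)\<in>J. (\<bar>K i\<bar> * L) * \<bar>?D i k \<omega>\<bar>)"
        unfolding J_def by (simp add: sum.cartesian_product)
      finally have "norm (?\<Delta> \<omega>) ^ 4 \<le> (\<Sum>(i, k)\<in>J. (\<bar>K i\<bar> * L) * \<bar>?D i k \<omega>\<bar>) ^ 4"
        by (intro power_mono) auto
      also have "\<dots> \<le> real (card J) ^ 3 * (\<Sum>x\<in>J. (case x of (i, k) \<Rightarrow> (\<bar>K i\<bar> * L) * \<bar>?D i k \<omega>\<bar>) ^ 4)"
        by (rule sum_power4_le[OF finJ])
      also have "\<dots> = ?G \<omega>" by (simp add: case_prod_beta power_mult_distrib del: vector_minus_component)
      finally show ?thesis .
    qed
    have int: "integrable M (\<lambda>\<omega>. case x of (i, k) \<Rightarrow> (\<bar>K i\<bar> * L) ^ 4 * ?D i k \<omega> ^ 4)" if "x \<in> J" for x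
      using that increment_fourth_moment(1)[OF \<alpha>\<beta>(1,2)] by (auto simp: J_def simp del: vector_minus_component)
    have intG: "integrable M ?G"
      using int by (intro integrable_mult_right Bochner_Integration.integrable_sum)
    have meas: "(\<lambda>\<omega>. norm (?\<Delta> \<omega>) ^ 4) \<in> borel_measurable M"
    proof -
      have "?\<Delta> \<in> borel_measurable M"
        by (intro borel_measurable_diff elem_integral_measurable[OF el]) (use st in auto)
      then show ?thesis by simp
    qed
    have int\<Delta>: "integrable M (\<lambda>\<omega>. norm (?\<Delta> \<omega>) ^ 4)"
    proof (rule Bochner_Integration.integrable_bound[OF intG meas])
      show "AE \<omega> in M. norm (norm (?\<Delta> \<omega>) ^ 4) \<le> norm (?G \<omega>)"
      proof (rule AE_I2)
        fix \<omega> assume "\<omega> \<in> space M"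
        from pt[OF this] show "norm (norm (?\<Delta> \<omega>) ^ 4) \<le> norm (?G \<omega>)"
          by (simp add: abs_le_iff del: vector_minus_component)
      qed
    qed
    have "expectation (\<lambda>\<omega>. norm (?\<Delta> \<omega>) ^ 4) \<le> expectation ?G"
      using int\<Delta> intG pt by (rule integral_mono)
    also have "\<dots> = real (card J) ^ 3 * (\<Sum>(i, k)\<in>J. (\<bar>K i\<bar> * L) ^ 4 * (3 * (\<beta> i - \<alpha> i)\<^sup>2))"
    proof -
      have "expectation (\<lambda>\<omega>. \<Sum>(i, k)\<in>J. (\<bar>K i\<bar> * L) ^ 4 * ?D i k \<omega> ^ 4) =
         (\<Sum>x\<in>J. expectation (\<lambda>\<omega>. case x of (i, k) \<Rightarrow> (\<bar>K i\<bar> * L) ^ 4 * ?D i k \<omega> ^ 4))"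
        using int by (rule Bochner_Integration.integral_sum)
      also have "\<dots> = (\<Sum>(i, k)\<in>J. (\<bar>K i\<bar> * L) ^ 4 * (3 * (\<beta> i - \<alpha> i)\<^sup>2))"
        using increment_fourth_moment(2)[OF \<alpha>\<beta>(1,2)]
        by (intro sum.cong refl) (auto simp: J_def simp del: vector_minus_component)
      finally show ?thesis by simp
    qed
    also have "\<dots> \<le> real (card J) ^ 3 * (\<Sum>(i, k)\<in>J. (\<bar>K i\<bar> * L) ^ 4 * (3 * (t - s)\<^sup>2))"
      using \<alpha>\<beta> by (intro mult_left_mono sum_mono) (auto simp: J_def intro!: mult_left_mono power_mono)
    also have "\<dots> = (3 * C0) * (t - s)\<^sup>2"
      unfolding C0_def by (simp add: case_prod_beta sum_distrib_left mult_ac)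
    finally show ?thesis using int\<Delta> by simp
  qed
  show thesis
    by (rule that[of "3 * C0"]) (use C0 main in auto)
qed

end

section \<open>Square-integrable limits\<close>

text \<open>Tool for carrying identities from elementary to general integrands: \<open>F m\<close>
  is a linear or quadratic expression in the approximation, \<open>G\<close> the same in the limit,
  \<open>d m\<close> their distance and \<open>h\<close> the size of the limit. The mixed term is
  handled by Young's inequality with a free parameter, and one finite distance already makes
  \<open>G\<close> integrable.\<close>

lemma L2_limit:
  fixes d :: "nat \<Rightarrow> 'x \<Rightarrow> real" and h G :: "'x \<Rightarrow> real"
  assumes d [measurable]: "\<And>m. d m \<in> borel_measurable N" and d0: "\<And>m x. 0 \<le> d m x"
    and lim: "(\<lambda>m. \<integral>\<^sup>+x. ennreal ((d m x)\<^sup>2) \<partial>N) \<longlonglongrightarrow> 0"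
    and h [measurable]: "h \<in> borel_measurable N" and h0: "\<And>x. 0 \<le> h x" and hi: "integrable N (\<lambda>x. (h x)\<^sup>2)"
    and F: "\<And>m. integrable N (F m)" and G [measurable]: "G \<in> borel_measurable N"
    and le: "\<And>m x. x \<in> space N \<Longrightarrow> \<bar>F m x - G x\<bar> \<le> C * ((d m x)\<^sup>2 + h x * d m x)" and C: "0 \<le> C"
  shows "integrable N G" and "(\<lambda>m. \<integral>x. F m x \<partial>N) \<longlonglongrightarrow> (\<integral>x. G x \<partial>N)" (is ?g1)
proof -
  define S where "S = (\<integral>x. (h x)\<^sup>2 \<partial>N)"
  have S: "0 \<le> S" unfolding S_def by simp
  have main: "integrable N G \<and> \<bar>(\<integral>x. F m x \<partial>N) - (\<integral>x. G x \<partial>N)\<bar> \<le> C * (\<delta> * (1 + 1 / \<alpha>) + \<alpha> * S)"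
    if m: "(\<integral>\<^sup>+x. ennreal ((d m x)\<^sup>2) \<partial>N) < ennreal \<delta>" and \<alpha>: "0 < \<alpha>" and \<delta>: "0 < \<delta>" for m \<delta> \<alpha>
  proof -
    have di: "integrable N (\<lambda>x. (d m x)\<^sup>2)"
      using m by (intro integrableI_bounded) (auto intro: less_trans)
    have "ennreal (\<integral>x. (d m x)\<^sup>2 \<partial>N) < ennreal \<delta>"
      using m di by (subst nn_integral_eq_integral[symmetric]) auto
    then have dI: "(\<integral>x. (d m x)\<^sup>2 \<partial>N) < \<delta>" using \<delta> by (simp add: ennreal_less_iff)
    have amgm: "h x * d m x \<le> \<alpha> * (h x)\<^sup>2 + (d m x)\<^sup>2 / \<alpha>" for x
    proof -
      have "0 \<le> (\<alpha> * h x - d m x)\<^sup>2" by simp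
      then have "2 * (\<alpha> * (h x * d m x)) \<le> \<alpha> * (\<alpha> * (h x)\<^sup>2) + (d m x)\<^sup>2"
        by (simp add: power2_eq_square algebra_simps)
      moreover have "0 \<le> \<alpha> * (h x * d m x)" using \<alpha> h0 d0 by simp
      ultimately have "\<alpha> * (h x * d m x) \<le> \<alpha> * (\<alpha> * (h x)\<^sup>2) + (d m x)\<^sup>2" by linarith
      also have "\<dots> = \<alpha> * (\<alpha> * (h x)\<^sup>2 + (d m x)\<^sup>2 / \<alpha>)" using \<alpha> by (simp add: field_simps)
      finally show ?thesis using \<alpha> by simp
    qed
    let ?B = "\<lambda>x. C * ((d m x)\<^sup>2 + (\<alpha> * (h x)\<^sup>2 + (d m x)\<^sup>2 / \<alpha>))"
    have Bi: "integrable N ?B" using di hi by simp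
    have FB: "\<bar>F m x - G x\<bar> \<le> ?B x" if "x \<in> space N" for x
    proof -
      have "\<bar>F m x - G x\<bar> \<le> C * ((d m x)\<^sup>2 + h x * d m x)" by (rule le[OF that])
      also have "\<dots> \<le> ?B x" using amgm[of x] C by (intro mult_left_mono) auto
      finally show ?thesis .
    qed
    have FG: "integrable N (\<lambda>x. F m x - G x)"
    proof (rule Bochner_Integration.integrable_bound[OF Bi])
      show "(\<lambda>x. F m x - G x) \<in> borel_measurable N"
        using borel_measurable_integrable[OF F[of m]] by simp
      show "AE x in N. norm (F m x - G x) \<le> norm (?B x)"
        using FB by (intro AE_I2) (smt (verit) real_norm_def)
    qed
    have "integrable N (\<lambda>x. F m x - (F m x - G x))"
      by (rule Bochner_Integration.integrable_diff[OF F FG])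
    then have Gi: "integrable N G" by simp
    have "\<bar>(\<integral>x. F m x \<partial>N) - (\<integral>x. G x \<partial>N)\<bar> = \<bar>\<integral>x. F m x - G x \<partial>N\<bar>"
      using F Gi by simp
    also have "\<dots> \<le> (\<integral>x. \<bar>F m x - G x\<bar> \<partial>N)" by (rule integral_abs_bound)
    also have "\<dots> \<le> (\<integral>x. ?B x \<partial>N)"
      using FB FG Bi by (intro integral_mono) auto
    also have "\<dots> = C * ((\<integral>x. (d m x)\<^sup>2 \<partial>N) * (1 + 1 / \<alpha>) + \<alpha> * S)"
      using di hi unfolding S_def by (simp add: algebra_simps)
    also have "\<dots> \<le> C * (\<delta> * (1 + 1 / \<alpha>) + \<alpha> * S)"
      using C dI \<alpha> by (intro mult_left_mono add_right_mono mult_right_mono) auto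
    finally show ?thesis using Gi by simp
  qed
  have ev: "eventually (\<lambda>m. (\<integral>\<^sup>+x. ennreal ((d m x)\<^sup>2) \<partial>N) < ennreal \<delta>) sequentially" if "0 < \<delta>" for \<delta>
    using order_tendstoD(2)[OF lim, of "ennreal \<delta>"] that by simp
  from eventually_happens[OF ev[of 1]] obtain m where "(\<integral>\<^sup>+x. ennreal ((d m x)\<^sup>2) \<partial>N) < ennreal 1" by auto
  from main[OF this, of 1] show "integrable N G" by simp
  show ?g1
  proof (rule LIMSEQ_I)
    fix r :: real assume r: "0 < r"
    \<comment> \<open>First \<open>\<alpha>\<close> makes the part coming from \<open>h\<close> at
      most \<open>r / 2\<close>; then \<open>\<delta>\<close>, which depends on
      \<open>\<alpha>\<close>, bounds the rest. The summands \<open>1\<close> keep the denominators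
      positive.\<close>
    define \<alpha> where "\<alpha> = r / (2 * (C + 1) * (S + 1))"
    have \<alpha>: "0 < \<alpha>" using r C S by (simp add: \<alpha>_def)
    define \<delta> where "\<delta> = r / (2 * (C + 1) * (1 + 1 / \<alpha>))"
    have \<delta>: "0 < \<delta>" using r C \<alpha> by (simp add: \<delta>_def add_pos_pos)
    have 1: "C * (\<delta> * (1 + 1 / \<alpha>)) < r / 2"
    proof -
      have "0 < 1 + 1 / \<alpha>" using \<alpha> by (simp add: add_pos_pos)
      then have *: "\<delta> * (1 + 1 / \<alpha>) = r / (2 * (C + 1))" unfolding \<delta>_def using C by (simp add: divide_simps)
      have "C * (\<delta> * (1 + 1 / \<alpha>)) = (C / (C + 1)) * (r / 2)" unfolding * by simp
      also have "\<dots> < 1 * (r / 2)" using r C by (intro mult_strict_right_mono) auto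
      finally show ?thesis by simp
    qed
    have 2: "C * (\<alpha> * S) \<le> r / 2"
    proof -
      have "C * (\<alpha> * S) = (C / (C + 1)) * ((S / (S + 1)) * (r / 2))"
        unfolding \<alpha>_def by (simp add: algebra_simps)
      also have "\<dots> \<le> 1 * (1 * (r / 2))" using r C S by (intro mult_mono mult_nonneg_nonneg) auto
      finally show ?thesis by simp
    qed
    from eventually_sequentially[THEN iffD1, OF ev[OF \<delta>]] obtain n0 where
      n0: "\<And>m. m \<ge> n0 \<Longrightarrow> (\<integral>\<^sup>+x. ennreal ((d m x)\<^sup>2) \<partial>N) < ennreal \<delta>" by blast
    show "\<exists>no. \<forall>n\<ge>no. norm ((\<integral>x. F n x \<partial>N) - (\<integral>x. G x \<partial>N)) < r"
    proof (intro exI[of _ n0] allI impI)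
      fix n assume "n0 \<le> n"
      from conjunct2[OF main[OF n0[OF this] \<alpha> \<delta>], unfolded distrib_left[of C]] 1 2 show "norm ((\<integral>x. F n x \<partial>N) - (\<integral>x. G x \<partial>N)) < r"
        unfolding real_norm_def by linarith
    qed
  qed
qed

text \<open>The right side is the error bound that \<open>L2_limit\<close> asks for, with
  \<open>y\<close> as the limit.\<close>

lemma quadratic_form_diff:
  fixes x y :: "'v::real_inner"
  assumes T: "linear T" and K: "\<And>z. norm (T z) \<le> K * norm z" and K0: "0 \<le> K"
  shows "\<bar>x \<bullet> T x - y \<bullet> T y\<bar> \<le> 2 * K * ((norm (x - y))\<^sup>2 + norm y * norm (x - y))"
proof -
  have "x \<bullet> T x - y \<bullet> T y = (x - y) \<bullet> T (x - y) + (x - y) \<bullet> T y + y \<bullet> T (x - y)"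
    by (simp add: linear_diff[OF T] inner_diff_left inner_diff_right)
  also have "\<bar>\<dots>\<bar> \<le> \<bar>(x - y) \<bullet> T (x - y)\<bar> + \<bar>(x - y) \<bullet> T y\<bar> + \<bar>y \<bullet> T (x - y)\<bar>" by linarith
  also have "\<dots> \<le> norm (x - y) * (K * norm (x - y)) + norm (x - y) * (K * norm y) + norm y * (K * norm (x - y))"
    by (intro add_mono order_trans[OF Cauchy_Schwarz_ineq2] mult_left_mono K) auto
  also have "\<dots> = K * (norm (x - y))\<^sup>2 + 2 * K * (norm y * norm (x - y))"
    by (simp add: power2_eq_square algebra_simps)
  also have "\<dots> \<le> 2 * K * ((norm (x - y))\<^sup>2 + norm y * norm (x - y))"
    using K0 by (simp add: algebra_simps)
  finally show ?thesis .
qed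

lemma norm_diff_square_le:
  fixes x y z :: "'v::real_normed_vector"
  shows "(norm (x - z))\<^sup>2 \<le> 2 * (norm (x - y))\<^sup>2 + 2 * (norm (y - z))\<^sup>2"
proof -
  have "norm (x - z) \<le> norm (x - y) + norm (y - z)" by (rule norm_triangle_sub[of "x - z" "y - z", simplified, THEN order_trans]) simp
  then have "(norm (x - z))\<^sup>2 \<le> (norm (x - y) + norm (y - z))\<^sup>2" by (intro power_mono) auto
  also have "\<dots> \<le> 2 * (norm (x - y))\<^sup>2 + 2 * (norm (y - z))\<^sup>2"
    using zero_le_power2[of "norm (x - y) - norm (y - z)"] by (simp add: power2_eq_square algebra_simps)
  finally show ?thesis .
qed

abbreviation sqdist where
  "sqdist N f g \<equiv> \<integral>\<^sup>+x. ennreal ((norm (f x - g x))\<^sup>2) \<partial>N"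

lemma nn_integral_norm_diff_square_le:
  fixes f g h :: "'x \<Rightarrow> 'v::{real_normed_vector, second_countable_topology}"
  assumes [measurable]: "f \<in> borel_measurable N" "g \<in> borel_measurable N" "h \<in> borel_measurable N"
  shows "sqdist N f h \<le>
    2 * sqdist N f g + 2 * sqdist N g h"
proof -
  have "sqdist N f h \<le>
    (\<integral>\<^sup>+x. 2 * ennreal ((norm (f x - g x))\<^sup>2) + 2 * ennreal ((norm (g x - h x))\<^sup>2) \<partial>N)"
  proof (rule nn_integral_mono)
    fix x
    have "ennreal ((norm (f x - h x))\<^sup>2) \<le> ennreal (2 * (norm (f x - g x))\<^sup>2 + 2 * (norm (g x - h x))\<^sup>2)"
      by (intro ennreal_leI norm_diff_square_le)
    also have "\<dots> = 2 * ennreal ((norm (f x - g x))\<^sup>2) + 2 * ennreal ((norm (g x - h x))\<^sup>2)"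
      by (simp add: ennreal_plus ennreal_mult)
    finally show "ennreal ((norm (f x - h x))\<^sup>2) \<le> 2 * ennreal ((norm (f x - g x))\<^sup>2) + 2 * ennreal ((norm (g x - h x))\<^sup>2)" .
  qed
  also have "\<dots> = 2 * sqdist N f g + 2 * sqdist N g h"
    by (simp add: nn_integral_add nn_integral_cmult)
  finally show ?thesis .
qed

text \<open>Processes live on \<open>M \<Otimes>\<^sub>M lborel\<close> with the sample point first, so that the inner integral of Fubini's
  theorem is over time.\<close>

definition cut :: "real \<Rightarrow> real \<Rightarrow> (real \<Rightarrow> 'a \<Rightarrow> 'v::real_vector) \<Rightarrow> 'a \<times> real \<Rightarrow> 'v" where
  "cut s t f x = indicator {s<..t} (snd x) *\<^sub>R f (snd x) (fst x)"

lemma cut_diff: "cut s t (\<lambda>u \<omega>. f u \<omega> - g u \<omega>) x = cut s t f x - cut s t g x"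
  by (simp add: cut_def scaleR_diff_right)

context brownian
begin

section \<open>Isometry and measurability for elementary processes\<close>

lemma elementary_diff:
  fixes \<xi> \<xi>' :: "_ \<Rightarrow> 'a \<Rightarrow> real ^ 'k ^ 'n"
  assumes "elementary I a b \<xi>" "elementary J a' b' \<xi>'"
  shows "elementary (I <+> J) (case_sum a a') (case_sum b b') (case_sum \<xi> (\<lambda>i \<omega>. - \<xi>' i \<omega>))" (is ?g1)
    and "elem_process (I <+> J) (case_sum a a') (case_sum b b') (case_sum \<xi> (\<lambda>i \<omega>. - \<xi>' i \<omega>)) u \<omega> =
      elem_process I a b \<xi> u \<omega> - elem_process J a' b' \<xi>' u \<omega>" (is ?g2)
    and "elem_integral (I <+> J) (case_sum a a') (case_sum b b') (case_sum \<xi> (\<lambda>i \<omega>. - \<xi>' i \<omega>)) t \<omega> =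
      elem_integral I a b \<xi> t \<omega> - elem_integral J a' b' \<xi>' t \<omega>" (is ?g3)
proof -
  have fin: "finite I" "finite J" using assms unfolding elementary_def by auto
  show ?g1
    using assms unfolding elementary_def by auto
  have neg: "(- A) *v x = - (A *v x)" for A :: "real^'k^'n" and x
    using bounded_bilinear.minus_left[OF bounded_bilinear_matrix_vector] .
  show ?g2
    unfolding elem_process_def
    by (simp only: sum.Plus[OF fin] o_def sum.case scaleR_minus_right sum_negf add_uminus_conv_diff)
  show ?g3
    unfolding elem_integral_def using fin by (simp add: sum.Plus sum_negf neg)
qed

lemma cut_elem_measurable [measurable]:
  fixes \<xi> :: "_ \<Rightarrow> 'a \<Rightarrow> real ^ 'k ^ 'n"
  assumes "elementary I a b \<xi>"
  shows "cut s t (elem_process I a b \<xi>) \<in> borel_measurable (M \<Otimes>\<^sub>M lborel)"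
proof -
  have "\<xi> i \<in> borel_measurable M" if "i \<in> I" for i
    using assms that measurable_F_M unfolding elementary_def by blast
  from measurable_compose[OF measurable_fst this]
  have [measurable]: "(\<lambda>x. \<xi> i (fst x)) \<in> borel_measurable (M \<Otimes>\<^sub>M lborel)" if "i \<in> I" for i
    using that by auto
  have [measurable]: "(\<lambda>x. indicator {a<..b} (snd x) :: real) \<in> borel_measurable (M \<Otimes>\<^sub>M lborel)" for a b :: real
    by (rule measurable_compose[OF measurable_snd]) simp
  show ?thesis
    unfolding cut_def[abs_def] elem_process_def
    by (intro borel_measurable_scaleR borel_measurable_sum) auto
qed

text \<open>\<open>elem_quadratic\<close> with the identity weight, restated with nonnegative
  integrals so that it can be chained with distances that are not yet known to be finite.\<close>

lemma elem_isometry: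
  fixes \<xi> :: "_ \<Rightarrow> 'a \<Rightarrow> real ^ 'k ^ 'n"
  assumes el: "elementary I a b \<xi>" and st: "0 \<le> s" "s \<le> t"
  shows "sqdist M (elem_integral I a b \<xi> t) (elem_integral I a b \<xi> s) =
    (\<integral>\<^sup>+x. ennreal ((norm (cut s t (elem_process I a b \<xi>) x))\<^sup>2) \<partial>(M \<Otimes>\<^sub>M lborel))"
proof -
  let ?\<Delta> = "\<lambda>\<omega>. elem_integral I a b \<xi> t \<omega> - elem_integral I a b \<xi> s \<omega>"
  let ?q = "\<lambda>\<omega> u. indicator {s<..t} u * (elem_process I a b \<xi> u \<omega> \<bullet> elem_process I a b \<xi> u \<omega>)"
  have m1: "(\<lambda>_. mat 1 :: real^'n^'n) \<in> borel_measurable (F s)" by simp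
  note * = elem_quadratic[OF el st m1 order_refl, simplified]
  have q: "norm (cut s t (elem_process I a b \<xi>) (\<omega>, u)) ^ 2 = ?q \<omega> u" for \<omega> u
    by (cases "u \<in> {s<..t}") (auto simp: cut_def power2_norm_eq_inner)
  have q0: "0 \<le> ?q \<omega> u" for \<omega> u by simp
  have "(\<integral>\<^sup>+x. ennreal ((norm (cut s t (elem_process I a b \<xi>) x))\<^sup>2) \<partial>(M \<Otimes>\<^sub>M lborel)) =
     (\<integral>\<^sup>+\<omega>. \<integral>\<^sup>+u. ennreal (?q \<omega> u) \<partial>lborel \<partial>M)"
    unfolding q[symmetric] by (rule lborel.nn_integral_fst[symmetric]) (use cut_elem_measurable[OF el] in measurable)
  also have "\<dots> = (\<integral>\<^sup>+\<omega>. ennreal (\<integral>u. ?q \<omega> u \<partial>lborel) \<partial>M)"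
    using *(2) q0 by (intro nn_integral_cong nn_integral_eq_integral) auto
  also have "\<dots> = ennreal (expectation (\<lambda>\<omega>. \<integral>u. ?q \<omega> u \<partial>lborel))"
    using *(3) q0 by (intro nn_integral_eq_integral AE_I2 integral_nonneg) auto
  also have "\<dots> = ennreal (expectation (\<lambda>\<omega>. ?\<Delta> \<omega> \<bullet> ?\<Delta> \<omega>))" using *(4) by simp
  also have "\<dots> = (\<integral>\<^sup>+\<omega>. ennreal (?\<Delta> \<omega> \<bullet> ?\<Delta> \<omega>) \<partial>M)"
    using *(1) by (intro nn_integral_eq_integral[symmetric]) auto
  finally show ?thesis by (simp add: power2_norm_eq_inner)
qed

lemma elem_integral_0: "elementary I a b \<xi> \<Longrightarrow> elem_integral I a b \<xi> 0 \<omega> = 0"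
  unfolding elem_integral_def elementary_def by (intro sum.neutral) (auto simp: min_def)

lemma simple_integrand_elementary:
  assumes "simple_integrand F N p \<xi>"
  shows "elementary {..<N} p (\<lambda>i. p (Suc i)) \<xi>"
proof -
  have "0 \<le> p 0" "mono p" using assms by (auto simp: simple_integrand_def)
  then have "0 \<le> p i" "p i \<le> p (Suc i)" for i
    using monoD[of p 0 i] monoD[of p i "Suc i"] by auto
  then show ?thesis using assms unfolding elementary_def simple_integrand_def by auto
qed

lemma simple_process_elem: "simple_process N p \<xi> = elem_process {..<N} p (\<lambda>i. p (Suc i)) \<xi>"
  by (simp add: fun_eq_iff simple_process_def elem_process_def)

lemma simple_integral_elem: "simple_integral W N p \<xi> = elem_integral {..<N} p (\<lambda>i. p (Suc i)) \<xi>"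
  by (simp add: fun_eq_iff simple_integral_def elem_integral_def)

text \<open>Progressive measurability speaks of \<open>{0..t}\<close> and the filtration at
  \<open>t\<close>; swapping the coordinates and extending by zero gives measurability on the whole
  product.\<close>

lemma cut_progressive_measurable:
  fixes H :: "real \<Rightarrow> 'a \<Rightarrow> real ^ 'k ^ 'n"
  assumes "progressively_measurable F H" "0 \<le> s" "0 \<le> t"
  shows "cut s t H \<in> borel_measurable (M \<Otimes>\<^sub>M lborel)"
proof -
  let ?\<Omega> = "space M \<times> {0..t}"
  let ?R = "restrict_space (M \<Otimes>\<^sub>M lborel) ?\<Omega>"
  have 1: "(\<lambda>(s, \<omega>). H s \<omega>) \<in> borel_measurable (restrict_space borel {0..t} \<Otimes>\<^sub>M F t)"
    using assms unfolding progressively_measurable_def by auto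
  have 2: "(\<lambda>x. (snd x, fst x)) \<in> measurable ?R (restrict_space borel {0..t} \<Otimes>\<^sub>M F t)"
  proof (rule measurable_Pair)
    have "snd \<in> measurable ?R borel"
      by (rule measurable_restrict_space1) (simp add: measurable_snd'')
    then show "snd \<in> measurable ?R (restrict_space borel {0..t})"
      by (intro measurable_restrict_space2) (auto simp: space_restrict_space)
    have "id \<in> measurable M (F t)" using sets_F_le[of t] by (auto simp: measurable_def)
    from measurable_compose[OF measurable_fst this] have "fst \<in> measurable (M \<Otimes>\<^sub>M lborel) (F t)" by simp
    then show "fst \<in> measurable ?R (F t)" by (rule measurable_restrict_space1)
  qed
  from measurable_compose[OF 2 1] have "(\<lambda>x. H (snd x) (fst x)) \<in> borel_measurable ?R" by simp
  then have 3: "(\<lambda>x. indicator ?\<Omega> x *\<^sub>R H (snd x) (fst x)) \<in> borel_measurable (M \<Otimes>\<^sub>M lborel)"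
    by (subst (asm) borel_measurable_restrict_space_iff) auto
  have "(\<lambda>x. indicator {s<..t} (snd x) *\<^sub>R (indicator ?\<Omega> x *\<^sub>R H (snd x) (fst x))) \<in> borel_measurable (M \<Otimes>\<^sub>M lborel)"
    by (rule borel_measurable_scaleR[OF _ 3]) (rule measurable_compose[OF measurable_snd], simp)
  also have "?this \<longleftrightarrow> ?thesis"
    using assms(2) by (intro measurable_cong) (auto simp: cut_def space_pair_measure indicator_def)
  finally show ?thesis .
qed

end

section \<open>One approximating sequence for all times\<close>

locale ito_process = brownian M W for M :: "'a measure" and W :: "real \<Rightarrow> 'a \<Rightarrow> real ^ 'k" +
  fixes H :: "real \<Rightarrow> 'a \<Rightarrow> real ^ 'k ^ 'n" and I :: "real \<Rightarrow> 'a \<Rightarrow> real ^ 'n" and T :: real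
  assumes T: "0 \<le> T"
    and ito: "\<And>t. 0 \<le> t \<Longrightarrow> t \<le> T \<Longrightarrow> has_ito_integral M F W H t (I t)"
begin

abbreviation P where "P \<equiv> M \<Otimes>\<^sub>M (lborel :: real measure)"

lemma I_measurable: "0 \<le> t \<Longrightarrow> t \<le> T \<Longrightarrow> I t \<in> borel_measurable M"
  using ito unfolding has_ito_integral_def by blast

lemma cut_H_measurable: "0 \<le> s \<Longrightarrow> 0 \<le> t \<Longrightarrow> cut s t H \<in> borel_measurable P"
  using ito[of T] T by (intro cut_progressive_measurable) (auto simp: has_ito_integral_def)

lemma approximation_at:
  assumes t: "0 \<le> t" "t \<le> T"
  shows "\<exists>N p q \<xi>. (\<forall>m. elementary {..<N m :: nat} (p m) (q m) (\<xi> m)) \<and>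
    (\<lambda>m. sqdist P (\<lambda>x. cut 0 t (elem_process {..<N m} (p m) (q m) (\<xi> m)) x) (cut 0 t H)) \<longlonglongrightarrow> 0 \<and>
    (\<lambda>m. sqdist M (elem_integral {..<N m} (p m) (q m) (\<xi> m) t) (I t)) \<longlonglongrightarrow> 0"
proof -
  from ito[OF t] obtain N p \<xi> where si: "\<And>m. simple_integrand F (N m) (p m) (\<xi> m)"
    and 1: "(\<lambda>m. \<integral>\<^sup>+\<omega>. (\<integral>\<^sup>+s. ennreal ((norm (simple_process (N m) (p m) (\<xi> m) s \<omega> - H s \<omega>))\<^sup>2)
                       * indicator {0..t} s \<partial>lborel) \<partial>M) \<longlonglongrightarrow> 0"
    and 2: "(\<lambda>m. sqdist M (simple_integral W (N m) (p m) (\<xi> m) t) (I t))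
          \<longlonglongrightarrow> 0"
    unfolding has_ito_integral_def by auto
  note el = simple_integrand_elementary[OF si]
  have eq: "(\<integral>\<^sup>+\<omega>. (\<integral>\<^sup>+s. ennreal ((norm (simple_process (N m) (p m) (\<xi> m) s \<omega> - H s \<omega>))\<^sup>2)
                       * indicator {0..t} s \<partial>lborel) \<partial>M) =
    (sqdist P (\<lambda>x. cut 0 t (elem_process {..<N m} (p m) (\<lambda>i. p m (Suc i)) (\<xi> m)) x) (cut 0 t H))" for m
  proof -
    have meas: "(\<lambda>x. ennreal ((norm (cut 0 t (elem_process {..<N m} (p m) (\<lambda>i. p m (Suc i)) (\<xi> m)) x - cut 0 t H x))\<^sup>2)) \<in> borel_measurable P"
      using cut_elem_measurable[OF el[of m], of 0 t] cut_H_measurable[OF order_refl t(1)] by measurable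
    show ?thesis
      unfolding lborel.nn_integral_fst[OF meas, symmetric]
    proof (rule nn_integral_cong, rule nn_integral_cong_AE)
      fix \<omega>
      \<comment> \<open>The definition integrates over \<open>{0..t}\<close>, \<open>cut\<close>
        lives on \<open>{0<..t}\<close>: the single time \<open>0\<close> is a null set.\<close>
      have "AE u in lborel. u \<noteq> (0::real)" by (rule AE_lborel_singleton)
      then show "AE u in lborel. ennreal ((norm (simple_process (N m) (p m) (\<xi> m) u \<omega> - H u \<omega>))\<^sup>2) * indicator {0..t} u =
        ennreal ((norm (cut 0 t (elem_process {..<N m} (p m) (\<lambda>i. p m (Suc i)) (\<xi> m)) (\<omega>, u) - cut 0 t H (\<omega>, u)))\<^sup>2)"
        by eventually_elim (auto simp: cut_def simple_process_elem indicator_def)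
    qed
  qed
  show ?thesis
    by (intro exI conjI allI) (rule el 1[unfolded eq] 2[unfolded simple_integral_elem])+
qed

text \<open>Take the sequence belonging to \<open>T\<close>. On \<open>{0<..t}\<close> its
  integrands and those of the sequence belonging to \<open>t\<close> both approach \<open>H\<close>,
  so by the isometry the integrals of the two sequences approach each other at \<open>t\<close>, and
  those of the second tend to \<open>I t\<close>.\<close>

lemma approximation:
  "\<exists>N p q \<xi>. (\<forall>m. elementary {..<N m :: nat} (p m) (q m) (\<xi> m)) \<and>
    (\<lambda>m. sqdist P (\<lambda>x. cut 0 T (elem_process {..<N m} (p m) (q m) (\<xi> m)) x) (cut 0 T H)) \<longlonglongrightarrow> 0 \<and>
    (\<forall>t. 0 \<le> t \<longrightarrow> t \<le> T \<longrightarrow>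
      (\<lambda>m. sqdist M (elem_integral {..<N m} (p m) (q m) (\<xi> m) t) (I t)) \<longlonglongrightarrow> 0)"
proof -
  obtain N p q \<xi> where el_all: "\<forall>m. elementary {..<N m :: nat} (p m) (q m) (\<xi> m)" and
    A: "(\<lambda>m. sqdist P (\<lambda>x. cut 0 T (elem_process {..<N m} (p m) (q m) (\<xi> m)) x) (cut 0 T H)) \<longlonglongrightarrow> 0"
    using approximation_at[OF T order_refl] by (elim exE conjE)
  note el = el_all[rule_format]
  show ?thesis
  proof (intro exI conjI allI impI, rule el, rule A)
    fix t assume t: "0 \<le> t" "t \<le> T"
    obtain N' p' q' \<xi>' where el'_all: "\<forall>m. elementary {..<N' m :: nat} (p' m) (q' m) (\<xi>' m)" and
      B: "(\<lambda>m. sqdist P (\<lambda>x. cut 0 t (elem_process {..<N' m} (p' m) (q' m) (\<xi>' m)) x) (cut 0 t H)) \<longlonglongrightarrow> 0" and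
      C: "(\<lambda>m. sqdist M (elem_integral {..<N' m} (p' m) (q' m) (\<xi>' m) t) (I t)) \<longlonglongrightarrow> 0"
      using approximation_at[OF t] by (elim exE conjE)
    note el' = el'_all[rule_format]
    define E where "E m = elem_integral {..<N m} (p m) (q m) (\<xi> m) t" for m
    define E' where "E' m = elem_integral {..<N' m} (p' m) (q' m) (\<xi>' m) t" for m
    define S where "S m = elem_process {..<N m} (p m) (q m) (\<xi> m)" for m
    define S' where "S' m = elem_process {..<N' m} (p' m) (q' m) (\<xi>' m)" for m
    have [measurable]: "E m \<in> borel_measurable M" "E' m \<in> borel_measurable M" "I t \<in> borel_measurable M" for m
      unfolding E_def E'_def using elem_integral_measurable[OF el t(1)] elem_integral_measurable[OF el' t(1)] I_measurable[OF t] by auto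
    have [measurable]: "cut 0 s (S m) \<in> borel_measurable P" "cut 0 s (S' m) \<in> borel_measurable P" for m s
      unfolding S_def S'_def by (intro cut_elem_measurable el el')+
    have [measurable]: "cut 0 t H \<in> borel_measurable P" by (rule cut_H_measurable[OF order_refl t(1)])
    \<comment> \<open>The isometry for the difference of the two elementary processes; both
      integrals vanish at time \<open>0\<close>.\<close>
    have iso: "sqdist M (E m) (E' m) =
        (sqdist P (cut 0 t (S m)) (cut 0 t (S' m)))" for m
      using elem_isometry[OF elementary_diff(1)[OF el[of m] el'[of m]] order_refl t(1)]
      unfolding
        elementary_diff(3)[OF el[of m] el'[of m]] E_def E'_def S_def S'_def
        cut_diff[symmetric]
      by (simp add: cut_def[abs_def] elementary_diff(2)[OF el[of m] el'[of m]] elem_integral_0[OF el] elem_integral_0[OF el'])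
    have le: "sqdist M (E m) (I t) \<le>
       2 * (2 * sqdist P (cut 0 T (S m)) (cut 0 T H) +
            2 * sqdist P (cut 0 t (S' m)) (cut 0 t H)) +
       2 * sqdist M (E' m) (I t)" for m
    proof -
      have a: "sqdist P (cut 0 t (S m)) (cut 0 t H) \<le>
          sqdist P (cut 0 T (S m)) (cut 0 T H)"
        using t by (intro nn_integral_mono ennreal_leI power_mono) (auto simp: cut_def indicator_def)
      have b: "sqdist P (cut 0 t (S m)) (cut 0 t (S' m)) \<le>
          2 * sqdist P (cut 0 t (S m)) (cut 0 t H) +
          2 * sqdist P (cut 0 t H) (cut 0 t (S' m))"
        by (rule nn_integral_norm_diff_square_le) measurable
      have c: "sqdist M (E m) (I t) \<le>
          2 * sqdist M (E m) (E' m) +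
          2 * sqdist M (E' m) (I t)"
        by (rule nn_integral_norm_diff_square_le) measurable
      show ?thesis
        using c unfolding iso
        by (rule order_trans, intro add_mono mult_left_mono order_trans[OF b])
          (use a in \<open>auto simp: norm_minus_commute\<close>)
    qed
    have lim: "(\<lambda>m. 2 * (2 * sqdist P (cut 0 T (S m)) (cut 0 T H) +
            2 * sqdist P (cut 0 t (S' m)) (cut 0 t H)) +
       2 * sqdist M (E' m) (I t)) \<longlonglongrightarrow> 2 * (2 * 0 + 2 * 0) + 2 * 0"
      using A B C unfolding S_def S'_def E'_def
      by (intro tendsto_add tendsto_mult_ennreal tendsto_const) auto
    show "(\<lambda>m. sqdist M (elem_integral {..<N m} (p m) (q m) (\<xi> m) t) (I t)) \<longlonglongrightarrow> 0"
      unfolding E_def[symmetric]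
      by (rule tendsto_sandwich[OF _ _ tendsto_const lim[simplified]]) (use le in auto)
  qed
qed

end

lemma square_integrable_iff:
  fixes f :: "'x \<Rightarrow> 'v::{real_normed_vector, second_countable_topology}"
  assumes "f \<in> borel_measurable N"
  shows "integrable N (\<lambda>x. (norm (f x))\<^sup>2) \<longleftrightarrow> (\<integral>\<^sup>+x. ennreal ((norm (f x))\<^sup>2) \<partial>N) < \<infinity>"
  using assms by (simp add: integrable_iff_bounded)

lemma square_integrable_diff:
  fixes f g :: "'x \<Rightarrow> 'v::{real_normed_vector, second_countable_topology}"
  assumes [measurable]: "f \<in> borel_measurable N" "g \<in> borel_measurable N"
    and "integrable N (\<lambda>x. (norm (f x))\<^sup>2)" "sqdist N f g < \<infinity>"
  shows "integrable N (\<lambda>x. (norm (g x))\<^sup>2)"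
proof (subst square_integrable_iff)
  have "(\<integral>\<^sup>+x. ennreal ((norm (g x))\<^sup>2) \<partial>N) \<le>
    2 * sqdist N f g + 2 * (\<integral>\<^sup>+x. ennreal ((norm (f x))\<^sup>2) \<partial>N)"
    using nn_integral_norm_diff_square_le[of g N f "\<lambda>_. 0"] by (simp add: norm_minus_commute)
  also have "\<dots> < \<infinity>"
    using assms(3,4) unfolding square_integrable_iff[OF assms(1)]
    by (simp add: ennreal_mult_less_top)
  finally show "(\<integral>\<^sup>+x. ennreal ((norm (g x))\<^sup>2) \<partial>N) < \<infinity>" .
qed simp

text \<open>Fixes the common approximating sequence, so that limits at different times are taken
  along the same elementary processes.\<close>

locale ito_approximation = brownian M W for M :: "'a measure" and W :: "real \<Rightarrow> 'a \<Rightarrow> real ^ 'k" +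
  fixes N :: "nat \<Rightarrow> nat" and p q :: "nat \<Rightarrow> nat \<Rightarrow> real" and \<xi> :: "nat \<Rightarrow> nat \<Rightarrow> 'a \<Rightarrow> real ^ 'k ^ 'n"
    and H :: "real \<Rightarrow> 'a \<Rightarrow> real ^ 'k ^ 'n" and I :: "real \<Rightarrow> 'a \<Rightarrow> real ^ 'n" and T :: real
  assumes T: "0 \<le> T"
    and elem: "\<And>m. elementary {..<N m} (p m) (q m) (\<xi> m)"
    and H_measurable: "cut 0 T H \<in> borel_measurable (M \<Otimes>\<^sub>M lborel)"
    and I_measurable: "\<And>t. 0 \<le> t \<Longrightarrow> t \<le> T \<Longrightarrow> I t \<in> borel_measurable M"
    and H_limit: "(\<lambda>m. sqdist (M \<Otimes>\<^sub>M lborel) (\<lambda>x. cut 0 T (elem_process {..<N m} (p m) (q m) (\<xi> m)) x) (cut 0 T H)) \<longlonglongrightarrow> 0"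
    and I_limit: "\<And>t. 0 \<le> t \<Longrightarrow> t \<le> T \<Longrightarrow>
      (\<lambda>m. sqdist M (elem_integral {..<N m} (p m) (q m) (\<xi> m) t) (I t)) \<longlonglongrightarrow> 0"
begin

abbreviation P where "P \<equiv> M \<Otimes>\<^sub>M (lborel :: real measure)"
abbreviation E where "E m \<equiv> elem_integral {..<N m} (p m) (q m) (\<xi> m)"
abbreviation S where "S m \<equiv> elem_process {..<N m} (p m) (q m) (\<xi> m)"

lemma E_measurable [measurable]: "0 \<le> t \<Longrightarrow> E m t \<in> borel_measurable M"
  by (rule elem_integral_measurable[OF elem])

lemma cut_S_measurable [measurable]: "cut s t (S m) \<in> borel_measurable P"
  by (rule cut_elem_measurable[OF elem])

lemma cut_subinterval: "0 \<le> s \<Longrightarrow> t \<le> T \<Longrightarrow> cut s t f x = indicator {s<..t} (snd x) *\<^sub>R cut 0 T f x"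
  by (auto simp: cut_def indicator_def)

lemma cut_H_measurable: "0 \<le> s \<Longrightarrow> t \<le> T \<Longrightarrow> cut s t H \<in> borel_measurable P"
  by (subst measurable_cong[OF cut_subinterval], assumption, assumption,
      rule borel_measurable_scaleR[OF _ H_measurable], rule measurable_compose[OF measurable_snd], simp)

lemma cut_S_square_integrable:
  assumes "0 \<le> s" "s \<le> t" shows "integrable P (\<lambda>x. (norm (cut s t (S m) x))\<^sup>2)"
proof -
  let ?\<Delta> = "\<lambda>\<omega>. E m t \<omega> - E m s \<omega>"
  have m1: "(\<lambda>_. mat 1 :: real^'n^'n) \<in> borel_measurable (F s)" by simp
  have "integrable M (\<lambda>\<omega>. (norm (?\<Delta> \<omega>))\<^sup>2)"
    using elem_quadratic(1)[OF elem[of m] assms m1 order_refl] by (simp add: power2_norm_eq_inner)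
  moreover have "?\<Delta> \<in> borel_measurable M" using assms by (intro borel_measurable_diff E_measurable) auto
  ultimately have "(\<integral>\<^sup>+\<omega>. ennreal ((norm (?\<Delta> \<omega>))\<^sup>2) \<partial>M) < \<infinity>" by (simp only: square_integrable_iff)
  then show ?thesis
    unfolding elem_isometry[OF elem assms] by (simp only: square_integrable_iff[OF cut_S_measurable])
qed

lemma H_limit_sub:
  assumes "0 \<le> s" "t \<le> T"
  shows "(\<lambda>m. sqdist P (cut s t (S m)) (cut s t H)) \<longlonglongrightarrow> 0"
proof (rule tendsto_sandwich[OF _ _ tendsto_const H_limit])
  show "\<forall>\<^sub>F m in sequentially. sqdist P (cut s t (S m)) (cut s t H) \<le>
      sqdist P (cut 0 T (S m)) (cut 0 T H)"
    unfolding cut_subinterval[OF assms]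
    by (intro always_eventually allI nn_integral_mono ennreal_leI power_mono) (auto simp: indicator_def)
qed simp

lemma cut_H_square_integrable:
  assumes "0 \<le> s" "s \<le> t" "t \<le> T" shows "integrable P (\<lambda>x. (norm (cut s t H x))\<^sup>2)"
proof -
  have "eventually (\<lambda>m. sqdist P (cut s t (S m)) (cut s t H) < \<infinity>) sequentially"
    by (rule order_tendstoD(2)[OF H_limit_sub[OF assms(1,3)]]) simp
  then obtain m where m: "sqdist P (cut s t (S m)) (cut s t H) < \<infinity>"
    using eventually_happens[of _ sequentially] by auto
  show ?thesis
    by (rule square_integrable_diff[OF cut_S_measurable cut_H_measurable[OF assms(1,3)] cut_S_square_integrable[OF assms(1,2)] m])
qed

lemma increment_limit:
  assumes st: "0 \<le> s" "s \<le> t" "t \<le> T"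
  shows "(\<lambda>m. sqdist M (\<lambda>\<omega>. E m t \<omega> - E m s \<omega>) (\<lambda>\<omega>. I t \<omega> - I s \<omega>)) \<longlonglongrightarrow> 0"
proof -
  have st': "0 \<le> t" "s \<le> T" using st by auto
  have [measurable]: "I s \<in> borel_measurable M" "I t \<in> borel_measurable M"
    "E m s \<in> borel_measurable M" "E m t \<in> borel_measurable M" for m
    using st st' by (auto intro: I_measurable)
  have le: "sqdist M (\<lambda>\<omega>. E m t \<omega> - E m s \<omega>) (\<lambda>\<omega>. I t \<omega> - I s \<omega>) \<le>
    2 * sqdist M (E m t) (I t) + 2 * sqdist M (E m s) (I s)" for m
    using nn_integral_norm_diff_square_le[of "\<lambda>\<omega>. E m t \<omega> - I t \<omega>" M "\<lambda>_. 0" "\<lambda>\<omega>. E m s \<omega> - I s \<omega>"]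
    by (simp add: algebra_simps norm_minus_commute)
  have lim: "(\<lambda>m. 2 * sqdist M (E m t) (I t) +
      2 * sqdist M (E m s) (I s)) \<longlonglongrightarrow> 2 * 0 + 2 * 0"
    using st st' by (intro tendsto_add tendsto_mult_ennreal tendsto_const I_limit) auto
  show ?thesis
    by (rule tendsto_sandwich[OF _ _ tendsto_const lim[simplified]]) (use le in auto)
qed

lemma increment_square_integrable:
  assumes st: "0 \<le> s" "s \<le> t" "t \<le> T"
  shows "integrable M (\<lambda>\<omega>. (norm (I t \<omega> - I s \<omega>))\<^sup>2)"
proof -
  have st': "0 \<le> t" "s \<le> T" using st by auto
  have "eventually (\<lambda>m. sqdist M (\<lambda>\<omega>. E m t \<omega> - E m s \<omega>) (\<lambda>\<omega>. I t \<omega> - I s \<omega>) < \<infinity>) sequentially"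
    by (rule order_tendstoD(2)[OF increment_limit[OF st]]) simp
  then obtain m where m: "sqdist M (\<lambda>\<omega>. E m t \<omega> - E m s \<omega>) (\<lambda>\<omega>. I t \<omega> - I s \<omega>) < \<infinity>"
    using eventually_happens[of _ sequentially] by auto
  have m1: "(\<lambda>_. mat 1 :: real^'n^'n) \<in> borel_measurable (F s)" by simp
  have "integrable M (\<lambda>\<omega>. (norm (E m t \<omega> - E m s \<omega>))\<^sup>2)"
    using elem_quadratic(1)[OF elem[of m] st(1,2) m1 order_refl] by (simp add: power2_norm_eq_inner)
  from square_integrable_diff[OF borel_measurable_diff[OF E_measurable[OF st'(1)] E_measurable[OF st(1)]]
      borel_measurable_diff[OF I_measurable[OF st'(1) st(3)] I_measurable[OF st(1) st'(2)]] this m]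
  show ?thesis .
qed

lemma increment_mean_zero:
  assumes st: "0 \<le> s" "s \<le> t" "t \<le> T"
    and z: "z \<in> borel_measurable (F s)" "\<And>\<omega>. \<omega> \<in> space M \<Longrightarrow> norm (z \<omega>) \<le> C"
  shows "integrable M (\<lambda>\<omega>. z \<omega> \<bullet> (I t \<omega> - I s \<omega>))" (is ?g1)
    and "expectation (\<lambda>\<omega>. z \<omega> \<bullet> (I t \<omega> - I s \<omega>)) = 0" (is ?g2)
proof -
  have st': "0 \<le> t" "s \<le> T" using st by auto
  let ?d = "\<lambda>m \<omega>. norm ((E m t \<omega> - E m s \<omega>) - (I t \<omega> - I s \<omega>))"
  have [measurable]: "I s \<in> borel_measurable M" "I t \<in> borel_measurable M"
    "E m s \<in> borel_measurable M" "E m t \<in> borel_measurable M" "z \<in> borel_measurable M" for m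
    using st st' by (auto intro: I_measurable measurable_F_M[OF z(1)])
  have bound: "\<bar>z \<omega> \<bullet> (E m t \<omega> - E m s \<omega>) - z \<omega> \<bullet> (I t \<omega> - I s \<omega>)\<bar> \<le> \<bar>C\<bar> * ((?d m \<omega>)\<^sup>2 + 1 * ?d m \<omega>)"
    if "\<omega> \<in> space M" for m \<omega>
  proof -
    have "\<bar>z \<omega> \<bullet> (E m t \<omega> - E m s \<omega>) - z \<omega> \<bullet> (I t \<omega> - I s \<omega>)\<bar> \<le> norm (z \<omega>) * ?d m \<omega>"
      unfolding inner_diff_right[symmetric] by (rule Cauchy_Schwarz_ineq2)
    also have "\<dots> \<le> \<bar>C\<bar> * ((?d m \<omega>)\<^sup>2 + 1 * ?d m \<omega>)"
      using z(2)[OF that] by (intro mult_mono) auto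
    finally show ?thesis .
  qed
  \<comment> \<open>For a linear expression the error is bounded by the distance alone, so
    \<open>h\<close> is the constant \<open>1\<close>, which is square integrable on a probability
    space.\<close>
  note * = L2_limit[where d="?d" and h="\<lambda>_. 1" and N=M and C="\<bar>C\<bar>" and F="\<lambda>m \<omega>. z \<omega> \<bullet> (E m t \<omega> - E m s \<omega>)"
      and G="\<lambda>\<omega>. z \<omega> \<bullet> (I t \<omega> - I s \<omega>)", OF _ _ increment_limit[OF st] _ _ _ elem_martingale(1)[OF elem st(1,2) z] _ bound]
  show ?g1 by (rule *(1)) auto
  have "(\<lambda>m. expectation (\<lambda>\<omega>. z \<omega> \<bullet> (E m t \<omega> - E m s \<omega>))) \<longlonglongrightarrow> expectation (\<lambda>\<omega>. z \<omega> \<bullet> (I t \<omega> - I s \<omega>))"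
    by (rule *(2)) auto
  then have "(\<lambda>m. 0) \<longlonglongrightarrow> expectation (\<lambda>\<omega>. z \<omega> \<bullet> (I t \<omega> - I s \<omega>))"
    by (simp only: elem_martingale(2)[OF elem st(1,2) z])
  then show ?g2
    by (rule LIMSEQ_unique) simp
qed

text \<open>Both sides of \<open>elem_quadratic\<close> converge, one on the sample space along the
  integrals, the other on the product space along the integrands, so the weighted isometry survives
  the limit.\<close>

lemma increment_quadratic:
  fixes Q :: "'a \<Rightarrow> real^'n^'n"
  assumes st: "0 \<le> s" "s \<le> t" "t \<le> T"
    and Q: "Q \<in> borel_measurable (F s)" "\<And>\<omega>. \<omega> \<in> space M \<Longrightarrow> norm (Q \<omega>) \<le> C"
  shows "integrable M (\<lambda>\<omega>. (I t \<omega> - I s \<omega>) \<bullet> (Q \<omega> *v (I t \<omega> - I s \<omega>)))"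
    and "integrable P (\<lambda>x. cut s t H x \<bullet> (Q (fst x) ** cut s t H x))" (is ?g1)
    and "expectation (\<lambda>\<omega>. (I t \<omega> - I s \<omega>) \<bullet> (Q \<omega> *v (I t \<omega> - I s \<omega>))) =
      (\<integral>x. cut s t H x \<bullet> (Q (fst x) ** cut s t H x) \<partial>P)"
proof -
  have st': "0 \<le> t" "s \<le> T" using st by auto
  interpret PS: pair_sigma_finite M "lborel :: real measure" by standard
  let ?d = "\<lambda>m \<omega>. norm ((E m t \<omega> - E m s \<omega>) - (I t \<omega> - I s \<omega>))"
  let ?D = "\<lambda>m x. norm (cut s t (S m) x - cut s t H x)"
  have [measurable]: "I s \<in> borel_measurable M" "I t \<in> borel_measurable M"
    "E m s \<in> borel_measurable M" "E m t \<in> borel_measurable M" "Q \<in> borel_measurable M" 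
    "cut s t H \<in> borel_measurable P" for m
    using st st' by (auto intro: I_measurable measurable_F_M[OF Q(1)] cut_H_measurable)
  have Q2: "(\<lambda>x. Q (fst x)) \<in> borel_measurable P" by measurable
  obtain L where L: "L \<ge> 0" "\<And>A x. norm ((A::real^'n^'n) *v (x::real^'n)) \<le> norm A * norm x * L"
    using bounded_bilinear.nonneg_bounded[OF bounded_bilinear_matrix_vector] by blast
  obtain L' where L': "L' \<ge> 0" "\<And>A B. norm ((A::real^'n^'n) ** (B::real^'k^'n)) \<le> norm A * norm B * L'"
    using bounded_bilinear.nonneg_bounded[OF bounded_bilinear_matrix_matrix] by blast
  have lin: "linear ((*v) A)" for A :: "real^'n^'n" by simp
  have lin': "linear (\<lambda>B::real^'k^'n. A ** B)" for A :: "real^'n^'n"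
    using bounded_linear.linear[OF bounded_bilinear.bounded_linear_right[OF bounded_bilinear_matrix_matrix]] .
  have LK: "norm (Q \<omega> *v z) \<le> (\<bar>C\<bar> * L) * norm z" if "\<omega> \<in> space M" for \<omega> z
  proof -
    have "norm (Q \<omega> *v z) \<le> norm (Q \<omega>) * norm z * L" by (rule L)
    also have "\<dots> \<le> \<bar>C\<bar> * norm z * L" using Q(2)[OF that] L(1) by (intro mult_right_mono) auto
    finally show ?thesis by (simp add: mult_ac)
  qed
  have LK': "norm (Q \<omega> ** (z::real^'k^'n)) \<le> (\<bar>C\<bar> * L') * norm z" if "\<omega> \<in> space M" for \<omega> z
  proof -
    have "norm (Q \<omega> ** z) \<le> norm (Q \<omega>) * norm z * L'" by (rule L')
    also have "\<dots> \<le> \<bar>C\<bar> * norm z * L'" using Q(2)[OF that] L'(1) by (intro mult_right_mono) auto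
    finally show ?thesis by (simp add: mult_ac)
  qed
  let ?K = "\<bar>C\<bar> * L" and ?K' = "\<bar>C\<bar> * L'"
  have K0: "0 \<le> ?K" "0 \<le> ?K'" using L L' by auto
  let ?e = "\<lambda>m \<omega>. E m t \<omega> - E m s \<omega>" and ?i = "\<lambda>\<omega>. I t \<omega> - I s \<omega>"
  have b1: "\<bar>?e m \<omega> \<bullet> (Q \<omega> *v ?e m \<omega>) - ?i \<omega> \<bullet> (Q \<omega> *v ?i \<omega>)\<bar> \<le> 2 * ?K * ((?d m \<omega>)\<^sup>2 + norm (?i \<omega>) * ?d m \<omega>)"
    if "\<omega> \<in> space M" for m \<omega>
    by (rule quadratic_form_diff[OF lin LK[OF that] K0(1)])
  have b2: "\<bar>cut s t (S m) x \<bullet> (Q (fst x) ** cut s t (S m) x) - cut s t H x \<bullet> (Q (fst x) ** cut s t H x)\<bar>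
      \<le> 2 * ?K' * ((?D m x)\<^sup>2 + norm (cut s t H x) * ?D m x)" if "x \<in> space P" for m x
    by (rule quadratic_form_diff[OF lin' LK' K0(2)]) (use that in \<open>auto simp: space_pair_measure\<close>)
  have mQ: "(\<lambda>x. cut s t f x \<bullet> (Q (fst x) ** cut s t f x)) \<in> borel_measurable P"
    if "cut s t f \<in> borel_measurable P" for f :: "real \<Rightarrow> 'a \<Rightarrow> real^'k^'n"
    by (intro borel_measurable_inner that borel_measurable_bounded_bilinear[OF bounded_bilinear_matrix_matrix] Q2)
  have iS: "integrable P (\<lambda>x. cut s t (S m) x \<bullet> (Q (fst x) ** cut s t (S m) x))" for m
  proof (rule Bochner_Integration.integrable_bound[OF integrable_mult_right[OF cut_S_square_integrable[OF st(1,2)]] mQ])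
    show "AE x in P. norm (cut s t (S m) x \<bullet> (Q (fst x) ** cut s t (S m) x)) \<le> norm (?K' * (norm (cut s t (S m) x))\<^sup>2)"
    proof (rule AE_I2)
      fix x assume "x \<in> space P"
      then have "fst x \<in> space M" by (auto simp: space_pair_measure)
      have "norm (cut s t (S m) x \<bullet> (Q (fst x) ** cut s t (S m) x)) \<le>
          norm (cut s t (S m) x) * norm (Q (fst x) ** cut s t (S m) x)" by (simp add: Cauchy_Schwarz_ineq2)
      also have "\<dots> \<le> norm (cut s t (S m) x) * (?K' * norm (cut s t (S m) x))"
        by (intro mult_left_mono LK' \<open>fst x \<in> space M\<close>) simp
      also have "\<dots> = ?K' * (norm (cut s t (S m) x))\<^sup>2" by (simp add: power2_eq_square mult_ac)
      finally show "norm (cut s t (S m) x \<bullet> (Q (fst x) ** cut s t (S m) x)) \<le> norm (?K' * (norm (cut s t (S m) x))\<^sup>2)"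
        by simp
    qed
  qed simp
  have m1: "(\<lambda>\<omega>. ?i \<omega> \<bullet> (Q \<omega> *v ?i \<omega>)) \<in> borel_measurable M"
    by (intro borel_measurable_inner borel_measurable_bounded_bilinear[OF bounded_bilinear_matrix_vector]) auto
  note 1 = L2_limit[where d="?d" and h="\<lambda>\<omega>. norm (?i \<omega>)" and N=M and F="\<lambda>m \<omega>. ?e m \<omega> \<bullet> (Q \<omega> *v ?e m \<omega>)"
      and G="\<lambda>\<omega>. ?i \<omega> \<bullet> (Q \<omega> *v ?i \<omega>)", OF _ _ increment_limit[OF st] _ _ increment_square_integrable[OF st]
        elem_quadratic(1)[OF elem st(1,2) Q] m1 b1]
  note 2 = L2_limit[where d="?D" and h="\<lambda>x. norm (cut s t H x)" and N=P and F="\<lambda>m x. cut s t (S m) x \<bullet> (Q (fst x) ** cut s t (S m) x)"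
      and G="\<lambda>x. cut s t H x \<bullet> (Q (fst x) ** cut s t H x)", OF _ _ H_limit_sub[OF st(1,3)] _ _ cut_H_square_integrable[OF st]
        iS mQ b2]
  show "integrable M (\<lambda>\<omega>. ?i \<omega> \<bullet> (Q \<omega> *v ?i \<omega>))" by (rule 1(1)) (use K0 in auto)
  show ?g1 by (rule 2(1)) (use K0 in auto)
  have eq: "expectation (\<lambda>\<omega>. ?e m \<omega> \<bullet> (Q \<omega> *v ?e m \<omega>)) = (\<integral>x. cut s t (S m) x \<bullet> (Q (fst x) ** cut s t (S m) x) \<partial>P)" for m
  proof -
    have "cut s t (S m) (\<omega>, u) \<bullet> (Q \<omega> ** cut s t (S m) (\<omega>, u)) = indicator {s<..t} u * (S m u \<omega> \<bullet> (Q \<omega> ** S m u \<omega>))" for \<omega> u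
      by (cases "u \<in> {s<..t}") (auto simp: cut_def)
    then show ?thesis
      using elem_quadratic(4)[OF elem[of m] st(1,2) Q] PS.integral_fst'[OF iS[of m]] by simp
  qed
  have "(\<lambda>m. expectation (\<lambda>\<omega>. ?e m \<omega> \<bullet> (Q \<omega> *v ?e m \<omega>))) \<longlonglongrightarrow> expectation (\<lambda>\<omega>. ?i \<omega> \<bullet> (Q \<omega> *v ?i \<omega>))"
    by (rule 1(2)) (use K0 in auto)
  moreover have "(\<lambda>m. expectation (\<lambda>\<omega>. ?e m \<omega> \<bullet> (Q \<omega> *v ?e m \<omega>))) \<longlonglongrightarrow> (\<integral>x. cut s t H x \<bullet> (Q (fst x) ** cut s t H x) \<partial>P)"
    unfolding eq by (rule 2(2)) (use K0 in auto)
  ultimately show "expectation (\<lambda>\<omega>. ?i \<omega> \<bullet> (Q \<omega> *v ?i \<omega>)) = (\<integral>x. cut s t H x \<bullet> (Q (fst x) ** cut s t H x) \<partial>P)"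
    by (rule LIMSEQ_unique)
qed

text \<open>The bound is uniform over all grids. For two elementary approximations the isometry
  turns the sum into one integral over disjoint time cells; then one of the two tends to
  \<open>H\<close>. The \<open>4\<close> comes from splitting a squared distance twice.\<close>

lemma grid_defect:
  fixes t :: "nat \<Rightarrow> real"
  assumes t: "mono t" "0 \<le> t 0" "t K \<le> T"
  shows "(\<Sum>i<K. sqdist M (\<lambda>\<omega>. I (t (Suc i)) \<omega> - I (t i) \<omega>) (\<lambda>\<omega>. E m (t (Suc i)) \<omega> - E m (t i) \<omega>))
    \<le> 4 * sqdist P (cut 0 T (S m)) (cut 0 T H)"
proof -
  define A where "A n = sqdist P (cut 0 T (S n)) (cut 0 T H)" for n
  let ?dI = "\<lambda>i \<omega>. I (t (Suc i)) \<omega> - I (t i) \<omega>" and ?dE = "\<lambda>n i \<omega>. E n (t (Suc i)) \<omega> - E n (t i) \<omega>"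
  have ti: "0 \<le> t i" "t i \<le> t (Suc i)" "i < K \<Longrightarrow> t (Suc i) \<le> T" for i
    using monoD[OF t(1), of 0 i] monoD[OF t(1), of i "Suc i"] monoD[OF t(1), of "Suc i" K] t by auto
  have [measurable]: "cut 0 T H \<in> borel_measurable P" by (rule H_measurable)
  have mI: "?dI i \<in> borel_measurable M" if "i < K" for i
    using ti[of i] that by (intro borel_measurable_diff I_measurable) auto
  have mE: "?dE n i \<in> borel_measurable M" for n i
    using ti[of i] ti[of "Suc i"] by (intro borel_measurable_diff E_measurable) auto
  have iso: "sqdist M (?dE n i) (?dE m i) =
      (\<integral>\<^sup>+x. indicator {t i<..t (Suc i)} (snd x) * ennreal ((norm (cut 0 T (S n) x - cut 0 T (S m) x))\<^sup>2) \<partial>P)"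
    if "i < K" for n i
  proof -
    have eq: "?dE n i \<omega> - ?dE m i \<omega> = (E n (t (Suc i)) \<omega> - E m (t (Suc i)) \<omega>) - (E n (t i) \<omega> - E m (t i) \<omega>)" for \<omega>
      by simp
    show ?thesis
      unfolding eq elementary_diff(3)[OF elem[of n] elem[of m], symmetric]
        elem_isometry[OF elementary_diff(1)[OF elem[of n] elem[of m]] ti(1,2)]
    proof (intro nn_integral_cong)
      fix x :: "'a \<times> real"
      show "ennreal ((norm (cut (t i) (t (Suc i)) (elem_process ({..<N n} <+> {..<N m}) (case_sum (p n) (p m))
          (case_sum (q n) (q m)) (case_sum (\<xi> n) (\<lambda>i \<omega>. - \<xi> m i \<omega>))) x))\<^sup>2) =
        indicator {t i<..t (Suc i)} (snd x) * ennreal ((norm (cut 0 T (S n) x - cut 0 T (S m) x))\<^sup>2)"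
        using ti[of i] that
        by (cases "snd x \<in> {t i<..t (Suc i)}") (auto simp: cut_def elementary_diff(2)[OF elem[of n] elem[of m]])
    qed
  qed
  have ind: "(\<Sum>i<j. indicator {t i<..t (Suc i)} u) = (indicator {t 0<..t j} u :: ennreal)" for j u
  proof (induction j)
    case (Suc j)
    have "t 0 \<le> t j" "t j \<le> t (Suc j)" using t(1) by (auto simp: mono_def)
    then show ?case using Suc by (auto simp: indicator_def)
  qed simp
  have sum_iso: "(\<Sum>i<K. sqdist M (?dE n i) (?dE m i)) \<le> 2 * A n + 2 * A m" for n
  proof -
    have "(\<Sum>i<K. sqdist M (?dE n i) (?dE m i)) =
      (\<Sum>i<K. \<integral>\<^sup>+x. indicator {t i<..t (Suc i)} (snd x) * ennreal ((norm (cut 0 T (S n) x - cut 0 T (S m) x))\<^sup>2) \<partial>P)"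
      by (intro sum.cong refl iso) simp
    also have "\<dots> = (\<integral>\<^sup>+x. (\<Sum>i<K. indicator {t i<..t (Suc i)} (snd x) * ennreal ((norm (cut 0 T (S n) x - cut 0 T (S m) x))\<^sup>2)) \<partial>P)"
      by (rule nn_integral_sum[symmetric]) measurable
    also have "\<dots> \<le> sqdist P (cut 0 T (S n)) (cut 0 T (S m))"
      unfolding sum_distrib_right[symmetric] ind
      by (intro nn_integral_mono) (auto simp: indicator_def)
    also have "\<dots> \<le> 2 * A n + 2 * sqdist P (cut 0 T H) (cut 0 T (S m))"
      unfolding A_def by (rule nn_integral_norm_diff_square_le) measurable
    also have "sqdist P (cut 0 T H) (cut 0 T (S m)) = A m"
      unfolding A_def by (simp add: norm_minus_commute)
    finally show ?thesis .
  qed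
  let ?L = "\<Sum>i<K. sqdist M (?dI i) (?dE m i)"
  let ?B = "\<lambda>n. \<Sum>i<K. sqdist M (?dE n i) (?dI i)"
  have le: "?L \<le> 2 * ?B n + 2 * (2 * A n + 2 * A m)" for n
  proof -
    have "?L \<le> (\<Sum>i<K. 2 * sqdist M (?dI i) (?dE n i) +
        2 * sqdist M (?dE n i) (?dE m i))"
      by (intro sum_mono nn_integral_norm_diff_square_le mI mE) auto
    also have "\<dots> = 2 * ?B n + 2 * (\<Sum>i<K. sqdist M (?dE n i) (?dE m i))"
      by (simp only: sum.distrib sum_distrib_left norm_minus_commute)
    also have "\<dots> \<le> 2 * ?B n + 2 * (2 * A n + 2 * A m)"
      by (intro add_left_mono mult_left_mono sum_iso) auto
    finally show ?thesis .
  qed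
  have "(\<lambda>n. 2 * ?B n + 2 * (2 * A n + 2 * A m)) \<longlonglongrightarrow> 2 * (\<Sum>i<K. 0) + 2 * (2 * 0 + 2 * A m)"
  proof (intro tendsto_add tendsto_mult_ennreal tendsto_const tendsto_sum)
    show "A \<longlonglongrightarrow> 0" unfolding A_def[abs_def] by (rule H_limit)
    show "(\<lambda>n. sqdist M (?dE n i) (?dI i)) \<longlonglongrightarrow> 0" if "i \<in> {..<K}" for i
      using that ti[of i] by (intro increment_limit) auto
  qed auto
  from LIMSEQ_le_const[OF this] le have "?L \<le> 2 * (\<Sum>i<K. 0) + 2 * (2 * 0 + 2 * A m)" by blast
  also have "\<dots> = 4 * A m" by (simp add: mult.assoc[symmetric])
  finally show ?thesis unfolding A_def .
qed

text \<open>Here \<open>c\<close> is an increment and \<open>a\<close> its approximation. If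
  \<open>c - a\<close> is the larger part, \<open>norm c\<close> is at most twice its norm;
  otherwise \<open>norm a\<close> exceeds \<open>\<eta> / 2\<close>, which buys the two extra
  powers.\<close>

lemma tail_pointwise:
  fixes a c :: "'v::real_normed_vector"
  assumes "0 < \<eta>"
  shows "(norm c)\<^sup>2 * indicator {\<eta><..} (norm c) \<le> 4 * (norm (c - a))\<^sup>2 + 16 / \<eta>\<^sup>2 * norm a ^ 4"
proof (cases "\<eta> < norm c")
  case True
  have tri: "norm c \<le> norm (c - a) + norm a" using norm_triangle_ineq[of "c - a" a] by simp
  show ?thesis
  proof (cases "norm a \<le> norm (c - a)")
    case le: True
    have "(norm c)\<^sup>2 \<le> (2 * norm (c - a))\<^sup>2" using tri le by (intro power_mono) auto
    then show ?thesis using True by (simp add: power_mult_distrib add_increasing2)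
  next
    case False
    then have 1: "norm c \<le> 2 * norm a" "\<eta> \<le> 2 * norm a" using tri True by auto
    have "(norm c)\<^sup>2 * \<eta>\<^sup>2 \<le> (2 * norm a)\<^sup>2 * (2 * norm a)\<^sup>2"
      using 1 assms by (intro mult_mono power_mono) auto
    then have "(norm c)\<^sup>2 \<le> 16 / \<eta>\<^sup>2 * norm a ^ 4"
      using assms by (simp add: field_simps power2_eq_square power4_eq_xxxx)
    then show ?thesis using True by (simp add: add_increasing)
  qed
qed simp

text \<open>The order of choices matters: one \<open>m\<close> is fixed before the grid, as
  \<open>grid_defect\<close> controls its error uniformly in \<open>K\<close>; only then does
  \<open>K\<close> grow and remove the fourth moments of that one elementary integral.\<close>

lemma increment_tail:
  assumes \<eta>: "0 < \<eta>" and \<epsilon>: "0 < \<epsilon>"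
  shows "\<forall>\<^sub>F K in sequentially. (\<Sum>i<K. expectation (\<lambda>\<omega>.
      (norm (I (real (Suc i) * (T / real K)) \<omega> - I (real i * (T / real K)) \<omega>))\<^sup>2 *
      indicator {\<eta><..} (norm (I (real (Suc i) * (T / real K)) \<omega> - I (real i * (T / real K)) \<omega>)))) < \<epsilon>"
proof -
  \<comment> \<open>\<open>32 = 2 * 4 * 4\<close>: half of \<open>\<epsilon>\<close>, one factor
    \<open>4\<close> from \<open>tail_pointwise\<close> and one from
    \<open>grid_defect\<close>.\<close>
  define \<delta> where "\<delta> = \<epsilon> / 32"
  have \<delta>: "0 < \<delta>" using \<epsilon> by (simp add: \<delta>_def)
  have "eventually (\<lambda>m. sqdist P (cut 0 T (S m)) (cut 0 T H) < ennreal \<delta>) sequentially"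
    by (rule order_tendstoD(2)[OF H_limit]) (use \<delta> in simp)
  then obtain m where m: "sqdist P (cut 0 T (S m)) (cut 0 T H) < ennreal \<delta>"
    using eventually_happens[of _ sequentially] by auto
  obtain C where C: "0 \<le> C" 
    and C4: "\<And>s t. 0 \<le> s \<Longrightarrow> s \<le> t \<Longrightarrow> integrable M (\<lambda>\<omega>. norm (E m t \<omega> - E m s \<omega>) ^ 4)"
    "\<And>s t. 0 \<le> s \<Longrightarrow> s \<le> t \<Longrightarrow> expectation (\<lambda>\<omega>. norm (E m t \<omega> - E m s \<omega>) ^ 4) \<le> C * (t - s)\<^sup>2"
    using elem_fourth_moment[OF elem[of m]] by blast
  have "(\<lambda>K. 16 / \<eta>\<^sup>2 * (C * T\<^sup>2) / real K) \<longlonglongrightarrow> 0" by (rule lim_const_over_n)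
  then have ev: "\<forall>\<^sub>F K in sequentially. 16 / \<eta>\<^sup>2 * (C * T\<^sup>2) / real K < \<epsilon> / 2"
    by (rule order_tendstoD(2)) (use \<epsilon> in simp)
  show ?thesis
    using ev eventually_gt_at_top[of 0]
  proof eventually_elim
    case (elim K)
    define t where "t i = real i * (T / real K)" for i
    have K: "0 < real K" using elim by simp
    have mono: "mono t" unfolding t_def using T by (intro monoI mult_right_mono) auto
    have t0: "0 \<le> t 0" and tK: "t K \<le> T" using K by (auto simp: t_def)
    have ti: "0 \<le> t i" "t i \<le> t (Suc i)" "i < K \<Longrightarrow> t (Suc i) \<le> T" for i
      using monoD[OF mono, of 0 i] monoD[OF mono, of i "Suc i"] monoD[OF mono, of "Suc i" K] t0 tK by auto
    have dt: "t (Suc i) - t i = T / real K" for i by (simp add: t_def distrib_right add_divide_distrib)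
    let ?dI = "\<lambda>i \<omega>. I (t (Suc i)) \<omega> - I (t i) \<omega>" and ?dE = "\<lambda>i \<omega>. E m (t (Suc i)) \<omega> - E m (t i) \<omega>"
    have mI: "?dI i \<in> borel_measurable M" if "i < K" for i
      using ti[of i] that by (intro borel_measurable_diff I_measurable) auto
    have mE: "?dE i \<in> borel_measurable M" for i
      using ti[of i] ti[of "Suc i"] by (intro borel_measurable_diff E_measurable) auto
    have mD: "(\<lambda>\<omega>. ?dI i \<omega> - ?dE i \<omega>) \<in> borel_measurable M" if "i < K" for i
      using mI[OF that] mE[of i] by (rule borel_measurable_diff)
    have nn: "(\<Sum>i<K. sqdist M (?dI i) (?dE i)) \<le> ennreal (4 * \<delta>)"
    proof -
      have "(\<Sum>i<K. sqdist M (?dI i) (?dE i)) \<le> 4 * ennreal \<delta>"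
        using grid_defect[OF mono t0 tK, of m] m by (meson less_imp_le mult_left_mono order_trans zero_le)
      also have "4 * ennreal \<delta> = ennreal (4 * \<delta>)" using \<delta> by (simp add: ennreal_mult)
      finally show ?thesis .
    qed
    have iD: "integrable M (\<lambda>\<omega>. (norm (?dI i \<omega> - ?dE i \<omega>))\<^sup>2)" if "i < K" for i
    proof (subst square_integrable_iff[OF mD[OF that]])
      have "sqdist M (?dI i) (?dE i) \<le>
        (\<Sum>i<K. sqdist M (?dI i) (?dE i))"
        using that by (intro member_le_sum) auto
      also note nn
      finally show "sqdist M (?dI i) (?dE i) < \<infinity>"
        by (simp add: le_less_trans)
    qed
    have sumD: "(\<Sum>i<K. expectation (\<lambda>\<omega>. (norm (?dI i \<omega> - ?dE i \<omega>))\<^sup>2)) \<le> 4 * \<delta>"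
    proof -
      have "(\<Sum>i<K. sqdist M (?dI i) (?dE i)) =
        (\<Sum>i<K. ennreal (expectation (\<lambda>\<omega>. (norm (?dI i \<omega> - ?dE i \<omega>))\<^sup>2)))"
        by (intro sum.cong refl nn_integral_eq_integral iD) auto
      also have "\<dots> = ennreal (\<Sum>i<K. expectation (\<lambda>\<omega>. (norm (?dI i \<omega> - ?dE i \<omega>))\<^sup>2))"
        by (rule sum_ennreal) simp
      finally have "ennreal (\<Sum>i<K. expectation (\<lambda>\<omega>. (norm (?dI i \<omega> - ?dE i \<omega>))\<^sup>2)) =
        (\<Sum>i<K. sqdist M (?dI i) (?dE i))" ..
      then have "ennreal (\<Sum>i<K. expectation (\<lambda>\<omega>. (norm (?dI i \<omega> - ?dE i \<omega>))\<^sup>2)) \<le> ennreal (4 * \<delta>)"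
        using nn by simp
      then show ?thesis using \<delta> by (simp add: ennreal_le_iff)
    qed
    have "expectation (\<lambda>\<omega>. (norm (?dI i \<omega>))\<^sup>2 * indicator {\<eta><..} (norm (?dI i \<omega>))) \<le>
        4 * expectation (\<lambda>\<omega>. (norm (?dI i \<omega> - ?dE i \<omega>))\<^sup>2) + 16 / \<eta>\<^sup>2 * (C * (T / real K)\<^sup>2)"
      if i: "i < K" for i
    proof -
      let ?R = "\<lambda>\<omega>. 4 * (norm (?dI i \<omega> - ?dE i \<omega>))\<^sup>2 + 16 / \<eta>\<^sup>2 * norm (?dE i \<omega>) ^ 4"
      have iR: "integrable M ?R" using iD[OF i] C4(1)[OF ti(1,2)[of i]] by simp
      have m': "(\<lambda>\<omega>. (norm (?dI i \<omega>))\<^sup>2 * indicator {\<eta><..} (norm (?dI i \<omega>))) \<in> borel_measurable M"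
        using mI[OF i] by measurable
      have "integrable M (\<lambda>\<omega>. (norm (?dI i \<omega>))\<^sup>2 * indicator {\<eta><..} (norm (?dI i \<omega>)))"
      proof (rule Bochner_Integration.integrable_bound[OF iR m'])
        show "AE \<omega> in M. norm ((norm (?dI i \<omega>))\<^sup>2 * indicator {\<eta><..} (norm (?dI i \<omega>))) \<le> norm (?R \<omega>)"
        proof (rule AE_I2)
          fix \<omega>
          have "norm ((norm (?dI i \<omega>))\<^sup>2 * indicator {\<eta><..} (norm (?dI i \<omega>))) =
            (norm (?dI i \<omega>))\<^sup>2 * indicator {\<eta><..} (norm (?dI i \<omega>))" by (simp add: abs_mult)
          also have "\<dots> \<le> ?R \<omega>" by (rule tail_pointwise[OF \<eta>])
          also have "\<dots> \<le> norm (?R \<omega>)" by simp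
          finally show "norm ((norm (?dI i \<omega>))\<^sup>2 * indicator {\<eta><..} (norm (?dI i \<omega>))) \<le> norm (?R \<omega>)" .
        qed
      qed
      then have "expectation (\<lambda>\<omega>. (norm (?dI i \<omega>))\<^sup>2 * indicator {\<eta><..} (norm (?dI i \<omega>))) \<le> expectation ?R"
        using iR by (intro integral_mono tail_pointwise[OF \<eta>])
      also have "\<dots> = 4 * expectation (\<lambda>\<omega>. (norm (?dI i \<omega> - ?dE i \<omega>))\<^sup>2) + 16 / \<eta>\<^sup>2 * expectation (\<lambda>\<omega>. norm (?dE i \<omega>) ^ 4)"
        using iD[OF i] C4(1)[OF ti(1,2)[of i]] by simp
      also have "\<dots> \<le> 4 * expectation (\<lambda>\<omega>. (norm (?dI i \<omega> - ?dE i \<omega>))\<^sup>2) + 16 / \<eta>\<^sup>2 * (C * (T / real K)\<^sup>2)"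
        using C4(2)[OF ti(1,2)[of i]] unfolding dt by (intro add_left_mono mult_left_mono) auto
      finally show ?thesis .
    qed
    then have "(\<Sum>i<K. expectation (\<lambda>\<omega>. (norm (?dI i \<omega>))\<^sup>2 * indicator {\<eta><..} (norm (?dI i \<omega>)))) \<le>
      (\<Sum>i<K. 4 * expectation (\<lambda>\<omega>. (norm (?dI i \<omega> - ?dE i \<omega>))\<^sup>2) + 16 / \<eta>\<^sup>2 * (C * (T / real K)\<^sup>2))"
      by (intro sum_mono) auto
    also have "\<dots> = 4 * (\<Sum>i<K. expectation (\<lambda>\<omega>. (norm (?dI i \<omega> - ?dE i \<omega>))\<^sup>2)) + 16 / \<eta>\<^sup>2 * (C * T\<^sup>2) / real K"
      using K by (simp add: sum.distrib sum_distrib_left[symmetric] power2_eq_square)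
    also have "\<dots> < 4 * (4 * \<delta>) + \<epsilon> / 2"
      using sumD elim(1) by linarith
    also have "\<dots> = \<epsilon>" by (simp add: \<delta>_def)
    finally show ?case unfolding t_def .
  qed
qed

end

section \<open>The supersolution\<close>

text \<open>Maclaurin's formula along the segment from \<open>z\<close> to
  \<open>z + \<delta>\<close> at a fixed time. Time and space are expanded separately, since
  \<open>C12_on\<close> gives second derivatives in space only.\<close>

lemma C12_on_line_taylor:
  assumes C12: "C12_on T v vt vx vxx" and t: "t \<in> {0..T}"
  shows "\<exists>\<theta>. 0 < \<theta> \<and> \<theta> < 1 \<and>
    v t (z + \<delta>) = v t z + vx t z \<bullet> \<delta> + 1/2 * (\<delta> \<bullet> (vxx t (z + \<theta> *\<^sub>R \<delta>) *v \<delta>))"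
proof -
  have dv: "(v t has_derivative (\<lambda>h. vx t x \<bullet> h)) (at x)"
    and dvx: "(vx t has_derivative (\<lambda>h. vxx t x *v h)) (at x)" for x
    using C12 t unfolding C12_on_def by auto
  define diff where "diff m s = (if m = 0 then v t (z + s *\<^sub>R \<delta>) else if m = 1 then vx t (z + s *\<^sub>R \<delta>) \<bullet> \<delta>
      else (vxx t (z + s *\<^sub>R \<delta>) *v \<delta>) \<bullet> \<delta>)" for m :: nat and s
  have line: "((\<lambda>s. z + s *\<^sub>R \<delta>) has_derivative (\<lambda>h. h *\<^sub>R \<delta>)) (at s)" for s
    by (auto intro!: derivative_eq_intros)
  have lin: "vxx t x *v (h *\<^sub>R \<delta>) = h *\<^sub>R (vxx t x *v \<delta>)" for x h
    by (simp add: matrix_vector_mult_scaleR)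
  have D0: "(diff 0 has_real_derivative diff 1 s) (at s)" for s
  proof -
    have "((\<lambda>s. v t (z + s *\<^sub>R \<delta>)) has_derivative (\<lambda>h. vx t (z + s *\<^sub>R \<delta>) \<bullet> (h *\<^sub>R \<delta>))) (at s)"
      by (rule has_derivative_compose[OF line dv])
    then have "((\<lambda>s. v t (z + s *\<^sub>R \<delta>)) has_real_derivative vx t (z + s *\<^sub>R \<delta>) \<bullet> \<delta>) (at s)"
      unfolding has_field_derivative_def by (rule has_derivative_eq_rhs) (auto simp: mult.commute)
    then show ?thesis by (simp add: diff_def[abs_def])
  qed
  have D1: "(diff 1 has_real_derivative diff 2 s) (at s)" for s
  proof -
    have "((\<lambda>s. vx t (z + s *\<^sub>R \<delta>)) has_derivative (\<lambda>h. vxx t (z + s *\<^sub>R \<delta>) *v (h *\<^sub>R \<delta>))) (at s)"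
      by (rule has_derivative_compose[OF line dvx])
    then have "((\<lambda>s. vx t (z + s *\<^sub>R \<delta>) \<bullet> \<delta>) has_derivative (\<lambda>h. (vxx t (z + s *\<^sub>R \<delta>) *v (h *\<^sub>R \<delta>)) \<bullet> \<delta>)) (at s)"
      by (rule has_derivative_inner_left)
    then have "((\<lambda>s. vx t (z + s *\<^sub>R \<delta>) \<bullet> \<delta>) has_real_derivative (vxx t (z + s *\<^sub>R \<delta>) *v \<delta>) \<bullet> \<delta>) (at s)"
      unfolding has_field_derivative_def by (rule has_derivative_eq_rhs) (auto simp: lin mult.commute)
    then show ?thesis by (simp add: diff_def[abs_def])
  qed
  have "\<exists>\<theta>>0. \<theta> < 1 \<and> diff 0 1 = (\<Sum>m<2. diff m 0 / fact m * 1 ^ m) + diff 2 \<theta> / fact 2 * 1 ^ 2"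
  proof (rule Maclaurin)
    show "\<forall>m s. m < 2 \<and> 0 \<le> s \<and> s \<le> 1 \<longrightarrow> (diff m has_real_derivative diff (Suc m) s) (at s)"
    proof (intro allI impI)
      fix m :: nat and s :: real assume "m < 2 \<and> 0 \<le> s \<and> s \<le> 1"
      then have "m = 0 \<or> m = 1" by auto
      then show "(diff m has_real_derivative diff (Suc m) s) (at s)"
        using D0[of s] D1[of s] by (auto simp: numeral_2_eq_2)
    qed
  qed auto
  then obtain \<theta> where "0 < \<theta>" "\<theta> < 1"
    "diff 0 1 = (\<Sum>m<2. diff m 0 / fact m * 1 ^ m) + diff 2 \<theta> / fact 2 * 1 ^ 2" by blast
  then show ?thesis
    by (intro exI[of _ \<theta>]) (auto simp: diff_def numeral_2_eq_2 inner_commute)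
qed

lemma C12_on_time_mean_value:
  assumes C12: "C12_on T v vt vx vxx" and "0 \<le> s" "s \<le> t" "t \<le> T"
  shows "\<exists>r\<in>{s..t}. v t x - v s x = vt r x * (t - s)"
proof (cases "s = t")
  case False
  with assms have "s < t" by simp
  have "((\<lambda>s. v s x) has_derivative (\<lambda>h. vt r x * h)) (at r within {s..t})" if "s \<le> r" "r \<le> t" for r
  proof -
    have "((\<lambda>s. v s x) has_real_derivative vt r x) (at r within {0..T})"
      using C12 assms that unfolding C12_on_def by auto
    then have "((\<lambda>s. v s x) has_real_derivative vt r x) (at r within {s..t})"
      by (rule has_field_derivative_subset) (use assms in auto)
    then show ?thesis by (simp add: has_field_derivative_def)
  qed
  from mvt_simple[OF \<open>s < t\<close> this] show ?thesis by (metis atLeastAtMost_iff greaterThanLessThan_iff less_imp_le)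
qed (use assms in auto)

section \<open>Minimum conditions and the weak minimum principle\<close>

lemma trace_conjugate_eq_inner: "trace (transpose A ** B ** A) = A \<bullet> (B ** A)" for A :: "real^'k^'n" and B :: "real^'n^'n"
proof -
  have "trace (transpose A ** B ** A) = trace (transpose A ** (B ** A))"
    by (simp add: matrix_mul_assoc)
  also have "\<dots> = (\<Sum>k\<in>UNIV. \<Sum>i\<in>UNIV. A $ i $ k * (B ** A) $ i $ k)"
    unfolding trace_def transpose_def matrix_matrix_mult_def by simp
  also have "\<dots> = (\<Sum>i\<in>UNIV. \<Sum>k\<in>UNIV. A $ i $ k * (B ** A) $ i $ k)" by (rule sum.swap)
  finally show ?thesis by (simp add: inner_vec_def)
qed

text \<open>With \<open>trace_conjugate_eq_inner\<close> this writes the trace in the generator as a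
  sum of values of the Hessian form, one for each column of \<open>\<sigma>\<close>, so it inherits
  the sign of the form. The inner product itself is the shape in which the isometry delivers the
  second order term.\<close>

lemma inner_matrix_columns: "A \<bullet> (B ** A) = (\<Sum>k\<in>UNIV. column k A \<bullet> (B *v column k A))" for A :: "real^'k^'n"
  unfolding inner_vec_def matrix_matrix_mult_def matrix_vector_mult_def column_def
  by (simp add: sum_distrib_left) (rule sum.swap)

text \<open>If the Hessian form were negative in direction \<open>h\<close>, it would stay negative
  near \<open>x\<close> by continuity, and Taylor's formula with vanishing gradient would give a
  smaller value at a nearby point of \<open>D\<close>.\<close>

lemma C12_on_Hessian_nonneg_at_min:
  assumes C12: "C12_on T v vt vx vxx" and t: "t \<in> {0..T}"
    and D: "open D" "x \<in> D" and min: "\<And>y. y \<in> D \<Longrightarrow> v t x \<le> v t y"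
  shows "vx t x = 0" and "0 \<le> h \<bullet> (vxx t x *v h)"
proof -
  have dv: "(v t has_derivative (\<lambda>h. vx t x \<bullet> h)) (at x)"
    using C12 t unfolding C12_on_def by auto
  have "(\<lambda>h. vx t x \<bullet> h) = (\<lambda>h. 0)"
    by (rule has_derivative_local_min[OF dv])
      (use D min in \<open>auto simp: eventually_at_topological intro!: exI[of _ D]\<close>)
  then have "vx t x \<bullet> vx t x = 0" by metis
  then show vx0: "vx t x = 0" by simp
  let ?g = "\<lambda>y. h \<bullet> (vxx t y *v h)"
  have cont: "continuous_on UNIV (\<lambda>y. vxx t y)"
  proof -
    have "continuous_on ({0..T} \<times> UNIV) (\<lambda>(t, x). vxx t x)" using C12 unfolding C12_on_def by auto
    then have "continuous_on UNIV ((\<lambda>(t, x). vxx t x) \<circ> (\<lambda>y. (t, y)))"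
      by (intro continuous_on_compose continuous_intros) (rule continuous_on_subset, use t in auto)
    then show ?thesis by (simp add: comp_def)
  qed
  have "continuous_on UNIV ?g"
    by (intro continuous_intros bounded_bilinear.continuous_on[OF bounded_bilinear_matrix_vector] cont)
  then have g: "isCont ?g x" by (simp add: continuous_on_eq_continuous_at)
  show "0 \<le> h \<bullet> (vxx t x *v h)"
  proof (rule ccontr)
    assume "\<not> 0 \<le> h \<bullet> (vxx t x *v h)"
    then have "?g x < 0" by simp
    with g have "eventually (\<lambda>y. ?g y < 0) (nhds x)"
      unfolding continuous_at using order_tendstoD(2)[of ?g "?g x" "at x" 0] eventually_nhds_conv_at
      by (auto simp: eventually_nhds_conv_at)
    moreover have "eventually (\<lambda>y. y \<in> D) (nhds x)" using D by (rule eventually_nhds_in_open)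
    ultimately have "eventually (\<lambda>y. y \<in> D \<and> ?g y < 0) (nhds x)" by eventually_elim auto
    then obtain r where r: "0 < r" "\<And>y. dist y x < r \<Longrightarrow> y \<in> D \<and> ?g y < 0"
      unfolding eventually_nhds_metric by blast
    \<comment> \<open>The \<open>+ 1\<close> keeps \<open>c\<close> positive for every
      \<open>h\<close> and makes \<open>c * norm h\<close> strictly smaller than
      \<open>r\<close>.\<close>
    define c where "c = r / (norm h + 1)"
    have c: "0 < c" using r by (simp add: c_def add_nonneg_pos)
    have ch: "c * norm h < r"
    proof -
      have "c * norm h < c * (norm h + 1)" using c by simp
      also have "\<dots> = r" using norm_ge_zero[of h] by (simp add: c_def add_nonneg_eq_0_iff)
      finally show ?thesis .
    qed
    obtain \<theta> where \<theta>: "0 < \<theta>" "\<theta> < 1"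
      "v t (x + c *\<^sub>R h) = v t x + vx t x \<bullet> (c *\<^sub>R h) + 1/2 * ((c *\<^sub>R h) \<bullet> (vxx t (x + \<theta> *\<^sub>R (c *\<^sub>R h)) *v (c *\<^sub>R h)))"
      using C12_on_line_taylor[OF C12 t] by blast
    have "\<theta> * (c * norm h) \<le> 1 * (c * norm h)" using \<theta> c by (intro mult_right_mono) auto
    moreover have "norm (\<theta> *\<^sub>R (c *\<^sub>R h)) = \<theta> * (c * norm h)" using \<theta>(1) c by (simp add: mult.assoc)
    ultimately have "norm (\<theta> *\<^sub>R (c *\<^sub>R h)) < r" using ch by linarith
    then have 1: "?g (x + \<theta> *\<^sub>R (c *\<^sub>R h)) < 0" by (intro r(2)[THEN conjunct2]) (simp only: dist_norm add_diff_cancel_left')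
    have 2: "v t x \<le> v t (x + c *\<^sub>R h)" using ch c by (intro min r(2)[THEN conjunct1]) (simp add: dist_norm)
    have "v t (x + c *\<^sub>R h) = v t x + 1/2 * (c * (c * ?g (x + \<theta> *\<^sub>R (c *\<^sub>R h))))"
      unfolding \<theta>(3) vx0 by (simp add: matrix_vector_mult_scaleR)
    moreover have "c * (c * ?g (x + \<theta> *\<^sub>R (c *\<^sub>R h))) < 0" using 1 c by (simp add: mult_pos_neg)
    ultimately show False using 2 by simp
  qed
qed

text \<open>A negative minimum of the perturbed function over the compact cylinder is impossible in
  each position: at time \<open>T\<close> by the terminal condition; over the frontier because
  \<open>v\<close> does not increase in time there, so a negative value would persist up to
  \<open>T\<close>; over \<open>D\<close> because the first and second order conditions force the
  generator to be positive.\<close>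

lemma supersolution_nonneg:
  assumes C12: "C12_on T v vt vx vxx" and D: "open D" "bounded D"
    and gen: "\<And>t x. t \<in> {0..T} \<Longrightarrow> x \<in> D \<Longrightarrow> generator b \<sigma> vt vx vxx t x \<le> 0"
    and bd: "\<And>t x. t \<in> {0..T} \<Longrightarrow> x \<in> frontier D \<Longrightarrow> vt t x \<le> 0"
    and fin: "\<And>x. x \<in> closure D \<Longrightarrow> 0 \<le> v T x"
    and tx: "t \<in> {0..T}" "x \<in> D"
  shows "0 \<le> v t x"
proof (rule ccontr)
  assume "\<not> 0 \<le> v t x"
  then have neg: "v t x < 0" by simp
  \<comment> \<open>Small enough for \<open>v t x + e * (T - t)\<close> to stay negative;
    \<open>T + 1\<close> keeps the denominator positive.\<close>
  define e where "e = - v t x / (2 * (T + 1))"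
  have T: "0 \<le> T" using tx by auto
  have e: "0 < e" "e * T < - v t x"
  proof -
    show "0 < e" unfolding e_def using neg T by (intro divide_pos_pos) auto
    have "e * T = (- v t x / 2) * (T / (T + 1))" by (simp add: e_def)
    also have "\<dots> \<le> (- v t x / 2) * 1" using neg T by (intro mult_left_mono) auto
    also have "\<dots> < - v t x" using neg by simp
    finally show "e * T < - v t x" .
  qed
  let ?w = "\<lambda>(t, x). v t x + e * (T - t)"
  have "compact ({0..T} \<times> closure D)" using D by (intro compact_Times) (auto simp: compact_closure)
  moreover have "({0..T} \<times> closure D) \<noteq> {}" using tx closure_subset by auto
  moreover have "continuous_on ({0..T} \<times> closure D) ?w"
  proof -
    have "continuous_on ({0..T} \<times> closure D) (\<lambda>(t, x). v t x)"
      using C12 unfolding C12_on_def by (auto elim: continuous_on_subset)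
    then show ?thesis unfolding case_prod_beta by (intro continuous_intros)
  qed
  ultimately have "\<exists>p\<in>{0..T} \<times> closure D. \<forall>q\<in>{0..T} \<times> closure D. ?w p \<le> ?w q"
    by (rule continuous_attains_inf)
  then obtain p where p: "p \<in> {0..T} \<times> closure D" and pmin: "\<forall>q\<in>{0..T} \<times> closure D. ?w p \<le> ?w q" ..
  obtain s y where sy: "p = (s, y)" by (cases p)
  have s: "s \<in> {0..T}" and y: "y \<in> closure D" using p sy by auto
  have min: "v s y + e * (T - s) \<le> v r z + e * (T - r)" if "r \<in> {0..T}" "z \<in> closure D" for r z
    using bspec[OF pmin, of "(r, z)"] that sy by simp
  have "v s y + e * (T - s) \<le> v t x + e * (T - t)" using tx closure_subset by (intro min) auto
  also have "\<dots> \<le> v t x + e * T" using tx e by simp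
  also have "\<dots> < 0" using e by simp
  finally have wneg: "v s y + e * (T - s) < 0" .
  have sT: "s < T" using wneg fin[OF y] s by (cases "s = T") auto
  have vneg: "v s y < 0" using wneg e s by (smt (verit) atLeastAtMost_iff mult_nonneg_nonneg)
  show False
  proof (cases "y \<in> D")
    case False
    then have fr: "y \<in> frontier D" using y D(1) by (simp add: frontier_def interior_open)
    obtain r where r: "r \<in> {s..T}" "v T y - v s y = vt r y * (T - s)"
      using C12_on_time_mean_value[OF C12, of s T y] s by auto
    have "vt r y \<le> 0" using r s fr by (intro bd) auto
    then have "v T y \<le> v s y" using r(2) sT by (smt (verit) mult_nonpos_nonneg)
    then show False using fin[OF y] vneg by simp
  next
    case True
    have "v s y \<le> v s z" if "z \<in> D" for z
      using min[OF s, of z] that closure_subset by auto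
    note * = C12_on_Hessian_nonneg_at_min[OF C12 s D(1) True this]
    have tr: "0 \<le> trace (transpose (\<sigma> y) ** vxx s y ** \<sigma> y)"
      unfolding trace_conjugate_eq_inner inner_matrix_columns by (intro sum_nonneg *)
    have der: "((\<lambda>r. v r y + e * (T - r)) has_real_derivative vt s y - e) (at s within {0..T})"
      using C12 s unfolding C12_on_def by (auto intro!: derivative_eq_intros)
    \<comment> \<open>As \<open>s < T\<close>, the minimum can be compared with later times, so the
      right-hand difference quotient is nonnegative, also for \<open>s = 0\<close>. The perturbation
      turns this into the strict \<open>vt s y \<ge> e > 0\<close>.\<close>
    have "0 \<le> vt s y - e"
    proof (rule ccontr)
      assume "\<not> 0 \<le> vt s y - e"
      then have "vt s y - e < 0" by simp
      from has_real_derivative_neg_dec_right[OF der this] obtain d where d: "0 < d"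
        "\<And>h. 0 < h \<Longrightarrow> s + h \<in> {0..T} \<Longrightarrow> h < d \<Longrightarrow> v (s + h) y + e * (T - (s + h)) < v s y + e * (T - s)" by blast
      define h where "h = min (d / 2) (T - s)"
      have h: "0 < h" "h < d" "s + h \<in> {0..T}" using d(1) sT s by (auto simp: h_def)
      from d(2)[OF h(1,3,2)] min[OF h(3) y] show False by simp
    qed
    then have "0 < generator b \<sigma> vt vx vxx s y" unfolding generator_def using * tr e by simp
    with gen[OF s True] show False by simp
  qed
qed

text \<open>One step: \<open>a\<close> is the drift increment and \<open>e\<close> the increment of
  the stochastic integral. For a small step this is Taylor's formula, with all terms quadratic in
  the drift or mixed absorbed by \<open>\<epsilon>\<close>; for a large one the clamp bounds the
  left side by \<open>2 * c\<close>, and the indicator term pays for it. The term linear in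
  \<open>e\<close> is kept exactly, because later its mean and not its size removes it. The ball of
  radius \<open>R + 1\<close> contains all points reached from \<open>D\<close> by small
  steps.\<close>

lemma clamped_taylor_upper_bound:
  fixes v :: "real \<Rightarrow> real^'n \<Rightarrow> real"
  assumes C12: "C12_on T v vt vx vxx" and R: "D \<subseteq> cball 0 R"
    and c: "\<And>t x. t \<in> {0..T} \<Longrightarrow> x \<in> cball 0 (R + 1) \<Longrightarrow> \<bar>v t x\<bar> \<le> c" "0 \<le> c"
    and L: "0 \<le> L" and \<epsilon>: "0 < \<epsilon>"
  shows "\<exists>\<eta>>0. \<exists>C\<ge>0. \<exists>h0>0. \<forall>t h z a e. 0 \<le> t \<longrightarrow> 0 \<le> h \<longrightarrow> h \<le> h0 \<longrightarrow> t + h \<le> T \<longrightarrow> z \<in> D \<longrightarrow>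
      norm a \<le> L * h \<longrightarrow>
      max (- c) (min c (v (t + h) (z + a + e))) - v t z \<le>
      vt t z * h + vx t z \<bullet> a + vx t z \<bullet> e + 1/2 * (e \<bullet> (vxx t z *v e)) + \<epsilon> * (h + (norm e)\<^sup>2)
        + C * ((norm e)\<^sup>2 * indicator {\<eta><..} (norm e))"
proof -
  let ?B = "{0..T} \<times> cball (0::real^'n) (R + 1)"
  have cpt: "compact ?B" by (intro compact_Times) auto
  obtain K where K: "K \<ge> 0" "\<And>A x. norm ((A::real^'n^'n) *v (x::real^'n)) \<le> norm A * norm x * K"
    using bounded_bilinear.nonneg_bounded[OF bounded_bilinear_matrix_vector] by blast
  have quad: "\<bar>x \<bullet> (A *v y)\<bar> \<le> K * norm A * norm x * norm y" for A :: "real^'n^'n" and x y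
  proof -
    have "\<bar>x \<bullet> (A *v y)\<bar> \<le> norm x * norm (A *v y)" by (rule Cauchy_Schwarz_ineq2)
    also have "\<dots> \<le> norm x * (norm A * norm y * K)" by (intro mult_left_mono K) auto
    finally show ?thesis by (simp add: mult_ac)
  qed
  have ct: "continuous_on ?B (\<lambda>(t, x). vt t x)" and cx: "continuous_on ?B (\<lambda>(t, x). vx t x)"
    and cxx: "continuous_on ?B (\<lambda>(t, x). vxx t x)"
    using C12 unfolding C12_on_def by (auto elim!: continuous_on_subset)
  have "\<exists>G. \<forall>p\<in>?B. norm (f p) \<le> G" if "continuous_on ?B f" for f :: "real \<times> (real^'n) \<Rightarrow> 'z::real_normed_vector"
    using compact_imp_bounded[OF compact_continuous_image[OF that cpt]] by (auto simp: bounded_iff)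
  note bd = this
  obtain G1 where G1: "\<forall>p\<in>?B. norm (case p of (t, x) \<Rightarrow> vt t x) \<le> G1" using bd[OF ct] ..
  obtain G2 where G2: "\<forall>p\<in>?B. norm (case p of (t, x) \<Rightarrow> vx t x) \<le> G2" using bd[OF cx] ..
  obtain G3 where G3: "\<forall>p\<in>?B. norm (case p of (t, x) \<Rightarrow> vxx t x) \<le> G3" using bd[OF cxx] ..
  have G123: "\<bar>vt t x\<bar> \<le> G1" "norm (vx t x) \<le> G2" "norm (vxx t x) \<le> G3" if "(t, x) \<in> ?B" for t x
    using bspec[OF G1 that] bspec[OF G2 that] bspec[OF G3 that] by simp_all
  \<comment> \<open>One constant for all three derivatives; \<open>K\<close> is the bound of the
    matrix-vector product.\<close>
  define G where "G = \<bar>G1\<bar> + \<bar>G2\<bar> + K * \<bar>G3\<bar>"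
  have G0: "0 \<le> G" using K by (simp add: G_def)
  have Gt: "\<bar>vt t x\<bar> \<le> G" and Gx: "\<bar>vx t x \<bullet> y\<bar> \<le> G * norm y"
    and Gxx: "\<bar>y \<bullet> (vxx t x *v y')\<bar> \<le> G * norm y * norm y'" if "(t, x) \<in> ?B" for t x y y'
  proof -
    have nn: "0 \<le> K * \<bar>G3\<bar>" using K by simp
    show "\<bar>vt t x\<bar> \<le> G" using G123(1)[OF that] nn by (simp add: G_def)
    have "\<bar>vx t x \<bullet> y\<bar> \<le> norm (vx t x) * norm y" by (rule Cauchy_Schwarz_ineq2)
    also have "\<dots> \<le> G * norm y" using G123(2)[OF that] nn by (intro mult_right_mono) (auto simp: G_def)
    finally show "\<bar>vx t x \<bullet> y\<bar> \<le> G * norm y" .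
    have "K * norm (vxx t x) \<le> K * \<bar>G3\<bar>" using K G123(3)[OF that] by (intro mult_left_mono) auto
    then have "K * norm (vxx t x) \<le> G" by (simp add: G_def)
    then have "K * norm (vxx t x) * norm y * norm y' \<le> G * norm y * norm y'" by (intro mult_right_mono) auto
    with quad[of y "vxx t x" y'] show "\<bar>y \<bullet> (vxx t x *v y')\<bar> \<le> G * norm y * norm y'" by linarith
  qed
  \<comment> \<open>Budget: the moduli of continuity of \<open>vt\<close> and \<open>vxx\<close>
    cost \<open>\<epsilon>' * h\<close> each, and the drift terms cost
    \<open>\<epsilon> / 2 * h\<close> through \<open>\<kappa>\<close>; the coefficients of
    \<open>(norm e)\<^sup>2\<close> add up to \<open>\<epsilon> / 2\<close>.\<close>
  define \<epsilon>' where "\<epsilon>' = \<epsilon> / 4"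
  define \<kappa> where "\<kappa> = min 1 (\<epsilon> / (2 * (G + 1)))"
  have \<epsilon>': "0 < \<epsilon>'" using \<epsilon> by (simp add: \<epsilon>'_def)
  have \<kappa>: "0 < \<kappa>" "\<kappa> \<le> 1" "G * \<kappa> \<le> \<epsilon> / 2"
  proof -
    show "0 < \<kappa>" "\<kappa> \<le> 1" using \<epsilon> G0 by (auto simp: \<kappa>_def)
    have "G * \<kappa> \<le> G * (\<epsilon> / (2 * (G + 1)))" using G0 by (intro mult_left_mono) (auto simp: \<kappa>_def)
    also have "\<dots> = (G / (G + 1)) * (\<epsilon> / 2)" by simp
    also have "\<dots> \<le> 1 * (\<epsilon> / 2)" using G0 \<epsilon> by (intro mult_right_mono) auto
    finally show "G * \<kappa> \<le> \<epsilon> / 2" by simp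
  qed
  have "uniformly_continuous_on ?B (\<lambda>(t, x). vt t x)" "uniformly_continuous_on ?B (\<lambda>(t, x). vxx t x)"
    using ct cxx cpt by (auto intro: compact_uniformly_continuous)
  moreover have "0 < \<epsilon>' / (K + 1)" using \<epsilon>' K by simp
  ultimately obtain d1 d2 where
    d1: "0 < d1" "\<And>p q. p \<in> ?B \<Longrightarrow> q \<in> ?B \<Longrightarrow> dist q p < d1 \<Longrightarrow> dist (case q of (t, x) \<Rightarrow> vt t x) (case p of (t, x) \<Rightarrow> vt t x) < \<epsilon>'" and
    d2: "0 < d2" "\<And>p q. p \<in> ?B \<Longrightarrow> q \<in> ?B \<Longrightarrow> dist q p < d2 \<Longrightarrow> dist (case q of (t, x) \<Rightarrow> vxx t x) (case p of (t, x) \<Rightarrow> vxx t x) < \<epsilon>' / (K + 1)"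
    using \<epsilon>' unfolding uniformly_continuous_on_def by metis
  \<comment> \<open>In a small step time and space move by less than \<open>d0\<close> each, so the
    pair moves by less than \<open>2 * d0\<close>.\<close>
  define d0 where "d0 = min 1 (min (d1 / 2) (d2 / 2))"
  have d0: "0 < d0" "d0 \<le> 1" "2 * d0 \<le> d1" "2 * d0 \<le> d2" using d1 d2 by (auto simp: d0_def)
  \<comment> \<open>The three bounds serve the time step, the drift step
    \<open>L * h \<le> d0 / 2\<close>, and the absorption of the drift terms through
    \<open>L\<^sup>2 * h \<le> \<kappa>\<^sup>2\<close>.\<close>
  define h0 where "h0 = min (d0 / 2) (min (d0 / 2 / (L + 1)) (\<kappa>\<^sup>2 / (L\<^sup>2 + 1)))"
  have h0: "0 < h0" using d0 L \<kappa> by (auto simp: h0_def intro!: divide_pos_pos add_nonneg_pos)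
  have h0': "h < d0" "h \<le> 1" "L * h \<le> d0 / 2" "L\<^sup>2 * h \<le> \<kappa>\<^sup>2" "L\<^sup>2 * h \<le> \<kappa>" if h: "0 \<le> h" "h \<le> h0" for h
  proof -
    have "h \<le> d0 / 2" using h by (simp add: h0_def)
    then show "h < d0" "h \<le> 1" using d0 by auto
    have "L * h \<le> (L + 1) * (d0 / 2 / (L + 1))" using h L d0 by (intro mult_mono) (auto simp: h0_def)
    also have "(L + 1) * (d0 / 2 / (L + 1)) = d0 / 2"
      by (subst times_divide_eq_right, rule nonzero_mult_div_cancel_left) (use L in simp)
    finally show "L * h \<le> d0 / 2" .
    have p: "0 < L\<^sup>2 + 1" by (simp add: add_nonneg_pos)
    have "L\<^sup>2 * h \<le> (L\<^sup>2 + 1) * (\<kappa>\<^sup>2 / (L\<^sup>2 + 1))" using h by (intro mult_mono) (auto simp: h0_def)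
    also have "\<dots> = \<kappa>\<^sup>2" using p by simp
    finally show "L\<^sup>2 * h \<le> \<kappa>\<^sup>2" .
    moreover have "\<kappa>\<^sup>2 \<le> \<kappa>" using \<kappa> by (simp add: power2_eq_square mult_left_le)
    ultimately show "L\<^sup>2 * h \<le> \<kappa>" by simp
  qed
  \<comment> \<open>If \<open>norm (a + e) \<ge> d0\<close>, then \<open>norm e \<ge> r\<close>,
    since the drift takes at most half. The threshold of the indicator is \<open>r / 2\<close>,
    because \<open>{r<..}\<close> would miss \<open>norm e = r\<close>.\<close>
  define r where "r = d0 / 2"
  have r: "0 < r" using d0 by (simp add: r_def)
  \<comment> \<open>For \<open>norm e \<ge> r\<close> the three summands dominate the bounded terms,
    the linear and the quadratic term in \<open>e\<close>, each as a multiple of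
    \<open>(norm e)\<^sup>2\<close>.\<close>
  define C where "C = (2 * c + G + G * L) / r\<^sup>2 + G / r + G / 2"
  have C0: "0 \<le> C" using c(2) G0 L r by (simp add: C_def)
  have main: "max (- c) (min c (v (t + h) (z + a + e))) - v t z \<le>
      vt t z * h + vx t z \<bullet> a + vx t z \<bullet> e + 1/2 * (e \<bullet> (vxx t z *v e)) + \<epsilon> * (h + (norm e)\<^sup>2)
        + C * ((norm e)\<^sup>2 * indicator {r / 2<..} (norm e))"
    if t: "0 \<le> t" and h: "0 \<le> h" "h \<le> h0" and th: "t + h \<le> T" and z: "z \<in> D" and a: "norm a \<le> L * h" for t h z a e
  proof -
    note h' = h0'[OF h]
    have tz: "(t, z) \<in> ?B" using t h th z R by auto
    have Lh: "norm a \<le> d0 / 2" using a h' by simp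
    have eps_nn: "0 \<le> \<epsilon> * (h + (norm e)\<^sup>2)" using \<epsilon> h by simp
    show ?thesis
    proof (cases "norm (a + e) < d0")
      case False
      have "norm (a + e) \<le> norm a + norm e" by (rule norm_triangle_ineq)
      then have er: "r \<le> norm e" using False Lh by (simp add: r_def)
      have ind: "indicator {r / 2<..} (norm e) = (1::real)" using er r by simp
      have "max (- c) (min c (v (t + h) (z + a + e))) - v t z \<le> 2 * c"
        using c(1)[of t z] c(2) tz by auto
      moreover have "- (G * h) \<le> vt t z * h"
        using mult_right_mono[OF Gt[OF tz] h(1)] h(1) abs_le_iff[of "vt t z * h" "G * h"] by (simp add: abs_mult)
      moreover have "- (G * L * h) \<le> vx t z \<bullet> a"
        using Gx[OF tz, of a] mult_left_mono[OF a G0] by (simp add: mult.assoc)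
      moreover have "- (G * norm e) \<le> vx t z \<bullet> e" using Gx[OF tz, of e] by simp
      moreover have "- (G / 2 * (norm e)\<^sup>2) \<le> 1/2 * (e \<bullet> (vxx t z *v e))"
        using Gxx[OF tz, of e e] by (simp add: power2_eq_square mult.assoc)
      moreover have "2 * c + G * h + G * L * h + G * norm e + G / 2 * (norm e)\<^sup>2 \<le> C * (norm e)\<^sup>2"
      proof -
        have 1: "1 \<le> (norm e)\<^sup>2 / r\<^sup>2" using er r by (simp add: power_mono)
        have "norm e * r \<le> norm e * norm e" using er by (intro mult_left_mono) auto
        then have 2: "norm e \<le> (norm e)\<^sup>2 / r" using r by (simp add: field_simps power2_eq_square)
        have "2 * c + G * h + G * L * h \<le> (2 * c + G + G * L) * 1"
          using h' G0 L mult_left_mono[OF h'(2) G0] mult_left_mono[OF h'(2), of "G * L"] by simp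
        also have "\<dots> \<le> (2 * c + G + G * L) * ((norm e)\<^sup>2 / r\<^sup>2)"
          using 1 c(2) G0 L by (intro mult_left_mono) auto
        finally have 3: "2 * c + G * h + G * L * h \<le> (2 * c + G + G * L) / r\<^sup>2 * (norm e)\<^sup>2" by simp
        have 4: "G * norm e \<le> G / r * (norm e)\<^sup>2" using mult_left_mono[OF 2 G0] by simp
        show ?thesis unfolding C_def distrib_right using 3 4 by linarith
      qed
      ultimately show ?thesis unfolding ind using eps_nn by simp
    next
      case True
      let ?d = "a + e"
      have zd: "z + \<theta> *\<^sub>R ?d \<in> cball 0 (R + 1)" if "0 \<le> \<theta>" "\<theta> \<le> 1" for \<theta>
      proof -
        have "norm (z + \<theta> *\<^sub>R ?d) \<le> norm z + \<theta> * norm ?d" using norm_triangle_ineq[of z "\<theta> *\<^sub>R ?d"] that by simp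
        also have "\<theta> * norm ?d \<le> 1 * 1" using that True d0 by (intro mult_mono) auto
        finally show ?thesis using z R by auto
      qed
      have tT: "t \<in> {0..T}" "t + h \<in> {0..T}" using t h th by auto
      have zd1: "z + a + e \<in> cball 0 (R + 1)" using zd[of 1] by (simp add: add.assoc)
      have clamp: "max (- c) (min c (v (t + h) (z + a + e))) = v (t + h) (z + a + e)"
        using c(1)[OF tT(2) zd1] by auto
      obtain s where s: "s \<in> {t..t + h}" "v (t + h) (z + a + e) - v t (z + a + e) = vt s (z + a + e) * h"
        using C12_on_time_mean_value[OF C12, of t "t + h" "z + a + e"] t h th by auto
      obtain \<theta> where \<theta>: "0 < \<theta>" "\<theta> < 1"
        "v t (z + ?d) = v t z + vx t z \<bullet> ?d + 1/2 * (?d \<bullet> (vxx t (z + \<theta> *\<^sub>R ?d) *v ?d))"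
        using C12_on_line_taylor[OF C12 tT(1)] by blast
      have dd: "dist (p, z + \<theta> *\<^sub>R ?d) (t, z) < 2 * d0" if "\<bar>p - t\<bar> \<le> h" "0 \<le> \<theta>" "\<theta> \<le> 1" for p \<theta>
      proof -
        have "dist (p, z + \<theta> *\<^sub>R ?d) (t, z) \<le> \<bar>p - t\<bar> + \<theta> * norm ?d"
          unfolding dist_Pair_Pair using sqrt_sum_squares_le_sum[of "dist p t" "dist (z + \<theta> *\<^sub>R ?d) z"] that
          by (simp add: dist_norm)
        also have "\<theta> * norm ?d \<le> 1 * norm ?d" using that by (intro mult_right_mono) auto
        finally show ?thesis using that h'(1) True by simp
      qed
      have "dist (vt s (z + a + e)) (vt t z) < \<epsilon>'"
        using d1(2)[OF tz, of "(s, z + a + e)"] dd[of s 1] d0(3) s(1) th t zd1 by (simp add: add.assoc)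
      then have "vt s (z + a + e) * h \<le> (vt t z + \<epsilon>') * h"
        using h by (intro mult_right_mono) (auto simp: dist_real_def)
      then have A: "v (t + h) (z + a + e) - v t (z + a + e) \<le> vt t z * h + \<epsilon>' * h"
        using s(2) by (simp add: distrib_right)
      have "dist (vxx t (z + \<theta> *\<^sub>R ?d)) (vxx t z) < \<epsilon>' / (K + 1)"
        using d2(2)[OF tz, of "(t, z + \<theta> *\<^sub>R ?d)"] dd[of t \<theta>] d0(4) tT h \<theta> zd[of \<theta>] by simp
      then have "K * norm (vxx t (z + \<theta> *\<^sub>R ?d) - vxx t z) \<le> K * (\<epsilon>' / (K + 1))"
        using K by (intro mult_left_mono) (auto simp: dist_norm)
      also have "\<dots> = (K / (K + 1)) * \<epsilon>'" by simp
      also have "\<dots> \<le> 1 * \<epsilon>'" using K \<epsilon>' by (intro mult_right_mono) auto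
      finally have Kd: "K * norm (vxx t (z + \<theta> *\<^sub>R ?d) - vxx t z) \<le> \<epsilon>'" by simp
      have "?d \<bullet> (vxx t (z + \<theta> *\<^sub>R ?d) *v ?d) - ?d \<bullet> (vxx t z *v ?d) = ?d \<bullet> ((vxx t (z + \<theta> *\<^sub>R ?d) - vxx t z) *v ?d)"
        by (simp only: inner_diff_right[symmetric] matrix_vector_mult_diff_rdistrib[symmetric])
      also have "\<dots> \<le> K * norm (vxx t (z + \<theta> *\<^sub>R ?d) - vxx t z) * norm ?d * norm ?d"
        using quad[of ?d "vxx t (z + \<theta> *\<^sub>R ?d) - vxx t z" ?d] by linarith
      also have "\<dots> \<le> \<epsilon>' * norm ?d * norm ?d" by (intro mult_right_mono Kd) auto
      finally have B: "?d \<bullet> (vxx t (z + \<theta> *\<^sub>R ?d) *v ?d) \<le> ?d \<bullet> (vxx t z *v ?d) + \<epsilon>' * (norm ?d)\<^sup>2"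
        by (simp add: power2_eq_square mult.assoc)
      have a2: "(norm a)\<^sup>2 \<le> \<kappa> * h"
      proof -
        have "(norm a)\<^sup>2 \<le> (L * h)\<^sup>2" using a by (intro power_mono) auto
        also have "\<dots> = (L\<^sup>2 * h) * h" by (simp add: power2_eq_square)
        also have "\<dots> \<le> \<kappa> * h" using h'(5) h(1) by (intro mult_right_mono) auto
        finally show ?thesis .
      qed
      have ae: "2 * (norm a * norm e) \<le> \<kappa> * h + \<kappa> * (norm e)\<^sup>2"
      proof -
        have "2 * (norm a * norm e) \<le> 2 * (L * h * norm e)" using a by (simp add: mult_right_mono)
        also have "2 * (L * h * norm e) \<le> \<kappa> * h + \<kappa> * (norm e)\<^sup>2"
        proof -
          \<comment> \<open>Young's inequality, to be multiplied by \<open>h\<close> and divided by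
            \<open>\<kappa>\<close>.\<close>
          have "0 \<le> (\<kappa> - L * norm e)\<^sup>2" by simp
          then have "2 * (\<kappa> * (L * norm e)) \<le> \<kappa>\<^sup>2 + L\<^sup>2 * (norm e)\<^sup>2" by (simp add: power2_eq_square algebra_simps)
          then have "h * (2 * (\<kappa> * (L * norm e))) \<le> h * (\<kappa>\<^sup>2 + L\<^sup>2 * (norm e)\<^sup>2)" using h(1) by (rule mult_left_mono)
          also have "\<dots> = \<kappa>\<^sup>2 * h + (L\<^sup>2 * h) * (norm e)\<^sup>2" by (simp add: algebra_simps)
          also have "\<dots> \<le> \<kappa>\<^sup>2 * h + \<kappa>\<^sup>2 * (norm e)\<^sup>2" using h'(4) by (intro add_left_mono mult_right_mono) auto
          also have "\<dots> = \<kappa> * (\<kappa> * h + \<kappa> * (norm e)\<^sup>2)" by (simp add: power2_eq_square algebra_simps)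
          finally have "\<kappa> * (2 * (L * h * norm e)) \<le> \<kappa> * (\<kappa> * h + \<kappa> * (norm e)\<^sup>2)" by (simp add: mult_ac)
          then show ?thesis using \<kappa>(1) by simp
        qed
        finally show ?thesis .
      qed
      have d2': "(norm ?d)\<^sup>2 \<le> 2 * h + 2 * (norm e)\<^sup>2"
      proof -
        have "(norm ?d)\<^sup>2 \<le> (norm a + norm e)\<^sup>2" by (intro power_mono norm_triangle_ineq) auto
        also have "\<dots> \<le> 2 * (norm a)\<^sup>2 + 2 * (norm e)\<^sup>2"
          using zero_le_power2[of "norm a - norm e"] by (simp add: power2_eq_square algebra_simps)
        also have "(norm a)\<^sup>2 \<le> h" using a2 mult_right_mono[OF \<kappa>(2) h(1)] by simp
        finally show ?thesis by simp
      qed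
      have Q: "?d \<bullet> (vxx t z *v ?d) \<le> e \<bullet> (vxx t z *v e) + G * (2 * (\<kappa> * h) + \<kappa> * (norm e)\<^sup>2)"
      proof -
        have "?d \<bullet> (vxx t z *v ?d) = e \<bullet> (vxx t z *v e) + a \<bullet> (vxx t z *v a) + a \<bullet> (vxx t z *v e) + e \<bullet> (vxx t z *v a)"
          by (simp add: matrix_vector_right_distrib inner_add_left inner_add_right)
        also have "\<dots> \<le> e \<bullet> (vxx t z *v e) + G * norm a * norm a + G * norm a * norm e + G * norm e * norm a"
          using Gxx[OF tz, of a a] Gxx[OF tz, of a e] Gxx[OF tz, of e a] by linarith
        also have "\<dots> = e \<bullet> (vxx t z *v e) + G * ((norm a)\<^sup>2 + 2 * (norm a * norm e))"
          by (simp add: power2_eq_square algebra_simps)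
        also have "\<dots> \<le> e \<bullet> (vxx t z *v e) + G * (2 * (\<kappa> * h) + \<kappa> * (norm e)\<^sup>2)"
          using a2 ae by (intro add_left_mono mult_left_mono G0) simp
        finally show ?thesis .
      qed
      have Gk: "G * (2 * (\<kappa> * h) + \<kappa> * (norm e)\<^sup>2) \<le> \<epsilon> / 2 * (2 * h + (norm e)\<^sup>2)"
      proof -
        have "G * (2 * (\<kappa> * h) + \<kappa> * (norm e)\<^sup>2) = (G * \<kappa>) * (2 * h + (norm e)\<^sup>2)" by (simp add: algebra_simps)
        also have "\<dots> \<le> \<epsilon> / 2 * (2 * h + (norm e)\<^sup>2)" using \<kappa>(3) h by (intro mult_right_mono) auto
        finally show ?thesis .
      qed
      have e2: "\<epsilon>' * (norm ?d)\<^sup>2 \<le> \<epsilon>' * (2 * h + 2 * (norm e)\<^sup>2)"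
        using d2' \<epsilon>' by (intro mult_left_mono) auto
      have "v (t + h) (z + a + e) - v t z \<le> vt t z * h + \<epsilon>' * h + vx t z \<bullet> ?d +
         1/2 * (e \<bullet> (vxx t z *v e) + \<epsilon> / 2 * (2 * h + (norm e)\<^sup>2) + \<epsilon>' * (2 * h + 2 * (norm e)\<^sup>2))"
      proof -
        have lin: "x - s \<le> p + q + 1/2 * (e2 + g2 + k2)"
          if "x - y \<le> p" "y = s + q + 1/2 * r" "r \<le> r2 + k" "r2 \<le> e2 + g" "g \<le> g2" "k \<le> k2"
          for x y p s q r r2 k e2 g g2 k2 :: real
          using that by argo
        have "v t (z + a + e) = v t (z + ?d)" by (simp only: add.assoc)
        with \<theta>(3) have "v t (z + a + e) = v t z + vx t z \<bullet> ?d + 1/2 * (?d \<bullet> (vxx t (z + \<theta> *\<^sub>R ?d) *v ?d))"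
          by (rule trans[rotated])
        from lin[OF A this B Q Gk e2] show ?thesis .
      qed
      also have "\<dots> = vt t z * h + vx t z \<bullet> a + vx t z \<bullet> e + 1/2 * (e \<bullet> (vxx t z *v e)) +
          (\<epsilon> * h + \<epsilon> / 2 * (norm e)\<^sup>2)"
        by (simp add: \<epsilon>'_def inner_add_right algebra_simps)
      also have "\<dots> \<le> vt t z * h + vx t z \<bullet> a + vx t z \<bullet> e + 1/2 * (e \<bullet> (vxx t z *v e)) + \<epsilon> * (h + (norm e)\<^sup>2)"
      proof -
        have "0 \<le> \<epsilon> * (norm e)\<^sup>2" using \<epsilon> by simp
        then show ?thesis by (simp add: algebra_simps)
      qed
      finally show ?thesis unfolding clamp using C0 by (simp add: add_increasing2)
    qed
  qed
  show ?thesis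
    by (rule exI[of _ "r / 2"], intro conjI exI[of _ C] exI[of _ h0] allI impI) (use r C0 h0 main in auto)
qed

section \<open>The stopped diffusion\<close>

context ito_process
begin

lemma ito_approximation_exists: "\<exists>N p q \<xi>. ito_approximation M W N p q \<xi> H I T"
proof -
  obtain N p q \<xi> where "\<forall>m. elementary {..<N m :: nat} (p m) (q m) (\<xi> m)"
    "(\<lambda>m. sqdist P (\<lambda>x. cut 0 T (elem_process {..<N m} (p m) (q m) (\<xi> m)) x) (cut 0 T H)) \<longlonglongrightarrow> 0"
    "\<forall>t. 0 \<le> t \<longrightarrow> t \<le> T \<longrightarrow>
      (\<lambda>m. sqdist M (elem_integral {..<N m} (p m) (q m) (\<xi> m) t) (I t)) \<longlonglongrightarrow> 0"
    using approximation by (elim exE conjE)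
  then have "ito_approximation M W N p q \<xi> H I T"
    by unfold_locales (use T cut_H_measurable[of 0 T] I_measurable in auto)
  then show ?thesis by blast
qed

end

text \<open>Rounding down to a grid yields measurable step approximations of a path and never
  evaluates the path beyond the given time.\<close>

lemma grid_floor_tendsto: "(\<lambda>n. real_of_int \<lfloor>real (Suc n) * x\<rfloor> / real (Suc n)) \<longlonglongrightarrow> x" for x :: real
proof (rule tendsto_sandwich)
  show "\<forall>\<^sub>F n in sequentially. x - 1 / real (Suc n) \<le> real_of_int \<lfloor>real (Suc n) * x\<rfloor> / real (Suc n)"
  proof (rule always_eventually, rule allI)
    fix n
    have "real (Suc n) * x - 1 \<le> real_of_int \<lfloor>real (Suc n) * x\<rfloor>" by linarith
    then have "(real (Suc n) * x - 1) / real (Suc n) \<le> real_of_int \<lfloor>real (Suc n) * x\<rfloor> / real (Suc n)"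
      by (intro divide_right_mono) auto
    then show "x - 1 / real (Suc n) \<le> real_of_int \<lfloor>real (Suc n) * x\<rfloor> / real (Suc n)"
      by (simp add: diff_divide_distrib)
  qed
  show "\<forall>\<^sub>F n in sequentially. real_of_int \<lfloor>real (Suc n) * x\<rfloor> / real (Suc n) \<le> x"
  proof (rule always_eventually, rule allI)
    fix n
    have "real_of_int \<lfloor>real (Suc n) * x\<rfloor> \<le> real (Suc n) * x" by linarith
    then show "real_of_int \<lfloor>real (Suc n) * x\<rfloor> / real (Suc n) \<le> x"
      by (simp add: divide_le_eq mult.commute)
  qed
  have "(\<lambda>n. x - 1 / real (Suc n)) \<longlonglongrightarrow> x - 0"
    by (intro tendsto_diff tendsto_const LIMSEQ_Suc[OF lim_1_over_n])
  then show "(\<lambda>n. x - 1 / real (Suc n)) \<longlonglongrightarrow> x" by simp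
qed simp

lemma continuous_on_prod_compose:
  assumes f: "continuous_on (A \<times> UNIV) (\<lambda>(t, x). f t x)" and "continuous_on B g" "continuous_on B h"
    and "\<And>p. p \<in> B \<Longrightarrow> g p \<in> A"
  shows "continuous_on B (\<lambda>p. f (g p) (h p))"
proof -
  have "continuous_on B (\<lambda>p. (\<lambda>(t, x). f t x) (g p, h p))"
    by (rule continuous_on_compose2[OF f continuous_on_Pair[OF assms(2,3)]]) (use assms(4) in auto)
  then show ?thesis by simp
qed

text \<open>For \<open>L > 0\<close> this is the radial retraction onto the ball of radius
  \<open>L\<close>. Its continuity keeps the truncated drift continuous along paths that leave
  \<open>D\<close>.\<close>

definition truncate_norm :: "real \<Rightarrow> 'v::real_normed_vector \<Rightarrow> 'v" where
  "truncate_norm L x = (L / max L (norm x)) *\<^sub>R x"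

lemma truncate_norm_eq: "0 < L \<Longrightarrow> norm x \<le> L \<Longrightarrow> truncate_norm L x = x"
  by (simp add: truncate_norm_def max_absorb1)

lemma norm_truncate_norm_le: "0 < L \<Longrightarrow> norm (truncate_norm L x) \<le> L"
  by (auto simp: truncate_norm_def max_def)

lemma continuous_on_truncate_norm [continuous_intros]:
  "0 < L \<Longrightarrow> continuous_on A f \<Longrightarrow> continuous_on A (\<lambda>x. truncate_norm L (f x))"
  unfolding truncate_norm_def by (intro continuous_intros) auto

lemma integrable_indicator_Ioc:
  fixes f :: "real \<Rightarrow> 'b::{banach, second_countable_topology}"
  assumes "continuous_on UNIV f"
  shows "integrable lborel (\<lambda>u. indicator {s<..t} u *\<^sub>R f u)"
proof -
  have "integrable lborel (\<lambda>u. indicator {s..t} u *\<^sub>R f u)"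
    using assms by (intro borel_integrable_compact) (auto elim: continuous_on_subset)
  then have "integrable lborel (\<lambda>u. indicator {s<..t} u *\<^sub>R (indicator {s..t} u *\<^sub>R f u))"
    by (rule integrable_mult_indicator[rotated]) simp
  also have "(\<lambda>u. indicator {s<..t} u *\<^sub>R (indicator {s..t} u *\<^sub>R f u)) = (\<lambda>u. indicator {s<..t} u *\<^sub>R f u)"
    by (auto simp: indicator_def)
  finally show ?thesis .
qed

lemma integral_indicator_Ioc_const: "s \<le> t \<Longrightarrow> (\<integral>u. indicator {s<..t} u * k \<partial>lborel) = (t - s) * k" for s t k :: real
  by simp

text \<open>The setting for one localizing time \<open>\<tau>\<close>. Continuity and adaptedness of
  the path are assumed up to \<open>\<tau>\<close>, which may lie beyond the exit from
  \<open>D\<close>; the bounds \<open>L\<close> and \<open>G\<close> hold on \<open>D\<close>, and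
  \<open>c\<close> on a larger ball.\<close>

locale stopped_diffusion = brownian M W for M :: "'a measure" and W :: "real \<Rightarrow> 'a \<Rightarrow> real ^ 'k" +
  fixes b :: "real ^ 'n \<Rightarrow> real ^ 'n" and \<sigma> :: "real ^ 'n \<Rightarrow> real ^ 'k ^ 'n"
    and X :: "real \<Rightarrow> 'a \<Rightarrow> real ^ 'n" and \<tau> :: "'a \<Rightarrow> real" and x0 :: "real ^ 'n"
    and D :: "(real ^ 'n) set" and T :: real
    and v vt :: "real \<Rightarrow> real ^ 'n \<Rightarrow> real" and vx :: "real \<Rightarrow> real ^ 'n \<Rightarrow> real ^ 'n"
    and vxx :: "real \<Rightarrow> real ^ 'n \<Rightarrow> real ^ 'n ^ 'n" and R L c G :: real
  assumes \<tau>: "stopping_time F \<tau>" "\<And>\<omega>. \<omega> \<in> space M \<Longrightarrow> 0 \<le> \<tau> \<omega>"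
    and X_0: "\<And>\<omega>. \<omega> \<in> space M \<Longrightarrow> X 0 \<omega> = x0"
    and X_cont: "\<And>\<omega>. \<omega> \<in> space M \<Longrightarrow> continuous_on {0..\<tau> \<omega>} (\<lambda>t. X t \<omega>)"
    and X_adapted: "\<And>t. 0 \<le> t \<Longrightarrow> X t \<in> borel_measurable (restrict_space (F t) {\<omega> \<in> space M. t \<le> \<tau> \<omega>})"
    and X_ito: "\<And>t. 0 \<le> t \<Longrightarrow> has_ito_integral M F W (\<lambda>s \<omega>. indicator {..\<tau> \<omega>} s *\<^sub>R \<sigma> (X s \<omega>)) t
            (\<lambda>\<omega>. X (min t (\<tau> \<omega>)) \<omega> - x0 - integral {0..min t (\<tau> \<omega>)} (\<lambda>s. b (X s \<omega>)))"
    and b_cont: "continuous_on UNIV b" and \<sigma>_cont: "continuous_on UNIV \<sigma>"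
    and D: "open D" "bounded D" "x0 \<in> D" and T: "0 < T"
    and C12: "C12_on T v vt vx vxx"
    and gen: "\<And>t x. t \<in> {0..T} \<Longrightarrow> x \<in> D \<Longrightarrow> generator b \<sigma> vt vx vxx t x \<le> 0"
    and v_nonneg: "\<And>t x. t \<in> {0..T} \<Longrightarrow> x \<in> D \<Longrightarrow> 0 \<le> v t x"
    and R: "D \<subseteq> cball 0 R"
    and L: "0 < L" "\<And>x. x \<in> D \<Longrightarrow> norm (b x) \<le> L"
    and c: "0 \<le> c" "\<And>t x. t \<in> {0..T} \<Longrightarrow> x \<in> cball 0 (R + 1) \<Longrightarrow> \<bar>v t x\<bar> \<le> c"
    and G: "\<And>t x. t \<in> {0..T} \<Longrightarrow> x \<in> D \<Longrightarrow> \<bar>vt t x\<bar> \<le> G"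
      "\<And>t x. t \<in> {0..T} \<Longrightarrow> x \<in> D \<Longrightarrow> norm (vx t x) \<le> G"
      "\<And>t x. t \<in> {0..T} \<Longrightarrow> x \<in> D \<Longrightarrow> norm (vxx t x) \<le> G"
begin

text \<open>The path frozen at \<open>\<tau>\<close>; the outer \<open>max\<close> also freezes it
  before time \<open>0\<close>, so that it is continuous on the whole line.\<close>

definition Y :: "real \<Rightarrow> 'a \<Rightarrow> real ^ 'n" where "Y s \<omega> = X (max 0 (min s (\<tau> \<omega>))) \<omega>"

definition H :: "real \<Rightarrow> 'a \<Rightarrow> real ^ 'k ^ 'n" where "H s \<omega> = indicator {..\<tau> \<omega>} s *\<^sub>R \<sigma> (X s \<omega>)"

text \<open>The stochastic integral is defined by the equation itself and not as a chosen limit.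
  This selects a version with continuous paths, and \<open>X_ito\<close> says that it is an Ito
  integral of \<open>H\<close>.\<close>

definition I :: "real \<Rightarrow> 'a \<Rightarrow> real ^ 'n" where
  "I t \<omega> = X (min t (\<tau> \<omega>)) \<omega> - x0 - integral {0..min t (\<tau> \<omega>)} (\<lambda>s. b (X s \<omega>))"

lemma Y_cont: "\<omega> \<in> space M \<Longrightarrow> continuous_on A (\<lambda>s. Y s \<omega>)"
  unfolding Y_def by (rule continuous_on_compose2[OF X_cont]) (auto intro!: continuous_intros \<tau>(2))

lemma Y_eq_X: "0 \<le> s \<Longrightarrow> s \<le> \<tau> \<omega> \<Longrightarrow> Y s \<omega> = X s \<omega>"
  by (simp add: Y_def)

lemma Y_0: "\<omega> \<in> space M \<Longrightarrow> Y 0 \<omega> = x0"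
  using \<tau>(2) X_0 by (simp add: Y_def)

lemma H_eq: "0 \<le> s \<Longrightarrow> H s \<omega> = indicator {..\<tau> \<omega>} s *\<^sub>R \<sigma> (Y s \<omega>)"
  using Y_eq_X[of s \<omega>] by (auto simp: H_def indicator_def)

lemma min_\<tau>_measurable: "(\<lambda>\<omega>. min t (\<tau> \<omega>)) \<in> borel_measurable (F t)"
proof (rule borel_measurableI_le)
  fix s
  show "{\<omega> \<in> space (F t). min t (\<tau> \<omega>) \<le> s} \<in> sets (F t)"
  proof (cases "t \<le> s")
    case True
    then have "{\<omega> \<in> space (F t). min t (\<tau> \<omega>) \<le> s} = space (F t)" by auto
    then show ?thesis by (metis sets.top)
  next
    case False
    then have "{\<omega> \<in> space (F t). min t (\<tau> \<omega>) \<le> s} = {\<omega> \<in> space (F s). \<tau> \<omega> \<le> s}" by auto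
    also have "\<dots> \<in> sets (F s)" using stopping_timeD[OF \<tau>(1), of s] by (simp add: pred_def)
    also have "sets (F s) \<subseteq> sets (F t)" using False by (intro sets_F_mono) auto
    finally show ?thesis .
  qed
qed

lemma \<tau>_le_sets:
  assumes "s \<le> t" shows "{\<omega> \<in> space M. s \<le> \<tau> \<omega>} \<in> sets (F t)"
proof -
  have "{\<omega> \<in> space M. s \<le> \<tau> \<omega>} = {\<omega> \<in> space (F t). s \<le> min t (\<tau> \<omega>)}" using assms by auto
  also have "\<dots> \<in> sets (F t)" using min_\<tau>_measurable[of t] by measurable
  finally show ?thesis .
qed

text \<open>Adaptedness of the stopped path: on each cell of a time grid the path is frozen at the left end point,
  where it is defined since the cell starts before \<open>\<tau>\<close>.\<close>

lemma Y_measurable: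
  assumes t: "0 \<le> t" shows "Y t \<in> borel_measurable (F t)"
proof -
  define d where "d n \<omega> = real_of_int \<lfloor>real (Suc n) * min t (\<tau> \<omega>)\<rfloor> / real (Suc n)" for n \<omega>
  \<comment> \<open>The guard on the grid time keeps each \<open>f n j\<close> measurable with
    respect to \<open>F t\<close>; its value \<open>0\<close> is not met at the rounded time
    \<open>d n \<omega>\<close>.\<close>
  define f where "f n j \<omega> = (if 0 \<le> real_of_int j / real (Suc n) \<and> real_of_int j / real (Suc n) \<le> t
      then indicator {\<omega> \<in> space M. real_of_int j / real (Suc n) \<le> \<tau> \<omega>} \<omega> *\<^sub>R X (real_of_int j / real (Suc n)) \<omega> else 0)"
    for n :: nat and j :: int and \<omega>
  have f: "f n j \<in> borel_measurable (F t)" for n j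
  proof (cases "0 \<le> real_of_int j / real (Suc n) \<and> real_of_int j / real (Suc n) \<le> t")
    case True
    let ?s = "real_of_int j / real (Suc n)"
    have "X ?s \<in> borel_measurable (restrict_space (F ?s) {\<omega> \<in> space M. ?s \<le> \<tau> \<omega>})"
      using True by (intro X_adapted) auto
    moreover have "{\<omega> \<in> space M. ?s \<le> \<tau> \<omega>} \<inter> space (F ?s) \<in> sets (F ?s)"
      using \<tau>_le_sets[of ?s ?s] by (simp add: Int_absorb2)
    ultimately have "(\<lambda>\<omega>. indicator {\<omega> \<in> space M. ?s \<le> \<tau> \<omega>} \<omega> *\<^sub>R X ?s \<omega>) \<in> borel_measurable (F ?s)"
      by (subst (asm) borel_measurable_restrict_space_iff) auto
    from measurable_F_mono[OF this, of t] True show ?thesis by (simp add: f_def[abs_def])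
  next
    case False
    then have "f n j = (\<lambda>_. 0)" by (auto simp: f_def fun_eq_iff)
    then show ?thesis by simp
  qed
  have "(\<lambda>\<omega>. f n \<lfloor>real (Suc n) * min t (\<tau> \<omega>)\<rfloor> \<omega>) \<in> borel_measurable (F t)" for n
    by (rule measurable_compose_countable[OF f]) (use min_\<tau>_measurable[of t] in measurable)
  then show ?thesis
  proof (rule borel_measurable_LIMSEQ_metric)
    fix \<omega> assume "\<omega> \<in> space (F t)"
    then have \<omega>: "\<omega> \<in> space M" by simp
    have le: "0 \<le> d n \<omega>" "d n \<omega> \<le> min t (\<tau> \<omega>)" for n
    proof -
      show "0 \<le> d n \<omega>" using t \<tau>(2)[OF \<omega>] unfolding d_def by (intro divide_nonneg_nonneg) auto
      have "real_of_int \<lfloor>real (Suc n) * min t (\<tau> \<omega>)\<rfloor> \<le> real (Suc n) * min t (\<tau> \<omega>)" by linarith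
      then show "d n \<omega> \<le> min t (\<tau> \<omega>)" unfolding d_def
        by (subst pos_divide_le_eq) (auto simp only: of_nat_0_less_iff zero_less_Suc mult.commute)
    qed
    have eq: "f n \<lfloor>real (Suc n) * min t (\<tau> \<omega>)\<rfloor> \<omega> = X (d n \<omega>) \<omega>" for n
      using le[of n] \<omega> unfolding f_def d_def[symmetric] by simp
    have "(\<lambda>n. d n \<omega>) \<longlonglongrightarrow> min t (\<tau> \<omega>)" unfolding d_def by (rule grid_floor_tendsto)
    then have "(\<lambda>n. X (d n \<omega>) \<omega>) \<longlonglongrightarrow> X (min t (\<tau> \<omega>)) \<omega>"
      using le t \<tau>(2)[OF \<omega>] by (intro continuous_on_tendsto_compose[OF X_cont[OF \<omega>]]) auto
    moreover have "X (min t (\<tau> \<omega>)) \<omega> = Y t \<omega>" using t \<tau>(2)[OF \<omega>] by (simp add: Y_def)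
    ultimately show "(\<lambda>n. f n \<lfloor>real (Suc n) * min t (\<tau> \<omega>)\<rfloor> \<omega>) \<longlonglongrightarrow> Y t \<omega>" unfolding eq by simp
  qed
qed

text \<open>Joint measurability from continuity in time: round the time down to a grid, where only
  countably many sections occur, and pass to the limit.\<close>

lemma Y_measurable_joint: "(\<lambda>x. Y (snd x) (fst x)) \<in> borel_measurable (M \<Otimes>\<^sub>M lborel)"
proof -
  have Ym: "Y s \<in> borel_measurable M" for s
  proof (cases "0 \<le> s")
    case True
    then show ?thesis using Y_measurable measurable_F_M by blast
  next
    case False
    have "Y s \<omega> = x0" if "\<omega> \<in> space M" for \<omega>
      using False X_0[OF that] by (simp add: Y_def)
    then show ?thesis by (subst measurable_cong[where g="\<lambda>_. x0"]) auto
  qed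
  have f: "(\<lambda>x. Y (real_of_int j / real (Suc n)) (fst x)) \<in> borel_measurable (M \<Otimes>\<^sub>M lborel)" for n j
    by (rule measurable_compose[OF measurable_fst Ym])
  have g: "(\<lambda>x. \<lfloor>real (Suc n) * snd x\<rfloor>) \<in> measurable (M \<Otimes>\<^sub>M lborel) (count_space UNIV)" for n
  proof -
    have "(\<lambda>u::real. \<lfloor>real (Suc n) * u\<rfloor>) \<in> measurable lborel (count_space UNIV)" by measurable
    from measurable_compose[OF measurable_snd this] show ?thesis .
  qed
  have "(\<lambda>x. Y (real_of_int \<lfloor>real (Suc n) * snd x\<rfloor> / real (Suc n)) (fst x)) \<in> borel_measurable (M \<Otimes>\<^sub>M lborel)" for n
    by (rule measurable_compose_countable[where f="\<lambda>j x. Y (real_of_int j / real (Suc n)) (fst x)", OF f g])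
  then show ?thesis
  proof (rule borel_measurable_LIMSEQ_metric)
    fix x :: "'a \<times> real" assume "x \<in> space (M \<Otimes>\<^sub>M lborel)"
    then have "fst x \<in> space M" by (auto simp: space_pair_measure)
    then show "(\<lambda>n. Y (real_of_int \<lfloor>real (Suc n) * snd x\<rfloor> / real (Suc n)) (fst x)) \<longlonglongrightarrow> Y (snd x) (fst x)"
      by (intro continuous_on_tendsto_compose[OF Y_cont[of _ UNIV]] grid_floor_tendsto) auto
  qed
qed

text \<open>Says that \<open>t\<close> is at most \<open>\<tau>\<close> and before the exit from
  \<open>D\<close>, without introducing an exit time.\<close>

definition \<Gamma> :: "real \<Rightarrow> 'a \<Rightarrow> bool" where
  "\<Gamma> t \<omega> \<longleftrightarrow> t \<le> \<tau> \<omega> \<and> (\<forall>u\<in>{0..t}. Y u \<omega> \<in> D)"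

lemma \<Gamma>_antimono: "\<Gamma> t \<omega> \<Longrightarrow> s \<le> t \<Longrightarrow> \<Gamma> s \<omega>"
  by (auto simp: \<Gamma>_def)

lemma \<Gamma>_0: "\<omega> \<in> space M \<Longrightarrow> \<Gamma> 0 \<omega>"
  using \<tau>(2) Y_0 D(3) by (auto simp: \<Gamma>_def)

text \<open>On a compact interval a path inside the open set \<open>D\<close> keeps a positive
  distance from the complement. So the condition on all times becomes countable: some
  \<open>1 / Suc n\<close> is a lower bound of the distance on a countable dense set of
  times.\<close>

lemma \<Gamma>_sets:
  assumes t: "0 \<le> t" shows "{\<omega> \<in> space M. \<Gamma> t \<omega>} \<in> sets (F t)"
proof -
  \<comment> \<open>The point \<open>0\<close> makes \<open>Q\<close> nonempty and covers the
    degenerate case \<open>t = 0\<close>.\<close>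
  define Q where "Q = insert 0 ({0<..<t} \<inter> \<rat>)"
  have Q: "countable Q" "Q \<subseteq> {0..t}" using t countable_rat by (auto simp: Q_def)
  have clQ: "{0..t} \<subseteq> closure Q"
  proof (cases "t = 0")
    case False
    then have "{0..t} = closure {0<..<t}" using t by simp
    also have "{0<..<t} \<subseteq> closure ({0<..<t} \<inter> \<rat>)"
      using open_Int_closure_subset[of "{0<..<t}" \<rat>] by (simp add: Rats_closure_real)
    then have "closure {0<..<t} \<subseteq> closure ({0<..<t} \<inter> \<rat>)"
      by (rule closure_minimal) simp
    also have "\<dots> \<subseteq> closure Q" by (rule closure_mono) (auto simp: Q_def)
    finally show ?thesis .
  qed (auto simp: Q_def intro: closure_subset[THEN subsetD])
  \<comment> \<open>\<open>infdist\<close> to the empty set is \<open>0\<close> by convention, so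
    the description of \<open>D\<close> by a positive distance relies on a nonempty complement;
    boundedness of \<open>D\<close> provides it.\<close>
  have ne: "- D \<noteq> {}" using D(2) not_bounded_UNIV by (metis Compl_UNIV_eq double_complement)
  have cl: "closed (- D)" by (rule closed_Compl[OF D(1)])
  have inD: "y \<in> D \<longleftrightarrow> 0 < infdist y (- D)" for y
    using in_closed_iff_infdist_zero[OF cl ne, of y] infdist_nonneg[of y "- D"] by force
  have eq: "(\<forall>u\<in>{0..t}. Y u \<omega> \<in> D) \<longleftrightarrow> (\<exists>n::nat. \<forall>q\<in>Q. 1 / real (Suc n) \<le> infdist (Y q \<omega>) (- D))"
    if \<omega>: "\<omega> \<in> space M" for \<omega>
  proof
    have cont: "continuous_on A (\<lambda>u. infdist (Y u \<omega>) (- D))" for A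
      by (intro continuous_intros Y_cont \<omega>)
    {
      assume a: "\<forall>u\<in>{0..t}. Y u \<omega> \<in> D"
      obtain u where u: "u \<in> {0..t}" "\<forall>s\<in>{0..t}. infdist (Y u \<omega>) (- D) \<le> infdist (Y s \<omega>) (- D)"
        using continuous_attains_inf[of "{0..t}" "\<lambda>u. infdist (Y u \<omega>) (- D)"] cont t by auto
      have "0 < infdist (Y u \<omega>) (- D)" using a u(1) inD by auto
      then obtain n where "1 / real (Suc n) < infdist (Y u \<omega>) (- D)" using nat_approx_posE by blast
      then show "\<exists>n::nat. \<forall>q\<in>Q. 1 / real (Suc n) \<le> infdist (Y q \<omega>) (- D)"
        using u(2) Q(2) by (intro exI[of _ n]) force
    }
    {
      assume "\<exists>n::nat. \<forall>q\<in>Q. 1 / real (Suc n) \<le> infdist (Y q \<omega>) (- D)"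
      then obtain n :: nat where n: "\<And>q. q \<in> Q \<Longrightarrow> 1 / real (Suc n) \<le> infdist (Y q \<omega>) (- D)" by blast
      have "1 / real (Suc n) \<le> infdist (Y u \<omega>) (- D)" if "u \<in> {0..t}" for u
        by (rule continuous_ge_on_closure[OF cont subsetD[OF clQ that] n])
      moreover have "0 < 1 / real (Suc n)" by simp
      ultimately show "\<forall>u\<in>{0..t}. Y u \<omega> \<in> D" unfolding inD by (meson less_le_trans)
    }
  qed
  have [measurable]: "(\<lambda>\<omega>. infdist (Y q \<omega>) (- D)) \<in> borel_measurable (F t)" if "q \<in> Q" for q
  proof -
    have "Y q \<in> borel_measurable (F t)"
      using that Q(2) measurable_F_mono[OF Y_measurable, of q t] by auto
    moreover have "(\<lambda>y. infdist y (- D)) \<in> borel_measurable borel"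
      by (intro borel_measurable_continuous_onI continuous_intros)
    ultimately show ?thesis by (rule measurable_compose)
  qed
  have "{\<omega> \<in> space M. \<Gamma> t \<omega>} = {\<omega> \<in> space M. t \<le> \<tau> \<omega>} \<inter>
      (\<Union>n. \<Inter>q\<in>Q. {\<omega> \<in> space (F t). 1 / real (Suc n) \<le> infdist (Y q \<omega>) (- D)})"
    unfolding \<Gamma>_def using eq by (auto simp: Q_def)
  also have "\<dots> \<in> sets (F t)"
  proof -
    have "(\<Inter>q\<in>Q. {\<omega> \<in> space (F t). 1 / real (Suc n) \<le> infdist (Y q \<omega>) (- D)}) \<in> sets (F t)" for n
    proof (rule sets.countable_INT'[OF Q(1)])
      show "Q \<noteq> {}" by (simp add: Q_def)
      show "(\<lambda>q. {\<omega> \<in> space (F t). 1 / real (Suc n) \<le> infdist (Y q \<omega>) (- D)}) ` Q \<subseteq> sets (F t)"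
      proof safe
        fix q assume "q \<in> Q"
        then show "{\<omega> \<in> space (F t). 1 / real (Suc n) \<le> infdist (Y q \<omega>) (- D)} \<in> sets (F t)" by measurable
      qed
    qed
    then show ?thesis by (intro sets.Int \<tau>_le_sets order_refl sets.countable_UN) auto
  qed
  finally show ?thesis .
qed

definition A :: "real \<Rightarrow> 'a \<Rightarrow> real ^ 'n" where
  "A t \<omega> = (\<integral>u. indicator {0<..t} u *\<^sub>R truncate_norm L (b (Y u \<omega>)) \<partial>lborel)"

text \<open>The process whose increments are estimated: it agrees with the stopped path while
  \<open>\<Gamma>\<close> holds, and afterwards its drift increments are still at most
  \<open>L\<close> times the step. So the step that crosses the exit is treated like any
  other.\<close>

definition Z :: "real \<Rightarrow> 'a \<Rightarrow> real ^ 'n" where "Z t \<omega> = x0 + A t \<omega> + I t \<omega>"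

lemma drift_cont: "\<omega> \<in> space M \<Longrightarrow> continuous_on B (\<lambda>u. truncate_norm L (b (Y u \<omega>)))"
  using L by (intro continuous_intros continuous_on_compose2[OF b_cont Y_cont]) auto

lemma A_diff:
  assumes \<omega>: "\<omega> \<in> space M" and st: "0 \<le> s" "s \<le> t"
  shows "A t \<omega> - A s \<omega> = (\<integral>u. indicator {s<..t} u *\<^sub>R truncate_norm L (b (Y u \<omega>)) \<partial>lborel)"
proof -
  have "A t \<omega> = (\<integral>u. indicator {0<..s} u *\<^sub>R truncate_norm L (b (Y u \<omega>)) + indicator {s<..t} u *\<^sub>R truncate_norm L (b (Y u \<omega>)) \<partial>lborel)"
    unfolding A_def using st by (intro Bochner_Integration.integral_cong refl) (auto simp: indicator_def)
  also have "\<dots> = A s \<omega> + (\<integral>u. indicator {s<..t} u *\<^sub>R truncate_norm L (b (Y u \<omega>)) \<partial>lborel)"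
    unfolding A_def by (intro Bochner_Integration.integral_add integrable_indicator_Ioc drift_cont \<omega>)
  finally show ?thesis by simp
qed

lemma norm_A_diff_le:
  assumes \<omega>: "\<omega> \<in> space M" and st: "0 \<le> s" "s \<le> t"
  shows "norm (A t \<omega> - A s \<omega>) \<le> L * (t - s)"
proof -
  let ?f = "\<lambda>u. indicator {s<..t} u *\<^sub>R truncate_norm L (b (Y u \<omega>))"
  have int: "integrable lborel ?f" by (intro integrable_indicator_Ioc drift_cont \<omega>)
  have "norm (A t \<omega> - A s \<omega>) \<le> (\<integral>u. norm (?f u) \<partial>lborel)"
    unfolding A_diff[OF \<omega> st] by (rule integral_norm_bound)
  also have "\<dots> \<le> (\<integral>u. indicator {s<..t} u * L \<partial>lborel)"
  proof (rule integral_mono[OF integrable_norm[OF int]])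
    show "integrable lborel (\<lambda>u. indicator {s<..t} u * L)"
      using integrable_indicator_Ioc[of "\<lambda>_. L" s t] by simp
  qed (use norm_truncate_norm_le[OF L(1)] L in \<open>auto simp: indicator_def\<close>)
  finally show ?thesis using st by (simp add: mult.commute)
qed

lemma A_measurable: "A t \<in> borel_measurable M"
proof -
  have bm: "(\<lambda>x. truncate_norm L (b x)) \<in> borel_measurable borel"
    using L by (intro borel_measurable_continuous_onI continuous_intros b_cont)
  have 1: "(\<lambda>x. truncate_norm L (b (Y (snd x) (fst x)))) \<in> borel_measurable (M \<Otimes>\<^sub>M lborel)"
    by (rule measurable_compose[OF Y_measurable_joint bm])
  have 2: "(\<lambda>x. indicator {0<..t} (snd x) :: real) \<in> borel_measurable (M \<Otimes>\<^sub>M lborel)"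
    by (rule measurable_compose[OF measurable_snd]) simp
  have "(\<lambda>(\<omega>, u). indicator {0<..t} u *\<^sub>R truncate_norm L (b (Y u \<omega>))) \<in> borel_measurable (M \<Otimes>\<^sub>M lborel)"
    using borel_measurable_scaleR[OF 2 1] by (simp add: case_prod_beta)
  then show ?thesis unfolding A_def[abs_def] by (rule lborel.borel_measurable_lebesgue_integral)
qed

text \<open>Inside \<open>D\<close> the truncation is inactive, so \<open>A\<close> equals the drift
  in the equation that defines \<open>I\<close>.\<close>

lemma Z_eq_Y:
  assumes \<omega>: "\<omega> \<in> space M" and t: "0 \<le> t" and \<Gamma>: "\<Gamma> t \<omega>"
  shows "Z t \<omega> = Y t \<omega>"
proof -
  have tt: "t \<le> \<tau> \<omega>" and YD: "\<And>u. u \<in> {0..t} \<Longrightarrow> Y u \<omega> \<in> D" using \<Gamma> by (auto simp: \<Gamma>_def)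
  let ?f = "\<lambda>u. truncate_norm L (b (Y u \<omega>))"
  have "integral {0..t} (\<lambda>s. b (X s \<omega>)) = integral {0..t} ?f"
  proof (rule integral_cong)
    fix u assume u: "u \<in> {0..t}"
    then show "b (X u \<omega>) = ?f u" using Y_eq_X[of u \<omega>] tt YD[OF u] L by (simp add: truncate_norm_eq)
  qed
  also have "\<dots> = (\<integral>u. indicator {0..t} u *\<^sub>R ?f u \<partial>lborel)"
    using set_borel_integral_eq_integral(2)[OF borel_integrable_atLeastAtMost'[OF drift_cont[OF \<omega>, of "{0..t}"]]]
    by (simp add: set_lebesgue_integral_def)
  also have "\<dots> = A t \<omega>"
    unfolding A_def
  proof (rule integral_cong_AE)
    have 0: "?f \<in> borel_measurable borel" by (intro borel_measurable_continuous_onI drift_cont \<omega>)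
    then show "(\<lambda>u. indicator {0..t} u *\<^sub>R ?f u) \<in> borel_measurable lborel"
      "(\<lambda>u. indicator {0<..t} u *\<^sub>R ?f u) \<in> borel_measurable lborel" by auto
    have "AE u in lborel. u \<noteq> (0::real)" by (rule AE_lborel_singleton)
    then show "AE u in lborel. indicator {0..t} u *\<^sub>R ?f u = indicator {0<..t} u *\<^sub>R ?f u"
      by eventually_elim (auto simp: indicator_def)
  qed
  finally show ?thesis using t tt Y_eq_X[of t \<omega>] by (simp add: Z_def I_def min_absorb1)
qed

text \<open>\<open>A\<close> is Lipschitz, and \<open>I\<close> inherits continuity from the stopped
  path and from the indefinite integral of its drift.\<close>

lemma Z_cont:
  assumes \<omega>: "\<omega> \<in> space M" shows "continuous_on {0..T} (\<lambda>t. Z t \<omega>)"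
proof -
  have "L-lipschitz_on {0..T} (\<lambda>t. A t \<omega>)"
  proof (rule lipschitz_onI)
    fix s t assume "s \<in> {0..T}" "t \<in> {0..T}"
    then show "dist (A s \<omega>) (A t \<omega>) \<le> L * dist s t"
      using norm_A_diff_le[OF \<omega>, of s t] norm_A_diff_le[OF \<omega>, of t s]
      by (cases "s \<le> t") (auto simp: dist_norm norm_minus_commute)
  qed (use L in auto)
  then have A: "continuous_on {0..T} (\<lambda>t. A t \<omega>)" by (rule lipschitz_on_continuous_on)
  have "(\<lambda>s. b (X s \<omega>)) integrable_on {0..\<tau> \<omega>}"
    by (intro integrable_continuous_real continuous_on_compose2[OF b_cont X_cont[OF \<omega>]]) auto
  then have "continuous_on {0..\<tau> \<omega>} (\<lambda>r. integral {0..r} (\<lambda>s. b (X s \<omega>)))"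
    by (rule indefinite_integral_continuous_1)
  then have B: "continuous_on {0..T} (\<lambda>t. integral {0..min t (\<tau> \<omega>)} (\<lambda>s. b (X s \<omega>)))"
    by (rule continuous_on_compose2[where f="\<lambda>t. min t (\<tau> \<omega>)"]) (use \<tau>(2)[OF \<omega>] in \<open>auto intro!: continuous_intros\<close>)
  have C: "continuous_on {0..T} (\<lambda>t. X (min t (\<tau> \<omega>)) \<omega>)"
    by (rule continuous_on_compose2[OF X_cont[OF \<omega>]]) (use \<tau>(2)[OF \<omega>] in \<open>auto intro!: continuous_intros\<close>)
  show ?thesis unfolding Z_def I_def by (intro continuous_intros A B C)
qed

lemma ito_process_H: "ito_process M W H I T"
proof unfold_locales
  show "0 \<le> T" using T by simp
  fix t :: real assume "0 \<le> t"
  from X_ito[OF this] show "has_ito_integral M F W H t (I t)"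
    unfolding H_def[abs_def] I_def[abs_def] .
qed

lemma I_measurable: "0 \<le> t \<Longrightarrow> I t \<in> borel_measurable M"
  using X_ito[of t] unfolding has_ito_integral_def I_def[abs_def] by blast

lemma Z_measurable: "0 \<le> t \<Longrightarrow> Z t \<in> borel_measurable M"
  unfolding Z_def[abs_def] by (intro borel_measurable_add borel_measurable_const A_measurable I_measurable)

definition gate :: "real \<Rightarrow> 'a \<Rightarrow> real" where "gate t \<omega> = of_bool (\<Gamma> t \<omega>)"

lemma gate_measurable: "0 \<le> t \<Longrightarrow> gate t \<in> borel_measurable (F t)"
proof -
  assume t: "0 \<le> t"
  have "gate t \<omega> = indicator {\<omega> \<in> space M. \<Gamma> t \<omega>} \<omega>" if "\<omega> \<in> space M" for \<omega>
    using that by (auto simp: gate_def)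
  then have "gate t \<in> borel_measurable (F t) \<longleftrightarrow> (\<lambda>\<omega>. indicator {\<omega> \<in> space M. \<Gamma> t \<omega>} \<omega> :: real) \<in> borel_measurable (F t)"
    by (intro measurable_cong) auto
  then show ?thesis using \<Gamma>_sets[OF t] by simp
qed

lemma slice_cont:
  assumes "t \<in> {0..T}"
  shows "continuous_on UNIV (v t)" "continuous_on UNIV (vt t)" "continuous_on UNIV (vx t)" "continuous_on UNIV (vxx t)"
proof -
  have *: "continuous_on ({0..T} \<times> UNIV) (\<lambda>(t, x). v t x)" "continuous_on ({0..T} \<times> UNIV) (\<lambda>(t, x). vt t x)"
    "continuous_on ({0..T} \<times> UNIV) (\<lambda>(t, x). vx t x)" "continuous_on ({0..T} \<times> UNIV) (\<lambda>(t, x). vxx t x)"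
    using C12 unfolding C12_on_def by blast+
  show "continuous_on UNIV (v t)" "continuous_on UNIV (vt t)" "continuous_on UNIV (vx t)" "continuous_on UNIV (vxx t)"
    by (rule *[THEN continuous_on_prod_compose, OF continuous_on_const continuous_on_id assms, unfolded id_def])+
qed

lemma comp_Y_measurable:
  fixes f :: "real ^ 'n \<Rightarrow> 'z::topological_space"
  assumes "continuous_on UNIV f" "0 \<le> t" shows "(\<lambda>\<omega>. f (Y t \<omega>)) \<in> borel_measurable (F t)"
  by (rule measurable_compose[OF Y_measurable[OF assms(2)]]) (intro borel_measurable_continuous_onI assms(1))

text \<open>An open gate puts \<open>Y t \<omega>\<close> into \<open>D\<close>, where the
  derivatives are bounded by \<open>G\<close>; a closed one gives zero. These are the bounded
  weights, known at the start of a step, that the isometry requires.\<close>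

lemma gated_bounds:
  assumes "t \<in> {0..T}"
  shows "(\<lambda>\<omega>. gate t \<omega> *\<^sub>R vx t (Y t \<omega>)) \<in> borel_measurable (F t)" (is ?g1) "norm (gate t \<omega> *\<^sub>R vx t (Y t \<omega>)) \<le> G" (is ?g2)
    "(\<lambda>\<omega>. gate t \<omega> *\<^sub>R vxx t (Y t \<omega>)) \<in> borel_measurable (F t)" "norm (gate t \<omega> *\<^sub>R vxx t (Y t \<omega>)) \<le> G"
    "(\<lambda>\<omega>. gate t \<omega> * vt t (Y t \<omega>)) \<in> borel_measurable (F t)" "\<bar>gate t \<omega> * vt t (Y t \<omega>)\<bar> \<le> G"
proof -
  have t: "0 \<le> t" using assms by simp
  show ?g1 "(\<lambda>\<omega>. gate t \<omega> *\<^sub>R vxx t (Y t \<omega>)) \<in> borel_measurable (F t)"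
     "(\<lambda>\<omega>. gate t \<omega> * vt t (Y t \<omega>)) \<in> borel_measurable (F t)"
    by (intro borel_measurable_scaleR borel_measurable_times gate_measurable comp_Y_measurable slice_cont t assms)+
  have G0: "0 \<le> G" using G(1)[OF assms D(3)] by linarith
  have YD: "\<Gamma> t \<omega> \<Longrightarrow> Y t \<omega> \<in> D" using t by (auto simp: \<Gamma>_def)
  show ?g2 "norm (gate t \<omega> *\<^sub>R vxx t (Y t \<omega>)) \<le> G" "\<bar>gate t \<omega> * vt t (Y t \<omega>)\<bar> \<le> G"
    using G[OF assms, of "Y t \<omega>"] YD G0 by (auto simp: gate_def)
qed

end

section \<open>The time grid\<close>

text \<open>The gates close once and for all, so the gated sum telescopes up to the last step whose
  gate is open at its start, and ends one index later.\<close>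

lemma telescope_gated:
  fixes \<alpha> :: "nat \<Rightarrow> real" and g :: "nat \<Rightarrow> bool"
  assumes g: "g 0" "\<And>i. g (Suc i) \<Longrightarrow> g i" and K: "0 < K"
  shows "\<exists>j<K. g j \<and> (g (K - 1) \<longrightarrow> j = K - 1) \<and> (\<Sum>i<K. of_bool (g i) * (\<alpha> (Suc i) - \<alpha> i)) = \<alpha> (Suc j) - \<alpha> 0"
  using K
proof (induction K)
  case (Suc K)
  show ?case
  proof (cases "K = 0")
    case True
    then show ?thesis using g(1) by auto
  next
    case False
    with Suc obtain j where j: "j < K" "g j" "g (K - 1) \<longrightarrow> j = K - 1"
      "(\<Sum>i<K. of_bool (g i) * (\<alpha> (Suc i) - \<alpha> i)) = \<alpha> (Suc j) - \<alpha> 0" by auto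
    show ?thesis
    proof (cases "g K")
      case True
      then have "g (K - 1)" using g(2)[of "K - 1"] False by simp
      with j False have "Suc j = K" by simp
      then show ?thesis using True j by (intro exI[of _ K]) auto
    next
      case gK: False
      then show ?thesis using j by (intro exI[of _ j]) auto
    qed
  qed
qed simp

lemma norm_integral_le:
  fixes f :: "'x \<Rightarrow> 'b::{banach, second_countable_topology}"
  assumes "integrable N g" "\<And>x. norm (f x) \<le> g x"
  shows "norm (\<integral>x. f x \<partial>N) \<le> (\<integral>x. g x \<partial>N)"
proof (cases "integrable N f")
  case True
  have "norm (\<integral>x. f x \<partial>N) \<le> (\<integral>x. norm (f x) \<partial>N)" by (rule integral_norm_bound)
  also have "\<dots> \<le> (\<integral>x. g x \<partial>N)" using True assms by (intro integral_mono) auto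
  finally show ?thesis .
next
  \<comment> \<open>The Bochner integral of a non-integrable function is \<open>0\<close> by
    convention.\<close>
  case False
  have "0 \<le> (\<integral>x. g x \<partial>N)" using assms(2) by (intro integral_nonneg_AE AE_I2) (meson norm_ge_zero order_trans)
  with False show ?thesis by (simp add: not_integrable_integral_eq)
qed

context stopped_diffusion
begin

definition grid :: "nat \<Rightarrow> nat \<Rightarrow> real" where "grid K i = real i * (T / real K)"

lemma grid:
  assumes "i < K"
  shows "0 \<le> grid K i" "grid K i \<le> grid K (Suc i)" "grid K (Suc i) \<le> T" "grid K (Suc i) - grid K i = T / real K"
    "grid K i \<in> {0..T}" "grid K (Suc i) \<in> {0..T}"
proof -
  show 1: "0 \<le> grid K i" and 2: "grid K i \<le> grid K (Suc i)"
    unfolding grid_def using T by (intro mult_nonneg_nonneg mult_right_mono; simp)+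
  have "real (Suc i) * (T / real K) \<le> real K * (T / real K)" using assms T by (intro mult_right_mono) auto
  then show 3: "grid K (Suc i) \<le> T" using assms by (simp add: grid_def)
  show "grid K (Suc i) - grid K i = T / real K"
    by (simp add: grid_def distrib_right add_divide_distrib)
  show "grid K i \<in> {0..T}" "grid K (Suc i) \<in> {0..T}" using 1 2 3 by auto
qed

lemma grid_0: "grid K 0 = 0" and grid_K: "0 < K \<Longrightarrow> grid K K = T"
  by (auto simp: grid_def)

definition w :: "real \<Rightarrow> real ^ 'n \<Rightarrow> real" where "w t x = max (- c) (min c (v t x))"

lemma w_eq_v: "t \<in> {0..T} \<Longrightarrow> x \<in> D \<Longrightarrow> w t x = v t x"
  using c(2)[of t x] R by (force simp: w_def)

lemma abs_w_le: "\<bar>w t x\<bar> \<le> c"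
  using c(1) by (auto simp: w_def)

text \<open>The clamped value at the first grid point where the gate is closed, or at
  \<open>T\<close>. Written as a gated sum it can be averaged step by step, each gate being known at
  the start of its step.\<close>

definition stopped_value :: "nat \<Rightarrow> 'a \<Rightarrow> real" where
  "stopped_value K \<omega> = w 0 x0 + (\<Sum>i<K. gate (grid K i) \<omega> *
     (w (grid K (Suc i)) (Z (grid K (Suc i)) \<omega>) - w (grid K i) (Z (grid K i) \<omega>)))"

lemma Z_0: "\<omega> \<in> space M \<Longrightarrow> Z 0 \<omega> = x0"
  using Z_eq_Y[OF _ order_refl \<Gamma>_0] Y_0 by simp

lemma stopped_value_eq:
  assumes \<omega>: "\<omega> \<in> space M" and K: "0 < K"
  shows "\<exists>j<K. \<Gamma> (grid K j) \<omega> \<and> (\<Gamma> T \<omega> \<longrightarrow> Suc j = K) \<and>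
    stopped_value K \<omega> = w (grid K (Suc j)) (Z (grid K (Suc j)) \<omega>)"
proof -
  have mono: "grid K i \<le> grid K j" if "i \<le> j" for i j
    unfolding grid_def using that T by (intro mult_right_mono) auto
  have g0: "\<Gamma> (grid K 0) \<omega>" using \<Gamma>_0[OF \<omega>] by (simp add: grid_0)
  have gS: "\<Gamma> (grid K i) \<omega>" if "\<Gamma> (grid K (Suc i)) \<omega>" for i
    using \<Gamma>_antimono[OF that] mono[of i "Suc i"] by simp
  obtain j where j: "j < K" "\<Gamma> (grid K j) \<omega>" "\<Gamma> (grid K (K - 1)) \<omega> \<longrightarrow> j = K - 1"
    "(\<Sum>i<K. of_bool (\<Gamma> (grid K i) \<omega>) * (w (grid K (Suc i)) (Z (grid K (Suc i)) \<omega>) - w (grid K i) (Z (grid K i) \<omega>)))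
      = w (grid K (Suc j)) (Z (grid K (Suc j)) \<omega>) - w (grid K 0) (Z (grid K 0) \<omega>)"
    using telescope_gated[of "\<lambda>i. \<Gamma> (grid K i) \<omega>" K "\<lambda>i. w (grid K i) (Z (grid K i) \<omega>)", OF g0 gS K] by blast
  have "\<Gamma> T \<omega> \<longrightarrow> Suc j = K"
    using j(3) K \<Gamma>_antimono[of T \<omega> "grid K (K - 1)"] mono[of "K - 1" K] grid_K[OF K] by auto
  then show ?thesis
    using j(1,2,4) Z_0[OF \<omega>] by (intro exI[of _ j]) (auto simp: stopped_value_def gate_def grid_0)
qed

lemma w_Z_cont:
  assumes \<omega>: "\<omega> \<in> space M" shows "continuous_on {0..T} (\<lambda>t. w t (Z t \<omega>))"
proof -
  have "continuous_on ({0..T} \<times> UNIV) (\<lambda>(t, x). v t x)" using C12 unfolding C12_on_def by blast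
  from continuous_on_prod_compose[OF this continuous_on_id Z_cont[OF \<omega>]]
  have "continuous_on {0..T} (\<lambda>t. v t (Z t \<omega>))" by simp
  then show ?thesis unfolding w_def by (intro continuous_intros)
qed

text \<open>At the last open grid point the path is in \<open>D\<close> and the value is
  nonnegative; uniform continuity of \<open>w t (Z t \<omega>)\<close> in time carries this over to
  the next grid point, up to an error that vanishes with the mesh.\<close>

lemma stopped_value_lower:
  assumes \<omega>: "\<omega> \<in> space M"
  shows "(\<lambda>K. max 0 (- stopped_value K \<omega>)) \<longlonglongrightarrow> 0"
proof (rule LIMSEQ_I)
  fix e :: real assume e: "0 < e"
  have "uniformly_continuous_on {0..T} (\<lambda>t. w t (Z t \<omega>))"
    by (intro compact_uniformly_continuous w_Z_cont \<omega>) simp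
  then obtain d where d: "0 < d"
    "\<And>s t. s \<in> {0..T} \<Longrightarrow> t \<in> {0..T} \<Longrightarrow> dist t s < d \<Longrightarrow> dist (w t (Z t \<omega>)) (w s (Z s \<omega>)) < e"
    using e unfolding uniformly_continuous_on_def by blast
  have "(\<lambda>K. T / real K) \<longlonglongrightarrow> 0" by (rule lim_const_over_n)
  then have "\<forall>\<^sub>F K in sequentially. T / real K < d" using d(1) by (rule order_tendstoD)
  then have "\<forall>\<^sub>F K in sequentially. norm (max 0 (- stopped_value K \<omega>) - 0) < e"
    using eventually_gt_at_top[of 0]
  proof eventually_elim
    case (elim K)
    obtain j where j: "j < K" "\<Gamma> (grid K j) \<omega>" "stopped_value K \<omega> = w (grid K (Suc j)) (Z (grid K (Suc j)) \<omega>)"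
      using stopped_value_eq[OF \<omega> elim(2)] by blast
    note gr = grid[OF j(1)]
    have "w (grid K j) (Z (grid K j) \<omega>) = v (grid K j) (Y (grid K j) \<omega>)"
      using Z_eq_Y[OF \<omega> gr(1) j(2)] j(2) gr by (simp add: \<Gamma>_def w_eq_v)
    also have "\<dots> \<ge> 0" using j(2) gr by (intro v_nonneg) (auto simp: \<Gamma>_def)
    finally have "0 \<le> w (grid K j) (Z (grid K j) \<omega>)" .
    moreover have "dist (w (grid K (Suc j)) (Z (grid K (Suc j)) \<omega>)) (w (grid K j) (Z (grid K j) \<omega>)) < e"
      using gr elim(1) by (intro d(2)) (auto simp: dist_real_def)
    ultimately have "- e < stopped_value K \<omega>" unfolding j(3) dist_real_def by linarith
    then show ?case using e by (auto simp: max_def)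
  qed
  then show "\<exists>no. \<forall>n\<ge>no. norm (max 0 (- stopped_value n \<omega>) - 0) < e" by (simp add: eventually_sequentially)
qed

lemma abs_stopped_value_le: "\<omega> \<in> space M \<Longrightarrow> \<bar>stopped_value K \<omega>\<bar> \<le> c"
proof (cases "K = 0")
  case True
  then show ?thesis using abs_w_le by (simp add: stopped_value_def)
next
  case False
  assume "\<omega> \<in> space M"
  then show ?thesis using stopped_value_eq[of \<omega> K] False abs_w_le by force
qed

lemma stopped_value_measurable: "stopped_value K \<in> borel_measurable M"
proof -
  have wZ: "(\<lambda>\<omega>. w t (Z t \<omega>)) \<in> borel_measurable M" if "t \<in> {0..T}" for t
  proof (rule measurable_compose[OF Z_measurable])
    show "w t \<in> borel_measurable borel"
      unfolding w_def[abs_def]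
      by (intro borel_measurable_continuous_onI continuous_intros slice_cont that)
  qed (use that in auto)
  show ?thesis unfolding stopped_value_def[abs_def]
    by (intro borel_measurable_add borel_measurable_const borel_measurable_sum borel_measurable_times borel_measurable_diff
        wZ measurable_F_M[OF gate_measurable] grid) auto
qed

section \<open>Riemann sums of the generator\<close>

definition grid_quadratic :: "nat \<Rightarrow> nat \<Rightarrow> 'a \<Rightarrow> real" where
  "grid_quadratic K i \<omega> = (\<integral>u. cut (grid K i) (grid K (Suc i)) H (\<omega>, u) \<bullet>
     ((gate (grid K i) \<omega> *\<^sub>R vxx (grid K i) (Y (grid K i) \<omega>)) ** cut (grid K i) (grid K (Suc i)) H (\<omega>, u)) \<partial>lborel)"

text \<open>In each cell the derivatives of \<open>v\<close> are frozen at the left end, where the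
  gate is known, while the drift and diffusion coefficients run. This mixed form is what the
  expectations of the steps produce.\<close>

definition grid_generator :: "nat \<Rightarrow> 'a \<Rightarrow> real" where
  "grid_generator K \<omega> = (\<Sum>i<K. gate (grid K i) \<omega> * vt (grid K i) (Y (grid K i) \<omega>) * (T / real K) +
     (gate (grid K i) \<omega> *\<^sub>R vx (grid K i) (Y (grid K i) \<omega>)) \<bullet> (A (grid K (Suc i)) \<omega> - A (grid K i) \<omega>) +
     1/2 * grid_quadratic K i \<omega>)"

text \<open>In a cell through which the gate stays open, the integrand is uniformly close to the
  generator and hence almost nonpositive. At most one cell sees the gate close; there the integrand
  is merely bounded, which costs one mesh width.\<close>

lemma grid_generator_limsup:
  assumes \<omega>: "\<omega> \<in> space M"
  shows "(\<lambda>K. max 0 (grid_generator K \<omega>)) \<longlonglongrightarrow> 0"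
proof (rule LIMSEQ_I)
  fix e :: real assume e: "0 < e"
  interpret mm: bounded_bilinear "\<lambda>(A::real^'n^'n) (B::real^'k^'n). A ** B"
    by (rule bounded_bilinear_matrix_matrix)
  let ?y = "\<lambda>u. Y u \<omega>" and ?bt = "\<lambda>u. truncate_norm L (b (Y u \<omega>))"
  \<comment> \<open>\<open>r\<close> is the time at which the derivatives of \<open>v\<close> are
    frozen, \<open>u\<close> the running time of the coefficients; where the path is in
    \<open>D\<close>, the diagonal value \<open>\<Phi> u u\<close> is the generator.\<close>
  define \<alpha> where "\<alpha> r u = vt r (?y r) + vx r (?y r) \<bullet> ?bt u" for r u
  define \<gamma> where "\<gamma> r u = \<sigma> (?y u) \<bullet> (vxx r (?y r) ** \<sigma> (?y u))" for r u
  define \<Phi> where "\<Phi> r u = \<alpha> r u + 1/2 * \<gamma> r u" for r u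
  have vc: "continuous_on ({0..T} \<times> UNIV) (\<lambda>(t, x). vt t x)"
    "continuous_on ({0..T} \<times> UNIV) (\<lambda>(t, x). vx t x)" "continuous_on ({0..T} \<times> UNIV) (\<lambda>(t, x). vxx t x)"
    using C12 unfolding C12_on_def by blast+
  let ?B = "{0..T} \<times> {0..T}"
  have yc: "continuous_on B (\<lambda>p. ?y (f p))" if "continuous_on B f" for f :: "real \<times> real \<Rightarrow> real" and B
    by (rule continuous_on_compose2[OF Y_cont[OF \<omega>, of UNIV] that]) simp
  have fs: "continuous_on ?B fst" "continuous_on ?B snd" "\<And>p. p \<in> ?B \<Longrightarrow> fst p \<in> {0..T}"
    by (auto intro!: continuous_intros)
  have c1: "continuous_on ?B (\<lambda>p. \<alpha> (fst p) (snd p))"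
    unfolding \<alpha>_def
    by (intro continuous_intros continuous_on_prod_compose[OF vc(1)] continuous_on_prod_compose[OF vc(2)]
        yc fs continuous_on_compose2[OF drift_cont[OF \<omega>, of UNIV] fs(2)]) auto
  have c2: "continuous_on ?B (\<lambda>p. \<gamma> (fst p) (snd p))"
    unfolding \<gamma>_def
    by (intro continuous_intros mm.continuous_on continuous_on_prod_compose[OF vc(3)]
        continuous_on_compose2[OF \<sigma>_cont yc] yc fs) auto
  have c3: "continuous_on ?B (\<lambda>p. \<Phi> (fst p) (snd p))"
    unfolding \<Phi>_def by (intro continuous_intros c1 c2)
  have cB: "compact ?B" by (intro compact_Times) auto
  have "bounded ((\<lambda>p. \<bar>\<alpha> (fst p) (snd p)\<bar> + 1/2 * \<bar>\<gamma> (fst p) (snd p)\<bar>) ` ?B)"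
    by (intro compact_imp_bounded compact_continuous_image continuous_intros c1 c2 cB)
  \<comment> \<open>A bound with separate absolute values, because past \<open>\<tau>\<close> the
    \<open>\<gamma>\<close> part is switched off and only \<open>\<alpha>\<close> remains.\<close>
  then obtain C where C: "\<And>r u. r \<in> {0..T} \<Longrightarrow> u \<in> {0..T} \<Longrightarrow> \<bar>\<alpha> r u\<bar> + 1/2 * \<bar>\<gamma> r u\<bar> \<le> C"
    unfolding bounded_iff by force
  have C0: "0 \<le> C" using C[of 0 0] T by (smt (verit) atLeastAtMost_iff divide_nonneg_nonneg mult_nonneg_nonneg abs_ge_zero)
  \<comment> \<open>Integrated over the total time \<open>T\<close> it gives \<open>e / 2\<close>;
    the other half is for the closing cell.\<close>
  define e' where "e' = e / (2 * T)"
  have e': "0 < e'" using e T by (simp add: e'_def)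
  have "uniformly_continuous_on ?B (\<lambda>p. \<Phi> (fst p) (snd p))" by (rule compact_uniformly_continuous[OF c3 cB])
  then obtain d where d: "0 < d" 
    "\<And>p q. p \<in> ?B \<Longrightarrow> q \<in> ?B \<Longrightarrow> dist q p < d \<Longrightarrow> dist (\<Phi> (fst q) (snd q)) (\<Phi> (fst p) (snd p)) < e'"
    using e' unfolding uniformly_continuous_on_def by metis
  have gen\<Phi>: "\<Phi> u u \<le> 0" if u: "u \<in> {0..T}" and yD: "?y u \<in> D" for u
  proof -
    have "\<Phi> u u = generator b \<sigma> vt vx vxx u (?y u)"
      unfolding \<Phi>_def \<alpha>_def \<gamma>_def generator_def trace_conjugate_eq_inner
      using L(2)[OF yD] L(1) by (simp add: truncate_norm_eq)
    then show ?thesis using gen[OF u yD] by simp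
  qed
  have ev: "\<forall>\<^sub>F K in sequentially. T / real K < d" "\<forall>\<^sub>F K in sequentially. C * T / real K < e / 2"
    by (rule order_tendstoD[OF lim_const_over_n]; use d e in simp)+
  have "\<forall>\<^sub>F K in sequentially. norm (max 0 (grid_generator K \<omega>) - 0) < e"
    using ev eventually_gt_at_top[of 0]
  proof eventually_elim
    case (elim K)
    define h where "h = T / real K"
    have h: "0 < h" using elim T by (simp add: h_def)
    \<comment> \<open>The gate difference is \<open>1\<close> exactly in the cell where the gate
      closes, and it telescopes to at most \<open>1\<close> over the grid.\<close>
    have step: "gate (grid K i) \<omega> * vt (grid K i) (?y (grid K i)) * (T / real K) +
       (gate (grid K i) \<omega> *\<^sub>R vx (grid K i) (?y (grid K i))) \<bullet> (A (grid K (Suc i)) \<omega> - A (grid K i) \<omega>) +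
       1/2 * grid_quadratic K i \<omega> \<le> e' * h + C * h * (gate (grid K i) \<omega> - gate (grid K (Suc i)) \<omega>)"
      if i: "i < K" for i
    proof -
      let ?s = "grid K i" and ?t = "grid K (Suc i)"
      note gr = grid[OF i]
      show ?thesis
      proof (cases "\<Gamma> ?s \<omega>")
        case False
        then have "\<not> \<Gamma> ?t \<omega>" using \<Gamma>_antimono gr by blast
        with False show ?thesis using e' h by (simp add: gate_def grid_quadratic_def)
      next
        case True
        have i1: "integrable lborel (\<lambda>u. indicator {?s<..?t} u * \<alpha> ?s u)"
          using integrable_indicator_Ioc[of "\<lambda>u. \<alpha> ?s u" ?s ?t] drift_cont[OF \<omega>, of UNIV]
          unfolding \<alpha>_def by (simp add: continuous_intros)
        have \<gamma>c: "continuous_on UNIV (\<lambda>u. \<gamma> ?s u)"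
          unfolding \<gamma>_def by (intro continuous_intros mm.continuous_on continuous_on_compose2[OF \<sigma>_cont Y_cont[OF \<omega>]]) auto
        have i2: "integrable lborel (\<lambda>u. indicator {?s<..min ?t (\<tau> \<omega>)} u * \<gamma> ?s u)"
          using integrable_indicator_Ioc[OF \<gamma>c] by simp
        have 1: "vt ?s (?y ?s) * (T / real K) + vx ?s (?y ?s) \<bullet> (A ?t \<omega> - A ?s \<omega>) = (\<integral>u. indicator {?s<..?t} u * \<alpha> ?s u \<partial>lborel)"
        proof -
          have ib: "integrable lborel (\<lambda>u. indicator {?s<..?t} u *\<^sub>R ?bt u)"
            by (intro integrable_indicator_Ioc drift_cont \<omega>)
          have "(\<integral>u. indicator {?s<..?t} u * \<alpha> ?s u \<partial>lborel) =
            (\<integral>u. indicator {?s<..?t} u * vt ?s (?y ?s) + vx ?s (?y ?s) \<bullet> (indicator {?s<..?t} u *\<^sub>R ?bt u) \<partial>lborel)"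
            unfolding \<alpha>_def by (simp add: distrib_left)
          also have "\<dots> = (\<integral>u. indicator {?s<..?t} u * vt ?s (?y ?s) \<partial>lborel) + (\<integral>u. vx ?s (?y ?s) \<bullet> (indicator {?s<..?t} u *\<^sub>R ?bt u) \<partial>lborel)"
            using integrable_indicator_Ioc[of "\<lambda>_. vt ?s (?y ?s)" ?s ?t] ib
            by (intro Bochner_Integration.integral_add integrable_inner_right) auto
          also have "\<dots> = vt ?s (?y ?s) * (T / real K) + vx ?s (?y ?s) \<bullet> (A ?t \<omega> - A ?s \<omega>)"
            unfolding integral_indicator_Ioc_const[OF gr(2)] A_diff[OF \<omega> gr(1,2)] integral_inner_right[OF ib] gr(4)
            by (simp only: mult.commute)
          finally show ?thesis ..
        qed
        have 2: "grid_quadratic K i \<omega> = (\<integral>u. indicator {?s<..min ?t (\<tau> \<omega>)} u * \<gamma> ?s u \<partial>lborel)"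
          unfolding grid_quadratic_def
        proof (intro Bochner_Integration.integral_cong refl)
          fix u
          show "cut ?s ?t H (\<omega>, u) \<bullet> ((gate ?s \<omega> *\<^sub>R vxx ?s (?y ?s)) ** cut ?s ?t H (\<omega>, u)) =
            indicator {?s<..min ?t (\<tau> \<omega>)} u * \<gamma> ?s u"
            using True gr(1) H_eq[of u \<omega>]
            by (cases "u \<in> {?s<..?t}"; cases "u \<le> \<tau> \<omega>") (auto simp: cut_def gate_def \<gamma>_def mm.zero_right)
        qed
        \<comment> \<open>Reduces both cases below to a pointwise bound on the cell; the indicator
          of \<open>{..\<tau> \<omega>}\<close> is there because \<open>H\<close> vanishes after
          \<open>\<tau>\<close>.\<close>
        have le: "(\<integral>u. indicator {?s<..?t} u * \<alpha> ?s u \<partial>lborel) + 1/2 * (\<integral>u. indicator {?s<..min ?t (\<tau> \<omega>)} u * \<gamma> ?s u \<partial>lborel) \<le> h * B"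
          if B: "\<And>u. u \<in> {?s<..?t} \<Longrightarrow> \<alpha> ?s u + 1/2 * (indicator {..\<tau> \<omega>} u * \<gamma> ?s u) \<le> B" for B
        proof -
          have "(\<integral>u. indicator {?s<..?t} u * \<alpha> ?s u \<partial>lborel) + 1/2 * (\<integral>u. indicator {?s<..min ?t (\<tau> \<omega>)} u * \<gamma> ?s u \<partial>lborel) =
            (\<integral>u. indicator {?s<..?t} u * \<alpha> ?s u + 1/2 * (indicator {?s<..min ?t (\<tau> \<omega>)} u * \<gamma> ?s u) \<partial>lborel)"
            using i1 i2 by simp
          also have "\<dots> \<le> (\<integral>u. indicator {?s<..?t} u * B \<partial>lborel)"
          proof (rule integral_mono)
            show "integrable lborel (\<lambda>u. indicator {?s<..?t} u * \<alpha> ?s u + 1/2 * (indicator {?s<..min ?t (\<tau> \<omega>)} u * \<gamma> ?s u))"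
              using i1 i2 by simp
            show "integrable lborel (\<lambda>u. indicator {?s<..?t} u * B)"
              using integrable_indicator_Ioc[of "\<lambda>_. B" ?s ?t] by simp
            fix u show "indicator {?s<..?t} u * \<alpha> ?s u + 1/2 * (indicator {?s<..min ?t (\<tau> \<omega>)} u * \<gamma> ?s u) \<le> indicator {?s<..?t} u * B"
              using B[of u] by (auto simp: indicator_def split: if_splits)
          qed
          also have "\<dots> = h * B" unfolding integral_indicator_Ioc_const[OF gr(2)] gr(4) h_def ..
          finally show ?thesis .
        qed
        have lhs: "gate ?s \<omega> * vt ?s (?y ?s) * (T / real K) + (gate ?s \<omega> *\<^sub>R vx ?s (?y ?s)) \<bullet> (A ?t \<omega> - A ?s \<omega>) +
           1/2 * grid_quadratic K i \<omega> =
          (\<integral>u. indicator {?s<..?t} u * \<alpha> ?s u \<partial>lborel) + 1/2 * (\<integral>u. indicator {?s<..min ?t (\<tau> \<omega>)} u * \<gamma> ?s u \<partial>lborel)"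
          using True 1 2 by (simp add: gate_def)
        show ?thesis
        proof (cases "\<Gamma> ?t \<omega>")
          case True2: True
          have "\<alpha> ?s u + 1/2 * (indicator {..\<tau> \<omega>} u * \<gamma> ?s u) \<le> e'" if u: "u \<in> {?s<..?t}" for u
          proof -
            have u': "u \<in> {0..T}" "?y u \<in> D" "u \<le> \<tau> \<omega>" using u gr True2 by (auto simp: \<Gamma>_def)
            have "dist (?s, u) (u, u) < d"
              using u gr elim(1) by (simp add: dist_Pair_Pair dist_real_def)
            then have "dist (\<Phi> ?s u) (\<Phi> u u) < e'" using d(2)[of "(u, u)" "(?s, u)"] u' gr by simp
            then have "\<Phi> ?s u < \<Phi> u u + e'" unfolding dist_real_def by linarith
            then show ?thesis using gen\<Phi>[OF u'(1,2)] u'(3) by (simp add: \<Phi>_def)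
          qed
          from le[OF this] show ?thesis unfolding lhs using True True2 by (simp add: gate_def mult.commute)
        next
          case False2: False
          have "\<alpha> ?s u + 1/2 * (indicator {..\<tau> \<omega>} u * \<gamma> ?s u) \<le> C" if u: "u \<in> {?s<..?t}" for u
          proof -
            have "u \<in> {0..T}" using u gr by auto
            from C[OF gr(5) this] show ?thesis by (cases "u \<le> \<tau> \<omega>") (auto simp: abs_if split: if_splits)
          qed
          from le[OF this] have "gate ?s \<omega> * vt ?s (?y ?s) * (T / real K) + (gate ?s \<omega> *\<^sub>R vx ?s (?y ?s)) \<bullet> (A ?t \<omega> - A ?s \<omega>) +
           1/2 * grid_quadratic K i \<omega> \<le> h * C" unfolding lhs .
          moreover have "0 \<le> e' * h" using e' h by simp
          ultimately show ?thesis using True False2 by (simp add: gate_def mult.commute)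
        qed
      qed
    qed
    have "grid_generator K \<omega> \<le> (\<Sum>i<K. e' * h + C * h * (gate (grid K i) \<omega> - gate (grid K (Suc i)) \<omega>))"
      unfolding grid_generator_def by (intro sum_mono step) simp
    also have "\<dots> = real K * (e' * h) + C * h * (gate (grid K 0) \<omega> - gate (grid K K) \<omega>)"
      by (simp add: sum.distrib sum_distrib_left[symmetric]
          sum_lessThan_telescope'[of "\<lambda>i. gate (grid K i) \<omega>"])
    also have "\<dots> \<le> real K * (e' * h) + C * h * 1"
      using C0 h by (intro add_left_mono mult_left_mono) (auto simp: gate_def)
    also have "\<dots> = e / 2 + C * T / real K" using elim T by (simp add: h_def e'_def)
    also have "\<dots> < e" using elim(2) by linarith
    finally show ?case using e by (auto simp: max_def)
  qed
  then show "\<exists>no. \<forall>n\<ge>no. norm (max 0 (grid_generator n \<omega>) - 0) < e" by (simp add: eventually_sequentially)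
qed

lemma cut_H_path_integrable:
  assumes \<omega>: "\<omega> \<in> space M" and s: "0 \<le> s"
  shows "integrable lborel (\<lambda>u. (norm (cut s t H (\<omega>, u)))\<^sup>2)"
proof -
  have "continuous_on UNIV (\<lambda>u. (norm (\<sigma> (Y u \<omega>)))\<^sup>2)"
    by (intro continuous_intros continuous_on_compose2[OF \<sigma>_cont Y_cont[OF \<omega>]]) auto
  from integrable_indicator_Ioc[OF this, of s "min t (\<tau> \<omega>)"]
  have "integrable lborel (\<lambda>u. indicator {s<..min t (\<tau> \<omega>)} u *\<^sub>R (norm (\<sigma> (Y u \<omega>)))\<^sup>2)" .
  also have "(\<lambda>u. indicator {s<..min t (\<tau> \<omega>)} u *\<^sub>R (norm (\<sigma> (Y u \<omega>)))\<^sup>2) = (\<lambda>u. (norm (cut s t H (\<omega>, u)))\<^sup>2)"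
  proof (rule ext)
    fix u show "indicator {s<..min t (\<tau> \<omega>)} u *\<^sub>R (norm (\<sigma> (Y u \<omega>)))\<^sup>2 = (norm (cut s t H (\<omega>, u)))\<^sup>2"
      using s H_eq[of u \<omega>] by (cases "u \<in> {s<..t}"; cases "u \<le> \<tau> \<omega>") (auto simp: cut_def)
  qed
  finally show ?thesis .
qed

lemma cut_H_grid_sum:
  assumes \<omega>: "\<omega> \<in> space M" and K: "0 < K"
  shows "(\<Sum>i<K. \<integral>u. (norm (cut (grid K i) (grid K (Suc i)) H (\<omega>, u)))\<^sup>2 \<partial>lborel) =
    (\<integral>u. (norm (cut 0 T H (\<omega>, u)))\<^sup>2 \<partial>lborel)"
proof -
  have mono: "grid K i \<le> grid K j" if "i \<le> j" for i j
    unfolding grid_def using that T by (intro mult_right_mono) auto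
  have ind: "(\<Sum>i<j. indicator {grid K i<..grid K (Suc i)} u) = (indicator {0<..grid K j} u :: real)" for j u
  proof (induction j)
    case (Suc j)
    have "0 \<le> grid K j" "grid K j \<le> grid K (Suc j)" using mono[of 0 j] mono[of j "Suc j"] by (auto simp: grid_0)
    then show ?case using Suc by (auto simp: indicator_def)
  qed (simp add: grid_0)
  have sq: "(norm (cut s t H (\<omega>, u)))\<^sup>2 = indicator {s<..t} u * (norm (H u \<omega>))\<^sup>2" for s t u
    by (cases "u \<in> {s<..t}") (auto simp: cut_def)
  have "(\<Sum>i<K. \<integral>u. (norm (cut (grid K i) (grid K (Suc i)) H (\<omega>, u)))\<^sup>2 \<partial>lborel) =
    (\<integral>u. (\<Sum>i<K. (norm (cut (grid K i) (grid K (Suc i)) H (\<omega>, u)))\<^sup>2) \<partial>lborel)"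
    by (intro Bochner_Integration.integral_sum[symmetric] cut_H_path_integrable \<omega> grid) simp
  also have "\<dots> = (\<integral>u. (norm (cut 0 T H (\<omega>, u)))\<^sup>2 \<partial>lborel)"
    unfolding sq sum_distrib_right[symmetric] ind grid_K[OF K] ..
  finally show ?thesis .
qed

text \<open>A dominating function independent of \<open>K\<close>: the quadratic parts of the cells
  add up to the energy of \<open>H\<close> over \<open>{0<..T}\<close>, and the other parts are
  bounded by multiples of the cell length.\<close>

lemma abs_grid_generator_le:
  assumes L': "0 \<le> L'" "\<And>A B. norm ((A::real^'n^'n) ** (B::real^'k^'n)) \<le> norm A * norm B * L'"
    and \<omega>: "\<omega> \<in> space M" and K: "0 < K"
  shows "\<bar>grid_generator K \<omega>\<bar> \<le> (G + G * L) * T + G * L' * (\<integral>u. (norm (cut 0 T H (\<omega>, u)))\<^sup>2 \<partial>lborel)"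
proof -
  let ?J = "\<lambda>i. \<integral>u. (norm (cut (grid K i) (grid K (Suc i)) H (\<omega>, u)))\<^sup>2 \<partial>lborel"
  have J0: "0 \<le> ?J i" for i by simp
  have G0: "0 \<le> G" using G(1)[of 0 x0] D(3) T by force
  have step: "\<bar>gate (grid K i) \<omega> * vt (grid K i) (Y (grid K i) \<omega>) * (T / real K) +
     (gate (grid K i) \<omega> *\<^sub>R vx (grid K i) (Y (grid K i) \<omega>)) \<bullet> (A (grid K (Suc i)) \<omega> - A (grid K i) \<omega>) +
     1/2 * grid_quadratic K i \<omega>\<bar> \<le> (G + G * L) * (T / real K) + G * L' * ?J i" if i: "i < K" for i
  proof -
    let ?s = "grid K i" and ?t = "grid K (Suc i)"
    note gr = grid[OF i]
    note gb = gated_bounds[OF gr(5)]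
    let ?Q = "gate ?s \<omega> *\<^sub>R vxx ?s (Y ?s \<omega>)"
    have h: "0 < T / real K" using T K by simp
    have 1: "\<bar>gate ?s \<omega> * vt ?s (Y ?s \<omega>) * (T / real K)\<bar> \<le> G * (T / real K)"
      unfolding abs_mult[of _ "T / real K"] abs_of_pos[OF h]
      by (rule mult_right_mono[OF gb(6) less_imp_le[OF h]])
    have "\<bar>(gate ?s \<omega> *\<^sub>R vx ?s (Y ?s \<omega>)) \<bullet> (A ?t \<omega> - A ?s \<omega>)\<bar> \<le> norm (gate ?s \<omega> *\<^sub>R vx ?s (Y ?s \<omega>)) * norm (A ?t \<omega> - A ?s \<omega>)"
      by (rule Cauchy_Schwarz_ineq2)
    also have "\<dots> \<le> G * (L * (T / real K))"
      using gb(2)[of \<omega>] norm_A_diff_le[OF \<omega> gr(1,2)] unfolding gr(4) by (intro mult_mono) (use G0 in auto)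
    finally have 2: "\<bar>(gate ?s \<omega> *\<^sub>R vx ?s (Y ?s \<omega>)) \<bullet> (A ?t \<omega> - A ?s \<omega>)\<bar> \<le> G * L * (T / real K)" by (simp add: mult.assoc)
    have "\<bar>grid_quadratic K i \<omega>\<bar> \<le> (\<integral>u. G * L' * (norm (cut ?s ?t H (\<omega>, u)))\<^sup>2 \<partial>lborel)"
      unfolding grid_quadratic_def real_norm_def[symmetric]
    proof (rule norm_integral_le)
      show "integrable lborel (\<lambda>u. G * L' * (norm (cut ?s ?t H (\<omega>, u)))\<^sup>2)"
        by (intro integrable_mult_right cut_H_path_integrable \<omega> gr)
      fix u
      have "norm (cut ?s ?t H (\<omega>, u) \<bullet> (?Q ** cut ?s ?t H (\<omega>, u))) \<le> norm (cut ?s ?t H (\<omega>, u)) * norm (?Q ** cut ?s ?t H (\<omega>, u))"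
        by (simp add: Cauchy_Schwarz_ineq2)
      also have "\<dots> \<le> norm (cut ?s ?t H (\<omega>, u)) * (norm ?Q * norm (cut ?s ?t H (\<omega>, u)) * L')"
        by (intro mult_left_mono L') simp
      also have "\<dots> \<le> norm (cut ?s ?t H (\<omega>, u)) * (G * norm (cut ?s ?t H (\<omega>, u)) * L')"
        using gb(4)[of \<omega>] L'(1) by (intro mult_left_mono mult_right_mono) auto
      also have "\<dots> = G * L' * (norm (cut ?s ?t H (\<omega>, u)))\<^sup>2" by (simp add: power2_eq_square)
      finally show "norm (cut ?s ?t H (\<omega>, u) \<bullet> (?Q ** cut ?s ?t H (\<omega>, u))) \<le> G * L' * (norm (cut ?s ?t H (\<omega>, u)))\<^sup>2" .
    qed
    also have "\<dots> = G * L' * ?J i" by simp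
    finally have 3: "\<bar>grid_quadratic K i \<omega>\<bar> \<le> G * L' * ?J i" .
    have 4: "(G + G * L) * (T / real K) = G * (T / real K) + G * L * (T / real K)" by (rule distrib_right)
    have 5: "0 \<le> G * L' * ?J i" using G0 L'(1) J0[of i] by (intro mult_nonneg_nonneg)
    have tri: "\<bar>x + y + 1/2 * q\<bar> \<le> a1 + a2 + j" if "\<bar>x\<bar> \<le> a1" "\<bar>y\<bar> \<le> a2" "\<bar>q\<bar> \<le> j" "0 \<le> j"
      for x y q a1 a2 j :: real
      using that by linarith
    show ?thesis unfolding 4 by (rule tri[OF 1 2 3 5])
  qed
  have "\<bar>grid_generator K \<omega>\<bar> \<le> (\<Sum>i<K. (G + G * L) * (T / real K) + G * L' * ?J i)"
    unfolding grid_generator_def by (rule order_trans[OF sum_abs], intro sum_mono step) simp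
  also have "\<dots> = (G + G * L) * T + G * L' * (\<Sum>i<K. ?J i)"
    using K by (simp add: sum.distrib sum_distrib_left)
  finally show ?thesis unfolding cut_H_grid_sum[OF \<omega> K] .
qed

section \<open>The reach-avoid bound\<close>

text \<open>With an open gate this is the one-step Taylor bound at
  \<open>Z s \<omega> = Y s \<omega>\<close>. With a closed gate every gated term vanishes, and the
  two error terms, left ungated, are nonnegative.\<close>

lemma stopped_value_step:
  assumes \<omega>: "\<omega> \<in> space M" and i: "i < K" and C: "0 \<le> C" and \<epsilon>: "0 < \<epsilon>"
    and taylor: "\<And>t h z a e. 0 \<le> t \<Longrightarrow> 0 \<le> h \<Longrightarrow> h \<le> h0 \<Longrightarrow> t + h \<le> T \<Longrightarrow> z \<in> D \<Longrightarrow> norm a \<le> L * h \<Longrightarrow>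
      max (- c) (min c (v (t + h) (z + a + e))) - v t z \<le>
      vt t z * h + vx t z \<bullet> a + vx t z \<bullet> e + 1/2 * (e \<bullet> (vxx t z *v e)) + \<epsilon> * (h + (norm e)\<^sup>2)
        + C * ((norm e)\<^sup>2 * indicator {\<eta><..} (norm e))"
    and h0: "T / real K \<le> h0"
  defines "s \<equiv> grid K i" and "t \<equiv> grid K (Suc i)"
  shows "gate s \<omega> * (w t (Z t \<omega>) - w s (Z s \<omega>)) \<le>
    gate s \<omega> * vt s (Y s \<omega>) * (T / real K) + (gate s \<omega> *\<^sub>R vx s (Y s \<omega>)) \<bullet> (A t \<omega> - A s \<omega>) +
    (gate s \<omega> *\<^sub>R vx s (Y s \<omega>)) \<bullet> (I t \<omega> - I s \<omega>) +
    1/2 * ((I t \<omega> - I s \<omega>) \<bullet> ((gate s \<omega> *\<^sub>R vxx s (Y s \<omega>)) *v (I t \<omega> - I s \<omega>))) +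
    \<epsilon> * (T / real K + (norm (I t \<omega> - I s \<omega>))\<^sup>2) +
    C * ((norm (I t \<omega> - I s \<omega>))\<^sup>2 * indicator {\<eta><..} (norm (I t \<omega> - I s \<omega>)))"
proof -
  note gr = grid[OF i, folded s_def t_def]
  have h: "0 \<le> T / real K" using T by simp
  show ?thesis
  proof (cases "\<Gamma> s \<omega>")
    case True
    have Ys: "Z s \<omega> = Y s \<omega>" "Y s \<omega> \<in> D" using Z_eq_Y[OF \<omega> gr(1) True] True gr(1) by (auto simp: \<Gamma>_def)
    have st: "s + T / real K = t" using gr(4) by simp
    have Zt: "Z t \<omega> = Y s \<omega> + (A t \<omega> - A s \<omega>) + (I t \<omega> - I s \<omega>)"
      unfolding Ys(1)[symmetric] by (simp add: Z_def)
    have "norm (A t \<omega> - A s \<omega>) \<le> L * (T / real K)" using norm_A_diff_le[OF \<omega> gr(1,2)] unfolding gr(4) .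
    from taylor[OF gr(1) h h0 _ Ys(2) this, of "I t \<omega> - I s \<omega>"]
    have "w t (Z t \<omega>) - v s (Y s \<omega>) \<le> vt s (Y s \<omega>) * (T / real K) + vx s (Y s \<omega>) \<bullet> (A t \<omega> - A s \<omega>) +
      vx s (Y s \<omega>) \<bullet> (I t \<omega> - I s \<omega>) + 1/2 * ((I t \<omega> - I s \<omega>) \<bullet> (vxx s (Y s \<omega>) *v (I t \<omega> - I s \<omega>))) +
      \<epsilon> * (T / real K + (norm (I t \<omega> - I s \<omega>))\<^sup>2) + C * ((norm (I t \<omega> - I s \<omega>))\<^sup>2 * indicator {\<eta><..} (norm (I t \<omega> - I s \<omega>)))"
      using gr(3) unfolding st Zt[symmetric] w_def[symmetric] by blast
    then show ?thesis using True w_eq_v[OF gr(5) Ys(2)] by (simp add: gate_def Ys(1))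
  next
    case False
    have "0 \<le> \<epsilon> * (T / real K + (norm (I t \<omega> - I s \<omega>))\<^sup>2)" using \<epsilon> h by simp
    moreover have "0 \<le> C * ((norm (I t \<omega> - I s \<omega>))\<^sup>2 * indicator {\<eta><..} (norm (I t \<omega> - I s \<omega>)))"
      using C by simp
    ultimately show ?thesis using False by (simp add: gate_def)
  qed
qed

lemma reach_probability_le:
  assumes S: "closed S" "S \<subseteq> D" "\<And>x. x \<in> S \<Longrightarrow> 1 \<le> v T x"
  defines "E0 \<equiv> {\<omega> \<in> space M. T \<le> \<tau> \<omega> \<and> Y T \<omega> \<in> S \<and> (\<forall>s\<in>{0..<T}. Y s \<omega> \<in> D)}"
  shows "E0 \<in> sets M" and "measure M E0 \<le> v 0 x0"
proof -
  have T0: "0 \<le> T" using T by simp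
  have E0_eq: "E0 = {\<omega> \<in> space M. \<Gamma> T \<omega>} \<inter> (Y T -` S \<inter> space M)"
  proof -
    \<comment> \<open>The event asks for \<open>D\<close> on \<open>{0..<T}\<close>; at
      \<open>T\<close> itself \<open>S \<subseteq> D\<close> supplies the membership.\<close>
    have "(\<forall>u\<in>{0..T}. Y u \<omega> \<in> D) \<longleftrightarrow> (\<forall>s\<in>{0..<T}. Y s \<omega> \<in> D)" if "Y T \<omega> \<in> S" for \<omega>
      using that S(2) T by (metis atLeastAtMost_iff atLeastLessThan_iff less_eq_real_def subsetD)
    then show ?thesis by (auto simp: E0_def \<Gamma>_def)
  qed
  have "{\<omega> \<in> space M. \<Gamma> T \<omega>} \<in> sets M" using \<Gamma>_sets[OF T0] sets_F_le by blast
  moreover have "Y T -` S \<inter> space M \<in> sets M"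
    using measurable_F_M[OF Y_measurable[OF T0]] S(1) by (intro measurable_sets) auto
  ultimately show E0: "E0 \<in> sets M" unfolding E0_eq by auto
  obtain N p q \<xi> where "ito_approximation M W N p q \<xi> H I T"
    using ito_process.ito_approximation_exists[OF ito_process_H] by blast
  then interpret ia: ito_approximation M W N p q \<xi> H I T .
  interpret PS: pair_sigma_finite M "lborel :: real measure" by standard
  obtain L' where L': "0 \<le> L'" "\<And>A B. norm ((A::real^'n^'n) ** (B::real^'k^'n)) \<le> norm A * norm B * L'"
    using bounded_bilinear.nonneg_bounded[OF bounded_bilinear_matrix_matrix] by blast
  \<comment> \<open>The energy of the integrand along one path. By the isometry its mean
    \<open>Jbar\<close> is, for every grid, the sum of the mean squared increments.\<close>
  define J where "J \<omega> = (\<integral>u. (norm (cut 0 T H (\<omega>, u)))\<^sup>2 \<partial>lborel)" for \<omega>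
  have intJ: "integrable M J"
    unfolding J_def[abs_def] by (rule PS.integrable_fst'[OF ia.cut_H_square_integrable[OF order_refl T0 order_refl]])
  define Jbar where "Jbar = expectation J"
  have Jbar: "0 \<le> Jbar" unfolding Jbar_def J_def by simp
  have G0: "0 \<le> G" using G(1)[of 0 x0] D(3) T by force
  define dI where "dI K i \<omega> = I (grid K (Suc i)) \<omega> - I (grid K i) \<omega>" for K i \<omega>
  define dA where "dA K i \<omega> = A (grid K (Suc i)) \<omega> - A (grid K i) \<omega>" for K i \<omega>
  define z where "z K i \<omega> = gate (grid K i) \<omega> *\<^sub>R vx (grid K i) (Y (grid K i) \<omega>)" for K i \<omega>
  define Q where "Q K i \<omega> = gate (grid K i) \<omega> *\<^sub>R vxx (grid K i) (Y (grid K i) \<omega>)" for K i \<omega>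
  define a where "a K i \<omega> = gate (grid K i) \<omega> * vt (grid K i) (Y (grid K i) \<omega>) * (T / real K)" for K i \<omega>
  have z: "z K i \<in> borel_measurable (F (grid K i))" "norm (z K i \<omega>) \<le> G"
    and Q: "Q K i \<in> borel_measurable (F (grid K i))" "norm (Q K i \<omega>) \<le> G" if "i < K" for K i \<omega>
    unfolding z_def[abs_def] Q_def[abs_def] using gated_bounds[OF grid(5)[OF that]] by auto
  have int_a: "integrable M (a K i)" if i: "i < K" for K i
  proof (rule integrable_const_bound)
    note gb = gated_bounds(5,6)[OF grid(5)[OF i]]
    show "a K i \<in> borel_measurable M"
      unfolding a_def[abs_def] by (intro borel_measurable_times measurable_F_M[OF gb(1)] borel_measurable_const)
    show "AE \<omega> in M. norm (a K i \<omega>) \<le> G * (T / real K)"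
    proof (rule AE_I2)
      fix \<omega>
      have h: "0 < T / real K" using T i by simp
      show "norm (a K i \<omega>) \<le> G * (T / real K)"
        unfolding a_def real_norm_def abs_mult[of _ "T / real K"] abs_of_pos[OF h]
        by (rule mult_right_mono[OF gb(2) less_imp_le[OF h]])
    qed
  qed
  have int_zA: "integrable M (\<lambda>\<omega>. z K i \<omega> \<bullet> dA K i \<omega>)" if i: "i < K" for K i
  proof (rule integrable_const_bound)
    show "(\<lambda>\<omega>. z K i \<omega> \<bullet> dA K i \<omega>) \<in> borel_measurable M"
      unfolding dA_def by (intro borel_measurable_inner borel_measurable_diff A_measurable measurable_F_M[OF z(1)[OF i]])
    show "AE \<omega> in M. norm (z K i \<omega> \<bullet> dA K i \<omega>) \<le> G * (L * (T / real K))"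
    proof (rule AE_I2)
      fix \<omega> assume \<omega>: "\<omega> \<in> space M"
      have "norm (z K i \<omega> \<bullet> dA K i \<omega>) \<le> norm (z K i \<omega>) * norm (dA K i \<omega>)" by (simp add: Cauchy_Schwarz_ineq2)
      also have "\<dots> \<le> G * (L * (T / real K))"
        using norm_A_diff_le[OF \<omega> grid(1,2)[OF i]] z(2)[OF i] G0
        unfolding grid(4)[OF i] dA_def[symmetric] by (intro mult_mono) auto
      finally show "norm (z K i \<omega> \<bullet> dA K i \<omega>) \<le> G * (L * (T / real K))" .
    qed
  qed
  \<comment> \<open>\<open>z\<close> is known at the start of the step, so the first order
    stochastic term has mean zero.\<close>
  have zI: "integrable M (\<lambda>\<omega>. z K i \<omega> \<bullet> dI K i \<omega>)" "expectation (\<lambda>\<omega>. z K i \<omega> \<bullet> dI K i \<omega>) = 0" if i: "i < K" for K i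
    unfolding dI_def using ia.increment_mean_zero[OF grid(1-3)[OF i] z[OF i]] by auto
  note quad = ia.increment_quadratic[OF grid(1-3) Q]
  have gq: "grid_quadratic K i \<omega> = (\<integral>u. cut (grid K i) (grid K (Suc i)) H (\<omega>, u) \<bullet> (Q K i (fst (\<omega>, u)) ** cut (grid K i) (grid K (Suc i)) H (\<omega>, u)) \<partial>lborel)" for K i \<omega>
    by (simp add: grid_quadratic_def Q_def)
  \<comment> \<open>The weighted isometry, with Fubini's theorem, trades the second order term for a
    time integral of the same mean.\<close>
  have IQ: "integrable M (\<lambda>\<omega>. dI K i \<omega> \<bullet> (Q K i \<omega> *v dI K i \<omega>))" "integrable M (grid_quadratic K i)"
    "expectation (\<lambda>\<omega>. dI K i \<omega> \<bullet> (Q K i \<omega> *v dI K i \<omega>)) = expectation (grid_quadratic K i)" if i: "i < K" for K i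
  proof -
    show "integrable M (\<lambda>\<omega>. dI K i \<omega> \<bullet> (Q K i \<omega> *v dI K i \<omega>))" unfolding dI_def by (rule quad(1)[OF i i i i i])
    show "integrable M (grid_quadratic K i)"
      unfolding gq[abs_def] by (rule PS.integrable_fst'[OF quad(2)[OF i i i i i]])
    show "expectation (\<lambda>\<omega>. dI K i \<omega> \<bullet> (Q K i \<omega> *v dI K i \<omega>)) = expectation (grid_quadratic K i)"
      unfolding gq[abs_def] dI_def PS.integral_fst'[OF quad(2)[OF i i i i i]] by (rule quad(3)[OF i i i i i])
  qed
  have sqI: "integrable M (\<lambda>\<omega>. (norm (dI K i \<omega>))\<^sup>2)" if i: "i < K" for K i
    unfolding dI_def by (rule ia.increment_square_integrable[OF grid(1-3)[OF i]])
  have sum_sq: "(\<Sum>i<K. expectation (\<lambda>\<omega>. (norm (dI K i \<omega>))\<^sup>2)) = Jbar" if K: "0 < K" for K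
  proof -
    have eq: "expectation (\<lambda>\<omega>. (norm (dI K i \<omega>))\<^sup>2) =
        expectation (\<lambda>\<omega>. \<integral>u. (norm (cut (grid K i) (grid K (Suc i)) H (\<omega>, u)))\<^sup>2 \<partial>lborel)"
      and int: "integrable M (\<lambda>\<omega>. \<integral>u. (norm (cut (grid K i) (grid K (Suc i)) H (\<omega>, u)))\<^sup>2 \<partial>lborel)" if i: "i < K" for i
    proof -
      have m1: "(\<lambda>_. mat 1 :: real^'n^'n) \<in> borel_measurable (F (grid K i))" by simp
      have "expectation (\<lambda>\<omega>. (norm (dI K i \<omega>))\<^sup>2) = (\<integral>x. (norm (cut (grid K i) (grid K (Suc i)) H x))\<^sup>2 \<partial>(M \<Otimes>\<^sub>M lborel))"
        using ia.increment_quadratic(3)[OF grid(1-3)[OF i] m1 order_refl] by (simp add: dI_def power2_norm_eq_inner)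
      also have "\<dots> = expectation (\<lambda>\<omega>. \<integral>u. (norm (cut (grid K i) (grid K (Suc i)) H (\<omega>, u)))\<^sup>2 \<partial>lborel)"
        by (rule PS.integral_fst'[symmetric, OF ia.cut_H_square_integrable[OF grid(1-3)[OF i]]])
      finally show "expectation (\<lambda>\<omega>. (norm (dI K i \<omega>))\<^sup>2) =
        expectation (\<lambda>\<omega>. \<integral>u. (norm (cut (grid K i) (grid K (Suc i)) H (\<omega>, u)))\<^sup>2 \<partial>lborel)" .
      show "integrable M (\<lambda>\<omega>. \<integral>u. (norm (cut (grid K i) (grid K (Suc i)) H (\<omega>, u)))\<^sup>2 \<partial>lborel)"
        by (rule PS.integrable_fst'[OF ia.cut_H_square_integrable[OF grid(1-3)[OF i]]])
    qed
    have "(\<Sum>i<K. expectation (\<lambda>\<omega>. (norm (dI K i \<omega>))\<^sup>2)) =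
      (\<Sum>i<K. expectation (\<lambda>\<omega>. \<integral>u. (norm (cut (grid K i) (grid K (Suc i)) H (\<omega>, u)))\<^sup>2 \<partial>lborel))"
      by (intro sum.cong refl eq) simp
    also have "\<dots> = expectation (\<lambda>\<omega>. \<Sum>i<K. \<integral>u. (norm (cut (grid K i) (grid K (Suc i)) H (\<omega>, u)))\<^sup>2 \<partial>lborel)"
      by (intro Bochner_Integration.integral_sum[symmetric] int) simp
    also have "\<dots> = Jbar"
      unfolding Jbar_def J_def by (intro Bochner_Integration.integral_cong refl cut_H_grid_sum K)
    finally show ?thesis .
  qed
  have gen_eq: "grid_generator K \<omega> = (\<Sum>i<K. a K i \<omega> + z K i \<omega> \<bullet> dA K i \<omega> + 1/2 * grid_quadratic K i \<omega>)" for K \<omega>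
    by (simp add: grid_generator_def a_def z_def dA_def)
  have int_gen: "integrable M (grid_generator K)" for K
    unfolding gen_eq[abs_def]
    by (intro Bochner_Integration.integrable_sum Bochner_Integration.integrable_add int_a int_zA integrable_mult_right IQ(2)) auto
  have E_gen: "expectation (grid_generator K) =
     (\<Sum>i<K. expectation (a K i) + expectation (\<lambda>\<omega>. z K i \<omega> \<bullet> dA K i \<omega>) + 1/2 * expectation (grid_quadratic K i))" for K
    unfolding gen_eq[abs_def]
    by (subst Bochner_Integration.integral_sum) (auto intro!: sum.cong simp: int_a int_zA IQ(2))
  have lim_gen: "(\<lambda>K. expectation (\<lambda>\<omega>. max 0 (grid_generator K \<omega>))) \<longlonglongrightarrow> 0"
  \<comment> \<open>Shifted by one index, since the domination is stated for
    \<open>K > 0\<close>.\<close>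
  proof (rule LIMSEQ_imp_Suc)
    have "(\<lambda>K. expectation (\<lambda>\<omega>. max 0 (grid_generator (Suc K) \<omega>))) \<longlonglongrightarrow> expectation (\<lambda>\<omega>. 0)"
    proof (rule integral_dominated_convergence[where w="\<lambda>\<omega>. (G + G * L) * T + G * L' * J \<omega>"])
      show "integrable M (\<lambda>\<omega>. (G + G * L) * T + G * L' * J \<omega>)" using intJ by simp
      show "AE \<omega> in M. (\<lambda>K. max 0 (grid_generator (Suc K) \<omega>)) \<longlonglongrightarrow> 0"
        by (intro AE_I2 LIMSEQ_Suc grid_generator_limsup)
      show "AE \<omega> in M. norm (max 0 (grid_generator (Suc K) \<omega>)) \<le> (G + G * L) * T + G * L' * J \<omega>" for K
      proof (rule AE_I2)
        fix \<omega> assume "\<omega> \<in> space M"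
        have "norm (max 0 (grid_generator (Suc K) \<omega>)) \<le> \<bar>grid_generator (Suc K) \<omega>\<bar>" by simp
        also have "\<dots> \<le> (G + G * L) * T + G * L' * J \<omega>"
          unfolding J_def by (rule abs_grid_generator_le[OF L' \<open>\<omega> \<in> space M\<close>]) simp
        finally show "norm (max 0 (grid_generator (Suc K) \<omega>)) \<le> (G + G * L) * T + G * L' * J \<omega>" .
      qed
      show "(\<lambda>\<omega>. max 0 (grid_generator (Suc K) \<omega>)) \<in> borel_measurable M" for K
        using borel_measurable_integrable[OF int_gen[of "Suc K"]] by simp
    qed simp
    then show "(\<lambda>K. expectation (\<lambda>\<omega>. max 0 (grid_generator (Suc K) \<omega>))) \<longlonglongrightarrow> 0" by simp
  qed
  have int_sv: "integrable M (stopped_value K)" for K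
    using stopped_value_measurable abs_stopped_value_le by (intro integrable_const_bound[where B=c]) auto
  have lim_sv: "(\<lambda>K. expectation (\<lambda>\<omega>. max 0 (- stopped_value K \<omega>))) \<longlonglongrightarrow> 0"
  proof -
    have "(\<lambda>K. expectation (\<lambda>\<omega>. max 0 (- stopped_value K \<omega>))) \<longlonglongrightarrow> expectation (\<lambda>\<omega>. 0)"
    proof (rule integral_dominated_convergence[where w="\<lambda>\<omega>. c"])
      show "AE \<omega> in M. (\<lambda>K. max 0 (- stopped_value K \<omega>)) \<longlonglongrightarrow> 0"
        by (intro AE_I2 stopped_value_lower)
      show "AE \<omega> in M. norm (max 0 (- stopped_value K \<omega>)) \<le> c" for K
      proof (rule AE_I2)
        fix \<omega> assume "\<omega> \<in> space M"
        from abs_stopped_value_le[OF this, of K] show "norm (max 0 (- stopped_value K \<omega>)) \<le> c" by auto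
      qed
      show "(\<lambda>\<omega>. max 0 (- stopped_value K \<omega>)) \<in> borel_measurable M" for K
        using stopped_value_measurable[of K] by simp
    qed auto
    then show ?thesis by simp
  qed
  show "measure M E0 \<le> v 0 x0"
  proof (rule field_le_epsilon)
    fix e :: real assume e: "0 < e"
    \<comment> \<open>A quarter of \<open>e\<close> for each of four errors:
      \<open>\<epsilon>\<close> times \<open>T + Jbar\<close>, the tail, the positive part of the
      Riemann sum, and the negative part of the stopped value.\<close>
    define \<epsilon> where "\<epsilon> = e / (4 * (T + Jbar + 1))"
    have \<epsilon>: "0 < \<epsilon>" "\<epsilon> * (T + Jbar) \<le> e / 4"
    proof -
      have p: "0 < T + Jbar + 1" using T Jbar by simp
      then show "0 < \<epsilon>" using e by (simp add: \<epsilon>_def)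
      have "\<epsilon> * (T + Jbar) \<le> \<epsilon> * (T + Jbar + 1)" using \<open>0 < \<epsilon>\<close> by simp
      also have "\<dots> = e / 4" unfolding \<epsilon>_def using p by (simp add: field_simps)
      finally show "\<epsilon> * (T + Jbar) \<le> e / 4" .
    qed
    have L0: "0 \<le> L" using L by simp
    have "\<exists>\<eta>>0. \<exists>C\<ge>0. \<exists>h0>0. \<forall>t h z a e. 0 \<le> t \<longrightarrow> 0 \<le> h \<longrightarrow> h \<le> h0 \<longrightarrow> t + h \<le> T \<longrightarrow> z \<in> D \<longrightarrow> norm a \<le> L * h \<longrightarrow>
      max (- c) (min c (v (t + h) (z + a + e))) - v t z \<le>
      vt t z * h + vx t z \<bullet> a + vx t z \<bullet> e + 1/2 * (e \<bullet> (vxx t z *v e)) + \<epsilon> * (h + (norm e)\<^sup>2)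
        + C * ((norm e)\<^sup>2 * indicator {\<eta><..} (norm e))"
      by (rule clamped_taylor_upper_bound[OF C12 R _ c(1) L0 \<epsilon>(1)]) (rule c(2))
    then obtain \<eta> C h0 where \<eta>: "0 < \<eta>" and C: "0 \<le> C" and h0: "0 < h0" and taylor:
      "\<forall>t h z a e. 0 \<le> t \<longrightarrow> 0 \<le> h \<longrightarrow> h \<le> h0 \<longrightarrow> t + h \<le> T \<longrightarrow> z \<in> D \<longrightarrow> norm a \<le> L * h \<longrightarrow>
      max (- c) (min c (v (t + h) (z + a + e))) - v t z \<le>
      vt t z * h + vx t z \<bullet> a + vx t z \<bullet> e + 1/2 * (e \<bullet> (vxx t z *v e)) + \<epsilon> * (h + (norm e)\<^sup>2)
        + C * ((norm e)\<^sup>2 * indicator {\<eta><..} (norm e))"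
      by (elim exE conjE)
    define tl where "tl K i \<omega> = (norm (dI K i \<omega>))\<^sup>2 * indicator {\<eta><..} (norm (dI K i \<omega>))" for K i \<omega>
    have int_tl: "integrable M (tl K i)" if i: "i < K" for K i
    proof (rule Bochner_Integration.integrable_bound[OF sqI[OF i]])
      have "dI K i \<in> borel_measurable M"
        unfolding dI_def[abs_def] using grid[OF i] by (intro borel_measurable_diff I_measurable) auto
      then show "tl K i \<in> borel_measurable M" unfolding tl_def[abs_def] by measurable
      show "AE \<omega> in M. norm (tl K i \<omega>) \<le> norm ((norm (dI K i \<omega>))\<^sup>2)"
        by (intro AE_I2) (auto simp: tl_def indicator_def)
    qed
    have e4: "0 < e / 4" "0 < e / (4 * (C + 1))" using e C by auto
    have "\<forall>\<^sub>F K in sequentially. T / real K < h0"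
      by (rule order_tendstoD(2)[OF lim_const_over_n h0])
    moreover have "\<forall>\<^sub>F K in sequentially. expectation (\<lambda>\<omega>. max 0 (grid_generator K \<omega>)) < e / 4"
      by (rule order_tendstoD(2)[OF lim_gen e4(1)])
    moreover have "\<forall>\<^sub>F K in sequentially. expectation (\<lambda>\<omega>. max 0 (- stopped_value K \<omega>)) < e / 4"
      by (rule order_tendstoD(2)[OF lim_sv e4(1)])
    moreover have "\<forall>\<^sub>F K in sequentially. (\<Sum>i<K. expectation (tl K i)) < e / (4 * (C + 1))"
      using ia.increment_tail[OF \<eta> e4(2)] unfolding tl_def[abs_def] dI_def grid_def .
    ultimately have "\<forall>\<^sub>F K in sequentially. measure M E0 \<le> v 0 x0 + e"
      using eventually_gt_at_top[of 0]
    proof eventually_elim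
      case (elim K)
      define h where "h = T / real K"
      have Kh: "real K * h = T" using elim(5) by (simp add: h_def)
      let ?U = "\<lambda>i \<omega>. a K i \<omega> + z K i \<omega> \<bullet> dA K i \<omega> + z K i \<omega> \<bullet> dI K i \<omega> + 1/2 * (dI K i \<omega> \<bullet> (Q K i \<omega> *v dI K i \<omega>))
         + \<epsilon> * (h + (norm (dI K i \<omega>))\<^sup>2) + C * tl K i \<omega>"
      have intU: "integrable M (?U i)" if "i < K" for i
        using that by (intro Bochner_Integration.integrable_add int_a int_zA zI(1) integrable_mult_right IQ(1) sqI int_tl integrable_const)
      have EU: "expectation (?U i) = expectation (a K i) + expectation (\<lambda>\<omega>. z K i \<omega> \<bullet> dA K i \<omega>)
          + 1/2 * expectation (grid_quadratic K i) + \<epsilon> * (h + expectation (\<lambda>\<omega>. (norm (dI K i \<omega>))\<^sup>2)) + C * expectation (tl K i)"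
        if i: "i < K" for i
        using int_a[OF i] int_zA[OF i] zI[OF i] IQ[OF i] sqI[OF i] int_tl[OF i]
        by (simp add: prob_space)
      have step: "stopped_value K \<omega> \<le> w 0 x0 + (\<Sum>i<K. ?U i \<omega>)" if \<omega>: "\<omega> \<in> space M" for \<omega>
        unfolding stopped_value_def
      proof (intro add_left_mono sum_mono)
        fix i assume "i \<in> {..<K}"
        then have i: "i < K" by simp
        show "gate (grid K i) \<omega> * (w (grid K (Suc i)) (Z (grid K (Suc i)) \<omega>) - w (grid K i) (Z (grid K i) \<omega>)) \<le> ?U i \<omega>"
          using stopped_value_step[OF \<omega> i C \<epsilon>(1) taylor[rule_format] less_imp_le[OF elim(1)]]
          unfolding a_def z_def dA_def dI_def Q_def tl_def h_def by simp
      qed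
      have "expectation (stopped_value K) \<le> expectation (\<lambda>\<omega>. w 0 x0 + (\<Sum>i<K. ?U i \<omega>))"
        by (intro integral_mono int_sv step Bochner_Integration.integrable_add integrable_const Bochner_Integration.integrable_sum intU) auto
      also have "\<dots> = w 0 x0 + (\<Sum>i<K. expectation (?U i))"
      proof -
        have "expectation (\<lambda>\<omega>. w 0 x0 + (\<Sum>i<K. ?U i \<omega>)) = expectation (\<lambda>\<omega>. w 0 x0) + expectation (\<lambda>\<omega>. \<Sum>i<K. ?U i \<omega>)"
          by (intro Bochner_Integration.integral_add integrable_const Bochner_Integration.integrable_sum intU) auto
        also have "expectation (\<lambda>\<omega>. \<Sum>i<K. ?U i \<omega>) = (\<Sum>i<K. expectation (?U i))"
          by (intro Bochner_Integration.integral_sum intU) auto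
        finally show ?thesis by (simp add: prob_space)
      qed
      also have "(\<Sum>i<K. expectation (?U i)) = expectation (grid_generator K) + \<epsilon> * (T + Jbar) + C * (\<Sum>i<K. expectation (tl K i))"
      proof -
        have "(\<Sum>i<K. expectation (?U i)) = (\<Sum>i<K. (expectation (a K i) + expectation (\<lambda>\<omega>. z K i \<omega> \<bullet> dA K i \<omega>)
          + 1/2 * expectation (grid_quadratic K i)) + \<epsilon> * (h + expectation (\<lambda>\<omega>. (norm (dI K i \<omega>))\<^sup>2)) + C * expectation (tl K i))"
          by (intro sum.cong refl EU) simp
        also have "\<dots> = expectation (grid_generator K) + \<epsilon> * (real K * h + (\<Sum>i<K. expectation (\<lambda>\<omega>. (norm (dI K i \<omega>))\<^sup>2)))
            + C * (\<Sum>i<K. expectation (tl K i))"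
          unfolding E_gen by (simp only: sum.distrib sum_distrib_left[symmetric] sum_constant card_lessThan)
        finally show ?thesis unfolding Kh sum_sq[OF elim(5)] .
      qed
      also have "expectation (grid_generator K) \<le> expectation (\<lambda>\<omega>. max 0 (grid_generator K \<omega>))"
        using int_gen[of K] by (intro integral_mono) auto
      finally have sv: "expectation (stopped_value K) \<le> w 0 x0 + (expectation (\<lambda>\<omega>. max 0 (grid_generator K \<omega>)) + \<epsilon> * (T + Jbar)
          + C * (\<Sum>i<K. expectation (tl K i)))" by simp
      have tl4: "C * (\<Sum>i<K. expectation (tl K i)) \<le> e / 4"
      proof -
        have "C * (\<Sum>i<K. expectation (tl K i)) \<le> C * (e / (4 * (C + 1)))" using elim(4) C by (intro mult_left_mono) auto
        also have "\<dots> = (C / (C + 1)) * (e / 4)" by simp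
        also have "\<dots> \<le> 1 * (e / 4)" using C e by (intro mult_right_mono) auto
        finally show ?thesis by simp
      qed
      \<comment> \<open>The right side is the positive part of the stopped value; on the event the
        value itself is \<open>v T (Y T \<omega>) \<ge> 1\<close>.\<close>
      have ind: "indicator E0 \<omega> \<le> stopped_value K \<omega> + max 0 (- stopped_value K \<omega>)" if \<omega>: "\<omega> \<in> space M" for \<omega>
      proof (cases "\<omega> \<in> E0")
        case True
        then have \<Gamma>T: "\<Gamma> T \<omega>" and YS: "Y T \<omega> \<in> S" unfolding E0_eq by auto
        obtain j where "Suc j = K" "stopped_value K \<omega> = w (grid K (Suc j)) (Z (grid K (Suc j)) \<omega>)"
          using stopped_value_eq[OF \<omega> elim(5)] \<Gamma>T by blast
        then have "stopped_value K \<omega> = w T (Z T \<omega>)" using grid_K[OF elim(5)] by simp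
        also have "\<dots> = v T (Y T \<omega>)" using Z_eq_Y[OF \<omega> T0 \<Gamma>T] YS S(2) T by (subst w_eq_v) auto
        also have "\<dots> \<ge> 1" by (rule S(3)[OF YS])
        finally show ?thesis using True by simp
      qed auto
      have int_neg: "integrable M (\<lambda>\<omega>. max 0 (- stopped_value K \<omega>))"
        using int_sv[of K] by simp
      have "measure M E0 = expectation (indicator E0)" using E0 by simp
      also have "\<dots> \<le> expectation (\<lambda>\<omega>. stopped_value K \<omega> + max 0 (- stopped_value K \<omega>))"
        using E0 by (intro integral_mono Bochner_Integration.integrable_add int_sv int_neg ind) (auto simp: emeasure_eq_measure)
      also have "\<dots> = expectation (stopped_value K) + expectation (\<lambda>\<omega>. max 0 (- stopped_value K \<omega>))"
        by (rule Bochner_Integration.integral_add[OF int_sv int_neg])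
      finally have "measure M E0 \<le> w 0 x0 + e" using sv tl4 \<epsilon>(2) elim(2,3) by argo
      then show ?case using w_eq_v[of 0 x0] D(3) T by simp
    qed
    then show "measure M E0 \<le> v 0 x0 + e"
      using eventually_happens[of _ sequentially] by auto
  qed
qed

end

theorem corollary4:
  fixes M :: "'a measure"
    and W :: "real \<Rightarrow> 'a \<Rightarrow> real ^ 'k"
    and b :: "real ^ 'n \<Rightarrow> real ^ 'n"
    and \<sigma> :: "real ^ 'n \<Rightarrow> real ^ 'k ^ 'n"
    and D S :: "(real ^ 'n) set"
    and T :: real
    and X :: "real ^ 'n \<Rightarrow> real \<Rightarrow> 'a \<Rightarrow> real ^ 'n"
    and \<zeta> :: "real ^ 'n \<Rightarrow> 'a \<Rightarrow> ereal"
    and v vt :: "real \<Rightarrow> real ^ 'n \<Rightarrow> real"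
    and vx :: "real \<Rightarrow> real ^ 'n \<Rightarrow> real ^ 'n"
    and vxx :: "real \<Rightarrow> real ^ 'n \<Rightarrow> real ^ 'n ^ 'n"
  assumes "prob_space M"
    and "wiener_process M W"
    and "local_lipschitz (UNIV :: real set) UNIV (\<lambda>_. b)"
    and "local_lipschitz (UNIV :: real set) UNIV (\<lambda>_. \<sigma>)"
    and "open D" and "bounded D"
    and "closed S" and "S \<subseteq> D"
    and "0 < T"
    and "\<And>x0. x0 \<in> D - S \<Longrightarrow> maximal_local_strong_solution M W b \<sigma> x0 (X x0) (\<zeta> x0)"
    and "C12_on T v vt vx vxx"
    and "\<And>t x. t \<in> {0..T} \<Longrightarrow> x \<in> D \<Longrightarrow> generator b \<sigma> vt vx vxx t x \<le> 0"
    and "\<And>t x. t \<in> {0..T} \<Longrightarrow> x \<in> frontier D \<Longrightarrow> vt t x \<le> 0"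
    and "\<And>x. x \<in> closure D \<Longrightarrow> indicator S x \<le> v T x"
  shows "\<forall>x0\<in>D - S. reach_avoid_prob M (X x0) (\<zeta> x0) D S T \<le> v 0 x0"
proof (rule ballI)
  fix x0 assume x0: "x0 \<in> D - S"
  note b_lip = assms(3) and \<sigma>_lip = assms(4) and opD = assms(5) and bdD = assms(6) and clS = assms(7) and SD = assms(8)
    and T = assms(9) and C12 = assms(11) and gen = assms(12) and bd = assms(13) and fin = assms(14)
  interpret brownian M W using assms(1,2) by (simp add: brownian_def brownian_axioms_def)
  let ?X = "X x0" and ?\<zeta> = "\<zeta> x0"
  have lss: "local_strong_solution M W b \<sigma> x0 ?X ?\<zeta>"
    using assms(10)[OF x0] unfolding maximal_local_strong_solution_def by blast
  have sol: "\<And>\<omega>. \<omega> \<in> space M \<Longrightarrow> ?X 0 \<omega> = x0"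
      "\<And>\<omega>. \<omega> \<in> space M \<Longrightarrow> continuous_on {t. 0 \<le> t \<and> ereal t < ?\<zeta> \<omega>} (\<lambda>t. ?X t \<omega>)"
      "\<And>t. 0 \<le> t \<Longrightarrow> ?X t \<in> borel_measurable (restrict_space (F t) {\<omega> \<in> space M. ereal t < ?\<zeta> \<omega>})"
    using lss unfolding local_strong_solution_def Let_def by blast+
  obtain \<tau> :: "nat \<Rightarrow> 'a \<Rightarrow> real" where \<tau>_st: "\<And>m. stopping_time F (\<tau> m)"
    and \<tau>_all: "\<forall>\<omega>\<in>space M. (\<forall>m. 0 \<le> \<tau> m \<omega> \<and> \<tau> m \<omega> \<le> \<tau> (Suc m) \<omega> \<and> ereal (\<tau> m \<omega>) < ?\<zeta> \<omega>) \<and>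
            (\<lambda>m. ereal (\<tau> m \<omega>)) \<longlonglongrightarrow> ?\<zeta> \<omega>"
    and ito: "\<And>m t. 0 \<le> t \<Longrightarrow> has_ito_integral M F W (\<lambda>s \<omega>. indicator {..\<tau> m \<omega>} s *\<^sub>R \<sigma> (?X s \<omega>)) t
            (\<lambda>\<omega>. ?X (min t (\<tau> m \<omega>)) \<omega> - x0 - integral {0..min t (\<tau> m \<omega>)} (\<lambda>s. b (?X s \<omega>)))"
    using lss unfolding local_strong_solution_def Let_def by blast
  have \<tau>: "0 \<le> \<tau> m \<omega>" "\<tau> m \<omega> \<le> \<tau> (Suc m) \<omega>" "ereal (\<tau> m \<omega>) < ?\<zeta> \<omega>" "(\<lambda>m. ereal (\<tau> m \<omega>)) \<longlonglongrightarrow> ?\<zeta> \<omega>"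
    if "\<omega> \<in> space M" for m \<omega>
    using \<tau>_all that by blast+
  have b_cont: "continuous_on UNIV b" and \<sigma>_cont: "continuous_on UNIV \<sigma>"
    using local_lipschitz_continuous_on[OF b_lip, of 0] local_lipschitz_continuous_on[OF \<sigma>_lip, of 0] by auto
  have fin0: "0 \<le> v T x" if "x \<in> closure D" for x
    using fin[OF that] by (rule order_trans[rotated]) simp
  have fin1: "1 \<le> v T x" if "x \<in> S" for x
    using fin[of x] that SD closure_subset by (auto simp: subset_iff)
  \<comment> \<open>This is where the frontier condition \<open>bd\<close> enters.\<close>
  have v_nonneg: "0 \<le> v t x" if "t \<in> {0..T}" "x \<in> D" for t x
    by (rule supersolution_nonneg[OF C12 opD bdD gen bd fin0 that])
  obtain R where R: "D \<subseteq> cball 0 R"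
    using bounded_subset_ballD[OF bdD, of 0] ball_subset_cball by blast
  have bnd: "\<exists>C. \<forall>p\<in>{0..T} \<times> cball 0 (R + 1). norm (f p) \<le> C"
    if "continuous_on ({0..T} \<times> UNIV) f" for f :: "real \<times> (real ^ 'n) \<Rightarrow> 'z::real_normed_vector"
  proof -
    have "compact ({0..T} \<times> cball (0 :: real ^ 'n) (R + 1))" by (intro compact_Times) auto
    moreover have "continuous_on ({0..T} \<times> cball 0 (R + 1)) f" using that by (rule continuous_on_subset) auto
    ultimately have "bounded (f ` ({0..T} \<times> cball 0 (R + 1)))"
      by (intro compact_imp_bounded compact_continuous_image)
    then show ?thesis by (auto simp: bounded_iff)
  qed
  have vc: "continuous_on ({0..T} \<times> UNIV) (\<lambda>(t, x). v t x)" "continuous_on ({0..T} \<times> UNIV) (\<lambda>(t, x). vt t x)"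
    "continuous_on ({0..T} \<times> UNIV) (\<lambda>(t, x). vx t x)" "continuous_on ({0..T} \<times> UNIV) (\<lambda>(t, x). vxx t x)"
    using C12 unfolding C12_on_def by blast+
  have bc: "continuous_on ({0..T} \<times> UNIV) (\<lambda>p. b (snd p))"
    by (rule continuous_on_compose2[OF b_cont]) (auto intro!: continuous_intros)
  obtain c where c: "\<forall>p\<in>{0..T} \<times> cball 0 (R + 1). norm (case p of (t, x) \<Rightarrow> v t x) \<le> c" using bnd[OF vc(1)] ..
  obtain G1 where G1: "\<forall>p\<in>{0..T} \<times> cball 0 (R + 1). norm (case p of (t, x) \<Rightarrow> vt t x) \<le> G1" using bnd[OF vc(2)] ..
  obtain G2 where G2: "\<forall>p\<in>{0..T} \<times> cball 0 (R + 1). norm (case p of (t, x) \<Rightarrow> vx t x) \<le> G2" using bnd[OF vc(3)] ..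
  obtain G3 where G3: "\<forall>p\<in>{0..T} \<times> cball 0 (R + 1). norm (case p of (t, x) \<Rightarrow> vxx t x) \<le> G3" using bnd[OF vc(4)] ..
  obtain L where L: "\<forall>p\<in>{0..T} \<times> cball 0 (R + 1). norm (b (snd p)) \<le> L" using bnd[OF bc] ..
  have inB: "(t, x) \<in> {0..T} \<times> cball 0 (R + 1)" if "t \<in> {0..T}" "x \<in> D" for t x
    using that R by (auto simp: subset_iff)
  \<comment> \<open>The maxima with \<open>1\<close> and \<open>0\<close> give the truncation level
    and the clamp the signs that the locale asks for; the last one is a common bound for the three
    derivatives.\<close>
  have sd: "stopped_diffusion M W b \<sigma> ?X (\<tau> m) x0 D T v vt vx vxx R (max 1 L) (max 0 c) (max G1 (max G2 G3))" for m
  proof (unfold_locales, goal_cases)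
    case 1 show ?case by (rule \<tau>_st)
  next
    case (2 \<omega>) then show ?case by (rule \<tau>(1))
  next
    case (3 \<omega>) then show ?case by (rule sol(1))
  next
    case (4 \<omega>)
    show ?case
      by (rule continuous_on_subset[OF sol(2)[OF 4]]) (use \<tau>(3)[OF 4, of m] in \<open>auto intro: le_less_trans[of "ereal _" "ereal (\<tau> m \<omega>)"]\<close>)
  next
    case (5 t)
    show ?case
      by (rule measurable_restrict_mono[OF sol(3)[OF 5]]) (use \<tau>(3)[of _ m] in \<open>auto intro: le_less_trans[of "ereal _" "ereal (\<tau> m _)"]\<close>)
  next
    case (6 t) then show ?case by (rule ito)
  next
    case 7 show ?case by (rule b_cont)
  next
    case 8 show ?case by (rule \<sigma>_cont)
  next
    case 9 show ?case by (rule opD)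
  next
    case 10 show ?case by (rule bdD)
  next
    case 11 show ?case using x0 by simp
  next
    case 12 show ?case by (rule T)
  next
    case 13 show ?case by (rule C12)
  next
    case (14 t x) then show ?case by (rule gen)
  next
    case (15 t x) then show ?case by (rule v_nonneg)
  next
    case 16 show ?case by (rule R)
  next
    case 17 show ?case by simp
  next
    case (18 x)
    have "norm (b x) \<le> L" using bspec[OF L inB[of 0 x]] T 18 by simp
    then show ?case by simp
  next
    case 19 show ?case by simp
  next
    case (20 t x)
    then have "(t, x) \<in> {0..T} \<times> cball 0 (R + 1)" by simp
    from bspec[OF c this] show ?case by simp
  next
    case (21 t x) from bspec[OF G1 inB[OF 21]] show ?case by simp
  next
    case (22 t x) from bspec[OF G2 inB[OF 22]] show ?case by simp
  next
    case (23 t x) from bspec[OF G3 inB[OF 23]] show ?case by simp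
  qed
  define E where "E m = {\<omega> \<in> space M. T \<le> \<tau> m \<omega> \<and> ?X T \<omega> \<in> S \<and> (\<forall>s\<in>{0..<T}. ?X s \<omega> \<in> D)}" for m
  have E: "E m \<in> sets M" "measure M (E m) \<le> v 0 x0" for m
  proof -
    interpret sd: stopped_diffusion M W b \<sigma> ?X "\<tau> m" x0 D T v vt vx vxx R "max 1 L" "max 0 c" "max G1 (max G2 G3)"
      by (rule sd)
    have "E m = {\<omega> \<in> space M. T \<le> \<tau> m \<omega> \<and> sd.Y T \<omega> \<in> S \<and> (\<forall>s\<in>{0..<T}. sd.Y s \<omega> \<in> D)}"
      unfolding E_def using T by (auto simp: sd.Y_eq_X)
    then show "E m \<in> sets M" "measure M (E m) \<le> v 0 x0"
      using sd.reach_probability_le[OF clS SD fin1] by simp_all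
  qed
  have "incseq E"
    unfolding incseq_Suc_iff E_def using \<tau>(2) by (blast intro: order_trans)
  then have lim: "(\<lambda>m. measure M (E m)) \<longlonglongrightarrow> measure M (\<Union>m. E m)"
    using E(1) by (intro finite_Lim_measure_incseq) auto
  \<comment> \<open>Since \<open>\<tau> m\<close> tends to the explosion time and stays below it,
    \<open>T\<close> precedes the explosion exactly if \<open>T \<le> \<tau> m\<close> for some
    \<open>m\<close>, so the events exhaust the reach-avoid event.\<close>
  have union: "(\<Union>m. E m) = {\<omega> \<in> space M. ereal T < ?\<zeta> \<omega> \<and> ?X T \<omega> \<in> S \<and> (\<forall>s\<in>{0..<T}. ?X s \<omega> \<in> D)}"
  proof -
    have "(\<exists>m. T \<le> \<tau> m \<omega>) \<longleftrightarrow> ereal T < ?\<zeta> \<omega>" if \<omega>: "\<omega> \<in> space M" for \<omega>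
    proof
      assume "\<exists>m. T \<le> \<tau> m \<omega>"
      then obtain m where "T \<le> \<tau> m \<omega>" by blast
      then have "ereal T \<le> ereal (\<tau> m \<omega>)" by simp
      also have "\<dots> < ?\<zeta> \<omega>" by (rule \<tau>(3)[OF \<omega>])
      finally show "ereal T < ?\<zeta> \<omega>" .
    next
      assume "ereal T < ?\<zeta> \<omega>"
      from order_tendstoD(1)[OF \<tau>(4)[OF \<omega>] this] obtain m where "ereal T < ereal (\<tau> m \<omega>)"
        using eventually_happens[of _ sequentially] by auto
      then show "\<exists>m. T \<le> \<tau> m \<omega>" by (intro exI[of _ m]) simp
    qed
    then show ?thesis unfolding E_def by blast
  qed
  have "measure M (\<Union>m. E m) \<le> v 0 x0"
    by (rule LIMSEQ_le_const2[OF lim]) (use E(2) in blast)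
  then show "reach_avoid_prob M ?X ?\<zeta> D S T \<le> v 0 x0"
    unfolding reach_avoid_prob_def union .
qed

end
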